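(* Let $m,d,n$ be integers such that $1 \le d \le n$ and $dn - \binom{d}{2} + 1 \le m\le \binom{n+1}{2}$, and let $G \subseteq \mathrm{Gr}(m,\mathcal{S}^n)$ consist of all $L$ such that $L \cap \mathcal{S}^n_{++} \neq \emptyset$. Then there exists a Zariski-closed proper subset $E \subsetneq G$ such that for every $L\in G$ with $L \notin E$ the following holds: there exists a nonempty open subset $U \subseteq \mathcal{S}^n_{+}(d)$ such that for each matrix $S \in U$, there exists a rank $(n-d)$ PSD matrix $\Omega \in \mathcal{S}^n_{+}\cap L$ such that $\Omega S=0$.
   Context: $\mathcal{S}^n$ is the vector space of real symmetric $n\times n$ matrices, $\mathcal{S}^n_+$ the cone of positive semidefinite (PSD) matrices, $\mathcal{S}^n_{++}$ the open cone of positive definite matrices, and $\mathcal{S}^n_+(d)$ the set of PSD matrices of rank at most $d$. "Open" means relatively open in $\mathcal{S}^n_+(d)$ in the Euclidean topology. $\mathrm{Gr}(m,\mathcal{S}^n)$ is the Grassmannian of $m$-dimensional linear subspaces of $\mathcal{S}^n$, viewed as a real projective variety via Plücker coordinates; $G$ carries the Zariski topology induced from $\mathrm{Gr}(m,\mathcal{S}^n)$. *)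

theory Defs
  imports
    "HOL-Analysis.Analysis"
    "HOL-Library.Poly_Mapping"
    "Jordan_Normal_Form.Determinant"
begin

(* The index type 'n plays the role of {1..n}; a linear order on it is only required so that the
   coordinates of a symmetric matrix are its entries (i, j) with i \<le> j. *)

definition Sym :: "(real^'n^'n) set" where
  "Sym = {A. Finite_Cartesian_Product.transpose A = A}"

definition PSD :: "(real^'n^'n) set" where
  "PSD = {A \<in> Sym. \<forall>x. 0 \<le> inner x (A *v x)}"

definition PD :: "(real^'n^'n) set" where
  "PD = {A \<in> Sym. \<forall>x. x \<noteq> 0 \<longrightarrow> 0 < inner x (A *v x)}"

definition PSD_rank_le :: "nat \<Rightarrow> (real^'n^'n) set" where
  "PSD_rank_le d = {A \<in> PSD. rank A \<le> d}"

definition Gr_Sym :: "nat \<Rightarrow> (real^'n^'n) set set" where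
  "Gr_Sym m = {L. subspace L \<and> L \<subseteq> Sym \<and> dim L = m}"


(* Real polynomials in variables of type 'v, as finitely supported maps from monomials (finitely
   supported exponent vectors) to coefficients. *)
type_synonym 'v rpoly = "('v \<Rightarrow>\<^sub>0 nat) \<Rightarrow>\<^sub>0 real"

definition rpoly_eval :: "('v \<Rightarrow> real) \<Rightarrow> 'v rpoly \<Rightarrow> real" where
  "rpoly_eval x p =
     (\<Sum>t\<in>Poly_Mapping.keys p. Poly_Mapping.lookup p t *
        (\<Prod>v\<in>Poly_Mapping.keys t. x v ^ Poly_Mapping.lookup t v))"

definition rpoly_vars :: "'v rpoly \<Rightarrow> 'v set" where
  "rpoly_vars p = (\<Union>t\<in>Poly_Mapping.keys p. Poly_Mapping.keys t)"

definition rpoly_homogeneous :: "'v rpoly \<Rightarrow> bool" where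
  "rpoly_homogeneous p \<longleftrightarrow>
     (\<exists>k. \<forall>t\<in>Poly_Mapping.keys p. (\<Sum>v\<in>Poly_Mapping.keys t. Poly_Mapping.lookup t v) = k)"


definition ordered_basis :: "(real^'n^'n) list \<Rightarrow> (real^'n^'n) set \<Rightarrow> bool" where
  "ordered_basis bs L \<longleftrightarrow> distinct bs \<and> independent (set bs) \<and> span (set bs) = L"

(* Pluecker coordinates p_I are indexed by all m-tuples I of positions (i, j), i \<le> j, and are
   alternating in I. Tuples with a repetition give 0 and a reordering changes at most the sign, so
   this redundant family defines the same closed sets as the one indexed by increasing tuples. *)
definition plucker_indices :: "nat \<Rightarrow> ('n::linorder \<times> 'n) list set" where
  "plucker_indices m = {I. length I = m \<and> (\<forall>(i, j) \<in> set I. i \<le> j)}"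

(* The m \<times> m minor, with columns I, of the coordinate matrix whose rows are the basis vectors. *)
definition plucker :: "(real^'n^'n) list \<Rightarrow> ('n \<times> 'n) list \<Rightarrow> real" where
  "plucker bs I =
     Determinant.det (Matrix.mat (length bs) (length bs)
       (\<lambda>(a, b). Finite_Cartesian_Product.vec_nth
                   (Finite_Cartesian_Product.vec_nth (bs ! a) (fst (I ! b))) (snd (I ! b))))"

(* Changing the basis rescales all Pluecker coordinates by a common nonzero factor, so for
   homogeneous f the condition below does not depend on the choice of bs. *)
definition Gr_Sym_zariski_closed ::
    "nat \<Rightarrow> (real^'n::{finite,linorder}^'n::{finite,linorder}) set set \<Rightarrow> bool" where
  "Gr_Sym_zariski_closed m Z \<longleftrightarrow>
     (\<exists>F :: ('n \<times> 'n) list rpoly set.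
        (\<forall>f\<in>F. rpoly_homogeneous f \<and> rpoly_vars f \<subseteq> plucker_indices m) \<and>
        Z = {L \<in> Gr_Sym m. \<forall>f\<in>F. \<forall>bs. ordered_basis bs L \<longrightarrow> rpoly_eval (plucker bs) f = 0})"

definition zariski_closed_in ::
    "nat \<Rightarrow> (real^'n::{finite,linorder}^'n::{finite,linorder}) set set \<Rightarrow>
     (real^'n::{finite,linorder}^'n::{finite,linorder}) set set \<Rightarrow> bool" where
  "zariski_closed_in m G E \<longleftrightarrow> (\<exists>Z. Gr_Sym_zariski_closed m Z \<and> E = G \<inter> Z)"

end

theory Submission
  imports Defs
begin

text \<open>Write \<open>W\<close> for the orthogonal complement, in the symmetric matrices with the trace inner product, of a
subspace \<open>L\<close>, and put \<open>r = n - d\<close>. The hypothesis on \<open>m\<close> says exactly that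
\<open>dim W < (r + 1) choose 2\<close>, the dimension of the symmetric matrices supported on an \<open>r\<close>-dimensional
space. Call \<open>L\<close> transversal if \<open>A ** N = 0\<close> with \<open>A \<in> L\<close> and \<open>N \<in> W\<close> forces \<open>A = 0\<close> or
\<open>N = 0\<close>. As these \<open>N\<close> form the normal space at
\<open>A\<close> of the matrices of the same rank, this says that \<open>L\<close> meets all rank strata transversally away from zero. The theorem follows from
two facts: the subspaces that are not transversal satisfy a nontrivial algebraic equation, and every
transversal \<open>L\<close> that contains a positive definite matrix has the asserted property.

\<^bold>\<open>The equation.\<close> Near a coordinate subspace, \<open>L\<close> is the graph of an \<open>m\<close> by \<open>q\<close> matrix with
\<open>m + q = (n + 1) choose 2\<close>. Pairs of symmetric matrices with product zero depend on \<open>m + q\<close> parameters, two of which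
are scalings; asking that \<open>L\<close> contains the first matrix and \<open>W\<close> the second imposes \<open>m + q - 1\<close> linear equations on
the graph, which can be solved for one row and one column of it. So the graphs of non-transversal subspaces
are covered by finitely many rational images of a space of dimension \<open>m * q - 1\<close>
(\<open>nontransversal_in_chart\<close>). Counting monomials shows that a nonzero polynomial vanishes on all of these images
(\<open>common_vanishing_polynomial\<close>). Cramer's rule turns it into a homogeneous polynomial in the Pluecker
coordinates. The chart is chosen around a coordinate subspace that contains the identity matrix, so all
small graphs meet the positive definite cone, and the polynomial does not vanish on all of them.

\<^bold>\<open>Transversal subspaces.\<close> A nonzero semidefinite element of \<open>L\<close> of minimal rank has rank at most \<open>r\<close>,
since otherwise its face meets \<open>L\<close> in dimension at least two and the rank can be lowered
(\<open>exists_low_rank_PSD\<close>). Transversality makes the linearisation \<open>K \<mapsto> A ** K + transpose K ** A\<close> onto modulo \<open>L\<close>, so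
an element of \<open>L\<close> can be moved inside \<open>L\<close> by congruences near the identity
(\<open>perturb_by_congruence\<close>); in particular its rank can be raised one by one, to exactly \<open>r\<close>.

Among the semidefinite \<open>A \<in> L\<close> of rank \<open>r\<close> take one for which the space of all \<open>N \<in> W\<close> with
\<open>A ** N ** A = 0\<close> has the least dimension. Suppose it is not zero. A dimension count gives a symmetric \<open>X\<close> such
that \<open>A ** X ** A\<close> lies in \<open>L\<close> and is not a multiple of \<open>A\<close>. As the dimension cannot drop along congruences to first order,
every such \<open>N\<close> has a partner \<open>N'\<close> in \<open>W\<close> with \<open>A ** X ** A ** N = A ** N'\<close> (\<open>first_order_rigidity\<close>). The map
\<open>N \<mapsto> N'\<close> is self-adjoint for the form given by \<open>A\<close>, hence has a real eigenvector \<open>N\<close>, with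
eigenvalue \<open>l\<close> say. Then \<open>A ** X ** A - l *\<^sub>R A\<close> and \<open>N\<close> contradict transversality
(\<open>exists_face_transversal_point\<close>).

So \<open>L\<close> and the symmetric matrices supported on the range of \<open>A\<close> span all symmetric matrices. This is
stable when the range moves. Hence for every semidefinite \<open>S\<close> of rank at most \<open>d\<close> near the orthogonal projection
onto the null space of \<open>A\<close> some \<open>X \<in> L\<close> near \<open>A\<close> satisfies \<open>X ** S = 0\<close>, and nearness to \<open>A\<close> makes it
semidefinite of rank \<open>r\<close> (\<open>nearby_kernels_are_hit\<close>).\<close>

section \<open>Symmetric matrices under the trace inner product\<close>

hide_const (open) List.transpose Matrix.vec Matrix.mat Matrix.orthogonal Determinant.det
no_notation vec_index (infixl \<open>$\<close> 100)
no_notation scalar_prod (infix \<open>\<bullet>\<close> 70)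
hide_fact (open) Matrix.vec_eq_iff
unbundle inner_syntax

lemma bounded_bilinear_matrix_mult:
  "bounded_bilinear ((**) :: real^'n^'n \<Rightarrow> real^'n^'n \<Rightarrow> real^'n^'n)"
proof -
  have "bilinear ((**) :: real^'n^'n \<Rightarrow> real^'n^'n \<Rightarrow> real^'n^'n)"
    unfolding bilinear_def
    by (auto intro!: linearI simp: matrix_matrix_mult_def vec_eq_iff algebra_simps sum.distrib
        sum_distrib_left)
  then show ?thesis by (simp add: bilinear_conv_bounded_bilinear)
qed

interpretation mm: bounded_bilinear "(**) :: real^'n^'n \<Rightarrow> real^'n^'n \<Rightarrow> real^'n^'n"
  by (rule bounded_bilinear_matrix_mult)

lemma bounded_bilinear_matrix_vector:
  "bounded_bilinear ((*v) :: real^'n^'n \<Rightarrow> real^'n \<Rightarrow> real^'n)"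
proof -
  have "bilinear ((*v) :: real^'n^'n \<Rightarrow> real^'n \<Rightarrow> real^'n)"
    unfolding bilinear_def
    by (auto intro!: linearI simp: matrix_vector_mult_def vec_eq_iff algebra_simps sum.distrib
        sum_distrib_left)
  then show ?thesis by (simp add: bilinear_conv_bounded_bilinear)
qed

interpretation mv: bounded_bilinear "(*v) :: real^'n^'n \<Rightarrow> real^'n \<Rightarrow> real^'n"
  by (rule bounded_bilinear_matrix_vector)

lemma linear_transpose: "linear (transpose :: real^'n^'n \<Rightarrow> real^'n^'n)"
  by (rule linearI) (auto simp: transpose_def vec_eq_iff)

lemmas transpose_add = linear_add[OF linear_transpose]
  and transpose_diff = linear_diff[OF linear_transpose]
  and transpose_scaleR = linear_scale[OF linear_transpose]

lemma tendsto_transpose [tendsto_intros]: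
  fixes f :: "_ \<Rightarrow> real^'n^'n"
  shows "(f \<longlongrightarrow> a) F \<Longrightarrow> ((\<lambda>x. transpose (f x)) \<longlongrightarrow> transpose a) F"
  by (rule bounded_linear.tendsto[OF linear_conv_bounded_linear[THEN iffD1, OF linear_transpose]])

lemma continuous_on_transpose [continuous_intros]:
  fixes f :: "_ \<Rightarrow> real^'n^'n"
  shows "continuous_on S f \<Longrightarrow> continuous_on S (\<lambda>x. transpose (f x))"
  by (rule bounded_linear.continuous_on[OF linear_conv_bounded_linear[THEN iffD1, OF linear_transpose]])

lemma inner_matrix: "A \<bullet> B = (\<Sum>i\<in>UNIV. \<Sum>j\<in>UNIV. A$i$j * B$i$j)" for A B :: "real^'n^'n"
  by (simp add: inner_vec_def)

lemma inner_mult_left: "(A ** B) \<bullet> C = B \<bullet> (transpose A ** C)" for A B C :: "real^'n^'n"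
proof -
  have "(A ** B) \<bullet> C = (\<Sum>i\<in>UNIV. \<Sum>j\<in>UNIV. \<Sum>k\<in>UNIV. A$i$k * B$k$j * C$i$j)"
    by (simp add: inner_matrix matrix_matrix_mult_def sum_distrib_right)
  also have "\<dots> = (\<Sum>i\<in>UNIV. \<Sum>k\<in>UNIV. \<Sum>j\<in>UNIV. A$i$k * B$k$j * C$i$j)"
    by (rule sum.cong[OF refl], rule sum.swap)
  also have "\<dots> = (\<Sum>k\<in>UNIV. \<Sum>i\<in>UNIV. \<Sum>j\<in>UNIV. A$i$k * B$k$j * C$i$j)"
    by (rule sum.swap)
  also have "\<dots> = (\<Sum>k\<in>UNIV. \<Sum>j\<in>UNIV. \<Sum>i\<in>UNIV. A$i$k * B$k$j * C$i$j)"
    by (rule sum.cong[OF refl], rule sum.swap)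
  also have "\<dots> = B \<bullet> (transpose A ** C)"
    by (simp add: inner_matrix matrix_matrix_mult_def transpose_def sum_distrib_left
        mult.commute mult.left_commute)
  finally show ?thesis .
qed

lemma inner_transpose: "transpose A \<bullet> transpose B = A \<bullet> B" for A B :: "real^'n^'n"
  unfolding inner_matrix transpose_def by (simp, rule sum.swap)

lemma inner_mult_right: "(A ** B) \<bullet> C = A \<bullet> (C ** transpose B)" for A B C :: "real^'n^'n"
proof -
  have "(A ** B) \<bullet> C = (transpose B ** transpose A) \<bullet> transpose C"
    by (metis inner_transpose matrix_transpose_mul)
  also have "\<dots> = transpose A \<bullet> transpose (C ** transpose B)"
    by (simp add: inner_mult_left matrix_transpose_mul)
  finally show ?thesis by (simp add: inner_transpose)
qed

lemma inner_matrix_vector: "(A *v x) \<bullet> y = x \<bullet> (transpose A *v y)" for A :: "real^'n^'n"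
  by (metis dot_lmul_matrix transpose_matrix_vector inner_commute)

lemma Sym_iff: "A \<in> Sym \<longleftrightarrow> transpose A = A"
  by (simp add: Sym_def)

lemma subspace_Sym: "subspace (Sym :: (real^'n^'n) set)"
  unfolding subspace_def Sym_def
  by (auto simp: transpose_add transpose_scaleR linear_0[OF linear_transpose])

lemma Sym_inner: "A \<in> Sym \<Longrightarrow> (A *v x) \<bullet> y = x \<bullet> (A *v y)"
  by (simp only: inner_matrix_vector Sym_iff)

lemma Sym_congr: "A \<in> Sym \<Longrightarrow> transpose G ** A ** G \<in> Sym"
  and Sym_congr': "A \<in> Sym \<Longrightarrow> G ** A ** transpose G \<in> Sym"
  by (simp_all add: Sym_iff matrix_transpose_mul matrix_mul_assoc)

lemma Sym_sandwich: "A \<in> Sym \<Longrightarrow> X \<in> Sym \<Longrightarrow> A ** X ** A \<in> Sym"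
  by (simp add: Sym_iff matrix_transpose_mul matrix_mul_assoc)

lemma PSD_imp: "A \<in> PSD \<Longrightarrow> A \<in> Sym" "A \<in> PSD \<Longrightarrow> 0 \<le> x \<bullet> (A *v x)"
  by (auto simp: PSD_def)

lemma norm_matrix_vector_le: "norm (A *v x) \<le> norm A * norm x" for A :: "real^'n^'n"
proof -
  have "norm (A *v x) \<le> sqrt (\<Sum>i\<in>UNIV. (norm (A$i) * norm x)\<^sup>2)"
    unfolding norm_vec_def[of "A *v x"] L2_set_def
    apply (rule real_sqrt_le_mono, rule sum_mono, rule power_mono)
    using Cauchy_Schwarz_ineq2[of "A$_" x]
    by (auto simp: matrix_vector_mult_def inner_vec_def)
  also have "\<dots> = norm A * norm x"
    by (simp add: norm_vec_def[of A] L2_set_def power_mult_distrib real_sqrt_mult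
        flip: sum_distrib_right)
  finally show ?thesis .
qed

text \<open>Both \<open>PSD_form_zero\<close> and \<open>max_ratio_eigenvector\<close> vary a form at a point where it attains its extreme value; the expression below is its increment in a fixed direction.\<close>

lemma nonneg_quadratic_linear_part_zero:
  fixes p q :: real
  assumes pos: "\<And>t. 0 \<le> t * (2 * p + t * q)"
  shows "p = 0"
proof (rule ccontr)
  assume p: "p \<noteq> 0"
  have q: "0 \<le> q" using pos[of 1] pos[of "-1"] by simp
  \<comment> \<open>The minimiser \<open>- p / q\<close>, with the denominator shifted so that \<open>q = 0\<close> is covered.\<close>
  have "0 \<le> (- p / (q + 1)) * (2 * p + (- p / (q + 1)) * q)" by (rule pos)
  also have "\<dots> = - (p\<^sup>2 * (q + 2)) / (q + 1)\<^sup>2"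
    using q by (simp add: divide_simps power2_eq_square) (simp add: algebra_simps)
  also have "\<dots> < 0" using p q by (auto intro!: divide_neg_pos)
  finally show False by simp
qed

lemma PSD_form_zero:
  assumes A: "A \<in> PSD" and x: "x \<bullet> (A *v x) = 0"
  shows "A *v x = 0"
proof -
  define y where "y = A *v x"
  have "0 \<le> t * (2 * (y \<bullet> (A *v x)) + t * (y \<bullet> (A *v y)))" for t
  proof -
    have "0 \<le> (x + t *\<^sub>R y) \<bullet> (A *v (x + t *\<^sub>R y))" using A by (rule PSD_imp)
    also have "\<dots> = t * (2 * (y \<bullet> (A *v x)) + t * (y \<bullet> (A *v y)))"
      using x Sym_inner[OF PSD_imp(1)[OF A], of x y]
      by (simp add: mv.add_right mv.scaleR_right inner_add_left inner_add_right
          inner_commute algebra_simps)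
    finally show ?thesis .
  qed
  then have "y \<bullet> (A *v x) = 0" by (rule nonneg_quadratic_linear_part_zero)
  then show ?thesis by (simp add: y_def)
qed

lemma inner_columns: "A \<bullet> B = (\<Sum>j\<in>UNIV. column j A \<bullet> column j B)" for A B :: "real^'n^'n"
  unfolding inner_matrix column_def inner_vec_def by (simp, rule sum.swap)

lemma column_mult: "column j (A ** B) = A *v column j B" for A B :: "real^'n^'n"
  by (simp add: column_def matrix_matrix_mult_def matrix_vector_mult_def vec_eq_iff)

lemma PSD_inner_mult_nonneg: fixes M :: "real^'n^'n" shows "A \<in> PSD \<Longrightarrow> 0 \<le> M \<bullet> (A ** M)"
  by (simp add: inner_columns column_mult PSD_imp sum_nonneg)

lemma PSD_inner_mult_zero: fixes M :: "real^'n^'n" assumes "A \<in> PSD" "M \<bullet> (A ** M) = 0" shows "A ** M = 0"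
proof -
  have "column j M \<bullet> (A *v column j M) = 0" for j
    using assms by (auto simp: inner_columns column_mult PSD_imp sum_nonneg_eq_0_iff)
  then have "column j (A ** M) = 0" for j
    using PSD_form_zero[OF assms(1)] by (simp add: column_mult)
  then show ?thesis by (simp add: column_def vec_eq_iff)
qed

text \<open>Rank-nullity on a subspace: the map is injective on the orthogonal complement of its kernel, and that complement has the same image.\<close>

lemma dim_kernel_plus_dim_image:
  fixes f :: "'a::euclidean_space \<Rightarrow> 'b::euclidean_space"
  assumes f: "linear f" and U: "subspace U"
  shows "dim U = dim {x\<in>U. f x = 0} + dim (f ` U)"
proof -
  define K where "K = {x\<in>U. f x = 0}"
  define C where "C = {y\<in>U. \<forall>x\<in>K. orthogonal x y}"
  have K: "subspace K" "K \<subseteq> U"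
    using f U unfolding K_def subspace_def
    by (auto simp: linear_0 linear_add linear_scale)
  have d: "dim C + dim K = dim U"
    unfolding C_def by (rule dim_subspace_orthogonal_to_vectors[OF K(1) U K(2)])
  have C: "subspace C" "C \<subseteq> U"
    using U unfolding C_def subspace_def
    by (auto simp: orthogonal_clauses)
  have "inj_on f (span C)"
  proof -
    have "x = 0" if "x \<in> C" "f x = 0" for x
    proof -
      have "x \<in> K" using that C by (auto simp: K_def)
      then have "orthogonal x x" using that by (auto simp: C_def)
      then show ?thesis by (simp add: orthogonal_self)
    qed
    then show ?thesis
      using linear_injective_on_subspace_0[OF f, of "span C"] C
      by (metis span_eq_iff)
  qed
  then have "dim (f ` C) = dim C" by (rule dim_image_eq[OF f])
  moreover have "f ` U \<subseteq> f ` C"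
  proof
    fix z assume "z \<in> f ` U"
    then obtain u where u: "u \<in> U" "z = f u" by auto
    obtain y w where yw: "y \<in> span K" "\<And>v. v \<in> span K \<Longrightarrow> orthogonal w v" "u = y + w"
      using orthogonal_subspace_decomp_exists[of K u] by metis
    have sK: "span K = K" using K by simp
    have "y \<in> K" using yw(1) by (simp only: sK)
    then have y: "y \<in> U" "f y = 0" by (auto simp: K_def)
    have "w \<in> U" using yw(3) u y U by (metis add_diff_cancel_left' subspace_diff)
    moreover have "orthogonal v w" if "v \<in> K" for v
      using yw(2)[of v] that by (simp add: sK orthogonal_commute)
    ultimately have "w \<in> C" by (auto simp: C_def)
    moreover have "z = f w" using u yw y f by (simp add: linear_add)
    ultimately show "z \<in> f ` C" by auto
  qed
  then have "f ` U = f ` C" using C by auto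
  ultimately show ?thesis using d by (simp add: K_def)
qed

definition null_space :: "real^'n^'n \<Rightarrow> (real^'n) set" where
  "null_space A = {x. A *v x = 0}"

lemma subspace_null_space: "subspace (null_space A)"
  unfolding null_space_def subspace_def by (auto simp: mv.add_right mv.scaleR_right)

lemma rank_plus_dim_null_space: "rank A + dim (null_space A) = CARD('n)" for A :: "real^'n^'n"
  using dim_kernel_plus_dim_image[of "(*v) A" UNIV]
  by (simp add: rank_dim_range null_space_def)

lemma rank_congr:
  fixes A G :: "real^'n^'n"
  assumes "inj ((*v) G)" 
  shows "rank (transpose G ** A ** G) = rank A"
proof -
  have G: "surj ((*v) G)" using assms linear_injective_imp_surjective[of "(*v) G"] by auto
  \<comment> \<open>The null space of the transpose is orthogonal to the range, which is everything.\<close>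
  have tG: "inj ((*v) (transpose G))"
  proof (subst linear_injective_0)
    show "linear ((*v) (transpose G))" by simp
    show "\<forall>x. transpose G *v x = 0 \<longrightarrow> x = 0"
    proof (intro allI impI)
      fix x assume x: "transpose G *v x = 0"
      obtain y where "x = G *v y" using G by (metis surjD)
      then have "x \<bullet> x = y \<bullet> (transpose G *v x)" by (metis inner_matrix_vector)
      then show "x = 0" by (simp add: x del: transpose_matrix_vector)
    qed
  qed
  have "range ((*v) (transpose G ** A ** G)) = (*v) (transpose G) ` (range ((*v) A))"
    using G by (auto simp: matrix_vector_mul_assoc[symmetric] surj_def image_iff) metis+
  then have "rank (transpose G ** A ** G) = dim ((*v) (transpose G) ` (range ((*v) A)))"
    by (simp add: rank_dim_range)
  also have "\<dots> = dim (range ((*v) A))"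
    by (rule dim_image_eq) (use tG in \<open>auto intro: inj_on_subset\<close>)
  finally show ?thesis by (simp add: rank_dim_range)
qed

section \<open>Polynomials vanishing on images of low-dimensional spaces\<close>

text \<open>Gaussian elimination on the equations: one equation is used to eliminate one unknown from all the others.\<close>

lemma underdetermined_system:
  fixes M :: "'b \<Rightarrow> 'g \<Rightarrow> real"
  assumes "finite G" "finite B" "card G < card B"
  shows "\<exists>c. (\<exists>\<beta>\<in>B. c \<beta> \<noteq> 0) \<and> (\<forall>\<gamma>\<in>G. (\<Sum>\<beta>\<in>B. c \<beta> * M \<beta> \<gamma>) = 0)"
  using assms
proof (induction G arbitrary: B M rule: finite_induct)
  case empty
  then have "B \<noteq> {}" by auto
  then show ?case by (intro exI[of _ "\<lambda>_. 1"]) auto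
next
  case (insert g G)
  show ?case
  proof (cases "\<forall>\<beta>\<in>B. M \<beta> g = 0")
    case True
    have "card G < card B" using insert by simp
    then obtain c where "(\<exists>\<beta>\<in>B. c \<beta> \<noteq> 0) \<and> (\<forall>\<gamma>\<in>G. (\<Sum>\<beta>\<in>B. c \<beta> * M \<beta> \<gamma>) = 0)"
      using insert.IH[of B M] insert.prems by blast
    then show ?thesis using True by (intro exI[of _ c]) auto
  next
    case False
    then obtain b where b: "b \<in> B" "M b g \<noteq> 0" by blast
    define B' where "B' = B - {b}"
    define M' where "M' \<beta> \<gamma> = M \<beta> \<gamma> - M \<beta> g / M b g * M b \<gamma>" for \<beta> \<gamma>
    have "finite B'" "card G < card B'" using insert b by (auto simp: B'_def)
    then obtain c where c: "\<exists>\<beta>\<in>B'. c \<beta> \<noteq> 0" "\<And>\<gamma>. \<gamma> \<in> G \<Longrightarrow> (\<Sum>\<beta>\<in>B'. c \<beta> * M' \<beta> \<gamma>) = 0"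
      using insert.IH[of B' M'] by blast
    define s where "s = - (\<Sum>\<beta>\<in>B'. c \<beta> * M \<beta> g) / M b g"
    define c' where "c' = c(b := s)"
    have sum: "(\<Sum>\<beta>\<in>B. c' \<beta> * M \<beta> \<gamma>) = s * M b \<gamma> + (\<Sum>\<beta>\<in>B'. c \<beta> * M \<beta> \<gamma>)" for \<gamma>
    proof -
      have "(\<Sum>\<beta>\<in>B. c' \<beta> * M \<beta> \<gamma>) = c' b * M b \<gamma> + (\<Sum>\<beta>\<in>B'. c' \<beta> * M \<beta> \<gamma>)"
        unfolding B'_def by (rule sum.remove) (use insert b in auto)
      also have "(\<Sum>\<beta>\<in>B'. c' \<beta> * M \<beta> \<gamma>) = (\<Sum>\<beta>\<in>B'. c \<beta> * M \<beta> \<gamma>)"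
        by (rule sum.cong) (auto simp: c'_def B'_def)
      finally show ?thesis by (simp add: c'_def)
    qed
    have "(\<Sum>\<beta>\<in>B. c' \<beta> * M \<beta> \<gamma>) = 0" if "\<gamma> \<in> insert g G" for \<gamma>
    proof (cases "\<gamma> = g")
      case True
      then show ?thesis using b by (simp add: sum s_def)
    next
      case False
      then have "(\<Sum>\<beta>\<in>B'. c \<beta> * M' \<beta> \<gamma>) = 0" using c(2) that by simp
      moreover have "(\<Sum>\<beta>\<in>B'. c \<beta> * M' \<beta> \<gamma>) = (\<Sum>\<beta>\<in>B'. c \<beta> * M \<beta> \<gamma>)
          - (\<Sum>\<beta>\<in>B'. c \<beta> * M \<beta> g) / M b g * M b \<gamma>"
        by (simp add: M'_def right_diff_distrib sum_subtractf sum_divide_distrib sum_distrib_right mult.assoc)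
      ultimately show ?thesis by (simp add: sum s_def)
    qed
    moreover have "\<exists>\<beta>\<in>B. c' \<beta> \<noteq> 0" using c(1) by (auto simp: c'_def B'_def)
    ultimately show ?thesis by blast
  qed
qed

text \<open>The degree is bounded in each variable separately, so that the monomials in question form a product set and are counted by a power.\<close>

definition box_poly :: "'v set \<Rightarrow> nat \<Rightarrow> (('v \<Rightarrow> real) \<Rightarrow> real) \<Rightarrow> bool" where
  "box_poly V D f \<longleftrightarrow> (\<exists>c. \<forall>x. f x = (\<Sum>\<gamma>\<in>V \<rightarrow>\<^sub>E {..D}. c \<gamma> * (\<Prod>v\<in>V. x v ^ \<gamma> v)))"

lemma box_poly_zero: "box_poly V D (\<lambda>x. 0)"
  unfolding box_poly_def by (rule exI[of _ "\<lambda>_. 0"]) simp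

lemma box_poly_add: assumes "box_poly V D f" "box_poly V D g" shows "box_poly V D (\<lambda>x. f x + g x)"
proof -
  obtain c e where "\<And>x. f x = (\<Sum>\<gamma>\<in>V \<rightarrow>\<^sub>E {..D}. c \<gamma> * (\<Prod>v\<in>V. x v ^ \<gamma> v))"
    "\<And>x. g x = (\<Sum>\<gamma>\<in>V \<rightarrow>\<^sub>E {..D}. e \<gamma> * (\<Prod>v\<in>V. x v ^ \<gamma> v))"
    using assms unfolding box_poly_def by blast
  then show ?thesis unfolding box_poly_def
    by (intro exI[of _ "\<lambda>\<gamma>. c \<gamma> + e \<gamma>"]) (simp add: distrib_right sum.distrib)
qed

lemma box_poly_sum:
  assumes "\<And>i. i \<in> S \<Longrightarrow> box_poly V D (f i)"
  shows "box_poly V D (\<lambda>x. \<Sum>i\<in>S. f i x)"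
  using assms by (induction S rule: infinite_finite_induct) (auto intro: box_poly_zero box_poly_add)

lemma box_poly_monomial:
  assumes V: "finite V" and g: "\<And>v. v \<in> V \<Longrightarrow> \<gamma> v \<le> D"
  shows "box_poly V D (\<lambda>x. a * (\<Prod>v\<in>V. x v ^ \<gamma> v))"
proof -
  define \<gamma>' where "\<gamma>' = restrict \<gamma> V"
  have m: "\<gamma>' \<in> V \<rightarrow>\<^sub>E {..D}" using g by (auto simp: \<gamma>'_def)
  have fin: "finite (V \<rightarrow>\<^sub>E {..D})" using V by (simp add: finite_PiE)
  have "(\<Sum>\<delta>\<in>V \<rightarrow>\<^sub>E {..D}. (if \<delta> = \<gamma>' then a else 0) * (\<Prod>v\<in>V. x v ^ \<delta> v))
      = a * (\<Prod>v\<in>V. x v ^ \<gamma> v)" for x :: "'a \<Rightarrow> real"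
  proof -
    have "(\<Sum>\<delta>\<in>V \<rightarrow>\<^sub>E {..D}. (if \<delta> = \<gamma>' then a else 0) * (\<Prod>v\<in>V. x v ^ \<delta> v))
      = (\<Sum>\<delta>\<in>V \<rightarrow>\<^sub>E {..D}. if \<delta> = \<gamma>' then a * (\<Prod>v\<in>V. x v ^ \<gamma>' v) else 0)"
      by (rule sum.cong) auto
    also have "\<dots> = a * (\<Prod>v\<in>V. x v ^ \<gamma>' v)" using fin m by simp
    also have "(\<Prod>v\<in>V. x v ^ \<gamma>' v) = (\<Prod>v\<in>V. x v ^ \<gamma> v)" by (rule prod.cong) (auto simp: \<gamma>'_def)
    finally show ?thesis .
  qed
  then show ?thesis unfolding box_poly_def
    by (intro exI[of _ "\<lambda>\<delta>. if \<delta> = \<gamma>' then a else 0"]) simp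
qed

lemma box_poly_mult:
  assumes V: "finite V" and f: "box_poly V D f" and g: "box_poly V E g"
  shows "box_poly V (D + E) (\<lambda>x. f x * g x)"
proof -
  obtain c e where ce: "\<And>x. f x = (\<Sum>\<gamma>\<in>V \<rightarrow>\<^sub>E {..D}. c \<gamma> * (\<Prod>v\<in>V. x v ^ \<gamma> v))"
    "\<And>x. g x = (\<Sum>\<gamma>\<in>V \<rightarrow>\<^sub>E {..E}. e \<gamma> * (\<Prod>v\<in>V. x v ^ \<gamma> v))"
    using assms unfolding box_poly_def by blast
  have "f x * g x = (\<Sum>\<gamma>\<in>V \<rightarrow>\<^sub>E {..D}. \<Sum>\<delta>\<in>V \<rightarrow>\<^sub>E {..E}.
      (c \<gamma> * e \<delta>) * (\<Prod>v\<in>V. x v ^ (\<gamma> v + \<delta> v)))" for x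
    by (simp add: ce sum_product power_add prod.distrib mult_ac)
  moreover have "box_poly V (D + E) (\<lambda>x. \<Sum>\<gamma>\<in>V \<rightarrow>\<^sub>E {..D}. \<Sum>\<delta>\<in>V \<rightarrow>\<^sub>E {..E}.
      (c \<gamma> * e \<delta>) * (\<Prod>v\<in>V. x v ^ (\<gamma> v + \<delta> v)))"
    by (intro box_poly_sum box_poly_monomial V) (auto simp: PiE_iff intro!: add_mono)
  ultimately show ?thesis by simp
qed

lemma box_poly_const: "finite V \<Longrightarrow> box_poly V D (\<lambda>x. a)"
  using box_poly_monomial[of V "\<lambda>_. 0" D a] by simp

lemma box_poly_var: assumes "finite V" "v \<in> V" shows "box_poly V 1 (\<lambda>x. x v)"
proof -
  have "box_poly V 1 (\<lambda>x. 1 * (\<Prod>u\<in>V. x u ^ (if u = v then 1 else 0)))"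
    by (rule box_poly_monomial) (use assms in auto)
  moreover have "(\<Prod>u\<in>V. x u ^ (if u = v then 1 else 0)) = x v" for x :: "'a \<Rightarrow> real"
  proof -
    have "(\<Prod>u\<in>V. x u ^ (if u = v then 1 else 0)) = (\<Prod>u\<in>V. if u = v then x v else 1)"
      by (rule prod.cong) auto
    then show ?thesis using assms by simp
  qed
  ultimately show ?thesis by simp
qed

lemma box_poly_mono:
  assumes V: "finite V" and f: "box_poly V D f" and "D \<le> E"
  shows "box_poly V E f"
proof -
  have "box_poly V (D + (E - D)) (\<lambda>x. f x * 1)"
    by (rule box_poly_mult[OF V f box_poly_const[OF V]])
  then show ?thesis using assms by simp
qed

lemma box_poly_power:
  assumes V: "finite V" and f: "box_poly V D f"
  shows "box_poly V (D * k) (\<lambda>x. f x ^ k)"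
proof (induction k)
  case 0
  then show ?case using box_poly_const[OF V, of 0 1] by simp
next
  case (Suc k)
  then show ?case using box_poly_mult[OF V f Suc] by simp
qed

lemma box_poly_prod:
  assumes V: "finite V" and f: "\<And>i. i \<in> S \<Longrightarrow> box_poly V D (f i)" and S: "finite S"
  shows "box_poly V (D * card S) (\<lambda>x. \<Prod>i\<in>S. f i x)"
  using S f
proof (induction S rule: finite_induct)
  case empty
  then show ?case using box_poly_const[OF V, of 0 1] by simp
next
  case (insert i S)
  then have "box_poly V (D + D * card S) (\<lambda>x. f i x * (\<Prod>i\<in>S. f i x))"
    by (intro box_poly_mult[OF V]) auto
  then show ?case using insert by simp
qed

definition poly_function :: "'v set \<Rightarrow> (('v \<Rightarrow> real) \<Rightarrow> real) \<Rightarrow> bool" where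
  "poly_function V f \<longleftrightarrow> (\<exists>D. box_poly V D f)"

context
  fixes V :: "'v set"
  assumes V: "finite V"
begin

lemma poly_function_const: "poly_function V (\<lambda>x. a)"
  using box_poly_const[OF V] unfolding poly_function_def by blast

lemma poly_function_var: "v \<in> V \<Longrightarrow> poly_function V (\<lambda>x. x v)"
  using box_poly_var[OF V] unfolding poly_function_def by blast

lemma poly_function_mult: "poly_function V f \<Longrightarrow> poly_function V g \<Longrightarrow> poly_function V (\<lambda>x. f x * g x)"
  using box_poly_mult[OF V] unfolding poly_function_def by blast

lemma poly_function_add:
  assumes "poly_function V f" "poly_function V g" shows "poly_function V (\<lambda>x. f x + g x)"
proof -
  obtain D E where "box_poly V D f" "box_poly V E g" using assms unfolding poly_function_def by blast
  then have "box_poly V (max D E) f" "box_poly V (max D E) g" by (auto intro: box_poly_mono[OF V])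
  then show ?thesis unfolding poly_function_def by (blast intro: box_poly_add)
qed

lemma poly_function_uminus: "poly_function V f \<Longrightarrow> poly_function V (\<lambda>x. - f x)"
  using poly_function_mult[OF poly_function_const[of "-1"]] by fastforce

lemma poly_function_diff: "poly_function V f \<Longrightarrow> poly_function V g \<Longrightarrow> poly_function V (\<lambda>x. f x - g x)"
  using poly_function_add[OF _ poly_function_uminus] by fastforce

lemma poly_function_sum: "(\<And>i. i \<in> S \<Longrightarrow> poly_function V (f i)) \<Longrightarrow> poly_function V (\<lambda>x. \<Sum>i\<in>S. f i x)"
  by (induction S rule: infinite_finite_induct) (auto intro: poly_function_const poly_function_add)

end

text \<open>The images of finitely many rational maps from spaces of dimension less than \<open>card B\<close> into \<open>B\<close>-space satisfy a
common polynomial equation. With \<open>b = card B\<close>, there are \<open>(K + 1) ^ b\<close> monomials with all exponents at most \<open>K\<close>;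
composed with one of the maps and cleared of denominators, they lie in the span of \<open>O(K ^ (b - 1))\<close> monomials. For
large \<open>K\<close> there are more unknown coefficients than conditions.\<close>

lemma common_vanishing_polynomial:
  fixes P :: "'t \<Rightarrow> 'e \<Rightarrow> ('v \<Rightarrow> real) \<Rightarrow> real" and h :: "'t \<Rightarrow> ('v \<Rightarrow> real) \<Rightarrow> real"
  assumes B: "finite B" and T: "finite T"
    and V: "\<And>t. t \<in> T \<Longrightarrow> finite (V t)" "\<And>t. t \<in> T \<Longrightarrow> card (V t) < card B"
    and P: "\<And>t e. t \<in> T \<Longrightarrow> e \<in> B \<Longrightarrow> poly_function (V t) (P t e)"
    and h: "\<And>t. t \<in> T \<Longrightarrow> poly_function (V t) (h t)"
  obtains K c where "\<exists>\<beta>\<in>B \<rightarrow>\<^sub>E {..K::nat}. c \<beta> \<noteq> (0::real)"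
    "\<And>t x. t \<in> T \<Longrightarrow> h t x \<noteq> 0 \<Longrightarrow> (\<Sum>\<beta>\<in>B \<rightarrow>\<^sub>E {..K}. c \<beta> * (\<Prod>e\<in>B. (P t e x / h t x) ^ \<beta> e)) = 0"
proof -
  define DP where "DP t e = (SOME D. box_poly (V t) D (P t e))" for t e
  have DP: "box_poly (V t) (DP t e) (P t e)" if "t \<in> T" "e \<in> B" for t e
    unfolding DP_def using P[OF that] unfolding poly_function_def by (rule someI_ex)
  define Dh where "Dh t = (SOME D. box_poly (V t) D (h t))" for t
  have Dh: "box_poly (V t) (Dh t) (h t)" if "t \<in> T" for t
    unfolding Dh_def using h[OF that] unfolding poly_function_def by (rule someI_ex)
  define \<delta> where "\<delta> = (\<Sum>t\<in>T. Dh t) + (\<Sum>p\<in>T\<times>B. DP (fst p) (snd p))"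
  have P': "box_poly (V t) \<delta> (P t e)" if "t \<in> T" "e \<in> B" for t e
  proof (rule box_poly_mono[OF V(1)[OF that(1)] DP[OF that]])
    have "DP (fst (t, e)) (snd (t, e)) \<le> (\<Sum>p\<in>T\<times>B. DP (fst p) (snd p))"
      by (rule member_le_sum) (use that B T in auto)
    then show "DP t e \<le> \<delta>" by (simp add: \<delta>_def)
  qed
  have h': "box_poly (V t) \<delta> (h t)" if "t \<in> T" for t
  proof (rule box_poly_mono[OF V(1)[OF that] Dh[OF that]])
    have "Dh t \<le> (\<Sum>t\<in>T. Dh t)" by (rule member_le_sum) (use that T in auto)
    then show "Dh t \<le> \<delta>" by (simp add: \<delta>_def)
  qed
  define b where "b = card B"
  \<comment> \<open>Large enough for the conditions below to be fewer than the monomials.\<close>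
  define K where "K = card T * (\<delta> * b + 1) ^ (b - 1)"
  \<comment> \<open>The \<open>\<beta>\<close>-monomial in the fractions, multiplied by the \<open>(K * b)\<close>-th power of the denominator.\<close>
  define Q where "Q t \<beta> x = (\<Prod>e\<in>B. P t e x ^ \<beta> e * h t x ^ (K - \<beta> e))" for t \<beta> x
  \<comment> \<open>The conditions: all coefficients of the composed polynomial, for every map, must vanish.\<close>
  define R where "R = Sigma T (\<lambda>t. V t \<rightarrow>\<^sub>E {..\<delta> * K * b})"
  have Qpoly: "box_poly (V t) (\<delta> * K * b) (Q t \<beta>)" if t: "t \<in> T" and \<beta>: "\<beta> \<in> B \<rightarrow>\<^sub>E {..K}" for t \<beta>
    unfolding Q_def b_def
  proof (rule box_poly_prod[OF V(1)[OF t] _ B])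
    fix e assume e: "e \<in> B"
    have "box_poly (V t) (\<delta> * \<beta> e + \<delta> * (K - \<beta> e)) (\<lambda>x. P t e x ^ \<beta> e * h t x ^ (K - \<beta> e))"
      by (intro box_poly_mult box_poly_power V(1) P' h' t e)
    moreover have "\<delta> * \<beta> e + \<delta> * (K - \<beta> e) = \<delta> * K"
      using \<beta> e by (auto simp: PiE_iff simp flip: distrib_left)
    ultimately show "box_poly (V t) (\<delta> * K) (\<lambda>x. P t e x ^ \<beta> e * h t x ^ (K - \<beta> e))" by simp
  qed
  define q where "q t \<beta> = (SOME q. \<forall>x. Q t \<beta> x =
      (\<Sum>\<gamma>\<in>V t \<rightarrow>\<^sub>E {..\<delta> * K * b}. q \<gamma> * (\<Prod>v\<in>V t. x v ^ \<gamma> v)))" for t \<beta>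
  have q: "Q t \<beta> x = (\<Sum>\<gamma>\<in>V t \<rightarrow>\<^sub>E {..\<delta> * K * b}. q t \<beta> \<gamma> * (\<Prod>v\<in>V t. x v ^ \<gamma> v))"
    if "t \<in> T" "\<beta> \<in> B \<rightarrow>\<^sub>E {..K}" for t \<beta> x
    using someI_ex[OF Qpoly[OF that, unfolded box_poly_def]] unfolding q_def by blast
  have finB: "finite (B \<rightarrow>\<^sub>E {..K})" using B by (simp add: finite_PiE)
  have finR: "finite R" unfolding R_def using T V(1) by (auto intro!: finite_PiE)
  have cardB: "card (B \<rightarrow>\<^sub>E {..K}) = (K + 1) ^ b" using B by (simp add: card_PiE b_def)
  have "card R < card (B \<rightarrow>\<^sub>E {..K})"
  proof (cases "T = {}")
    case True
    then show ?thesis by (simp add: R_def cardB)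
  next
    case False
    then have b: "0 < b" using V(2) by (auto simp: b_def)
    have "card R = (\<Sum>t\<in>T. card (V t \<rightarrow>\<^sub>E {..\<delta> * K * b}))"
      unfolding R_def by (rule card_SigmaI) (use T V(1) in \<open>auto intro!: finite_PiE\<close>)
    also have "\<dots> = (\<Sum>t\<in>T. (\<delta> * K * b + 1) ^ card (V t))"
      by (rule sum.cong) (use V(1) in \<open>auto simp: card_PiE\<close>)
    also have "\<dots> \<le> (\<Sum>t\<in>T. (\<delta> * K * b + 1) ^ (b - 1))"
      by (rule sum_mono, rule power_increasing) (use V(2) in \<open>fastforce simp: b_def\<close>)+
    also have "\<dots> = card T * (\<delta> * K * b + 1) ^ (b - 1)" by simp
    also have "\<dots> \<le> card T * ((\<delta> * b + 1) * (K + 1)) ^ (b - 1)"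
      by (intro mult_left_mono power_mono) (auto simp: algebra_simps)
    also have "\<dots> = (card T * (\<delta> * b + 1) ^ (b - 1)) * (K + 1) ^ (b - 1)"
      by (simp only: power_mult_distrib mult.assoc)
    also have "\<dots> = K * (K + 1) ^ (b - 1)" by (simp only: K_def[symmetric])
    also have "\<dots> < (K + 1) * (K + 1) ^ (b - 1)" by (intro mult_strict_right_mono) auto
    also have "\<dots> = (K + 1) ^ b" using b by (cases b) auto
    finally show ?thesis by (simp add: cardB)
  qed
  from underdetermined_system[OF finR finB this, of "\<lambda>\<beta> r. q (fst r) \<beta> (snd r)"]
  obtain c where c: "\<exists>\<beta>\<in>B \<rightarrow>\<^sub>E {..K}. c \<beta> \<noteq> 0"
    "\<And>t \<gamma>. (t, \<gamma>) \<in> R \<Longrightarrow> (\<Sum>\<beta>\<in>B \<rightarrow>\<^sub>E {..K}. c \<beta> * q t \<beta> \<gamma>) = 0"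
    by fastforce
  have zero: "(\<Sum>\<beta>\<in>B \<rightarrow>\<^sub>E {..K}. c \<beta> * Q t \<beta> x) = 0" if t: "t \<in> T" for t x
  proof -
    have "(\<Sum>\<beta>\<in>B \<rightarrow>\<^sub>E {..K}. c \<beta> * Q t \<beta> x) =
        (\<Sum>\<beta>\<in>B \<rightarrow>\<^sub>E {..K}. \<Sum>\<gamma>\<in>V t \<rightarrow>\<^sub>E {..\<delta> * K * b}. c \<beta> * q t \<beta> \<gamma> * (\<Prod>v\<in>V t. x v ^ \<gamma> v))"
      by (rule sum.cong) (auto simp: q[OF t] sum_distrib_left mult.assoc)
    also have "\<dots> = (\<Sum>\<gamma>\<in>V t \<rightarrow>\<^sub>E {..\<delta> * K * b}. (\<Sum>\<beta>\<in>B \<rightarrow>\<^sub>E {..K}. c \<beta> * q t \<beta> \<gamma>) * (\<Prod>v\<in>V t. x v ^ \<gamma> v))"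
      by (subst sum.swap) (simp add: sum_distrib_right)
    also have "\<dots> = 0" by (rule sum.neutral) (use c(2) t in \<open>auto simp: R_def\<close>)
    finally show ?thesis .
  qed
  have "(\<Sum>\<beta>\<in>B \<rightarrow>\<^sub>E {..K}. c \<beta> * (\<Prod>e\<in>B. (P t e x / h t x) ^ \<beta> e)) = 0" if t: "t \<in> T" and nz: "h t x \<noteq> 0" for t x
  proof -
    have "(\<Prod>e\<in>B. (P t e x / h t x) ^ \<beta> e) = Q t \<beta> x / (h t x ^ K) ^ b" if \<beta>: "\<beta> \<in> B \<rightarrow>\<^sub>E {..K}" for \<beta>
    proof -
      have "(P t e x / h t x) ^ \<beta> e = P t e x ^ \<beta> e * h t x ^ (K - \<beta> e) / h t x ^ K" if "e \<in> B" for e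
        using \<beta> that nz by (auto simp: PiE_iff power_divide power_diff)
      then have "(\<Prod>e\<in>B. (P t e x / h t x) ^ \<beta> e) = (\<Prod>e\<in>B. P t e x ^ \<beta> e * h t x ^ (K - \<beta> e) / h t x ^ K)"
        by simp
      also have "\<dots> = Q t \<beta> x / (h t x ^ K) ^ b" by (simp add: Q_def prod_dividef b_def)
      finally show ?thesis .
    qed
    then have "(\<Sum>\<beta>\<in>B \<rightarrow>\<^sub>E {..K}. c \<beta> * (\<Prod>e\<in>B. (P t e x / h t x) ^ \<beta> e)) =
        (\<Sum>\<beta>\<in>B \<rightarrow>\<^sub>E {..K}. c \<beta> * Q t \<beta> x) / (h t x ^ K) ^ b"
      by (simp add: sum_divide_distrib)
    then show ?thesis by (simp add: zero[OF t])
  qed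
  with c(1) that show ?thesis by blast
qed

text \<open>Induction on the variables: a coefficient polynomial that is nonzero at a small point leaves a nonzero polynomial in the remaining variable, and that one has finitely many roots.\<close>

lemma nonvanishing_small_point:
  fixes c :: "('e \<Rightarrow> nat) \<Rightarrow> real"
  assumes "finite B" "\<exists>\<beta>\<in>B \<rightarrow>\<^sub>E {..K}. c \<beta> \<noteq> 0" "0 < \<epsilon>"
  shows "\<exists>y. (\<forall>e. \<bar>y e\<bar> \<le> \<epsilon>) \<and> (\<Sum>\<beta>\<in>B \<rightarrow>\<^sub>E {..K}. c \<beta> * (\<Prod>e\<in>B. y e ^ \<beta> e)) \<noteq> 0"
  using assms
proof (induction B arbitrary: c rule: finite_induct)
  case empty
  then show ?case by (intro exI[of _ "\<lambda>_. 0"]) auto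
next
  case (insert e B)
  have reindex: "(\<Sum>\<beta>\<in>insert e B \<rightarrow>\<^sub>E {..K}. g \<beta>) = (\<Sum>k\<le>K. \<Sum>\<beta>\<in>B \<rightarrow>\<^sub>E {..K}. g (\<beta>(e := k)))" for g :: "('e \<Rightarrow> nat) \<Rightarrow> real"
  proof -
    have "inj_on (\<lambda>(k, \<beta>). \<beta>(e := k)) ({..K} \<times> (B \<rightarrow>\<^sub>E {..K}))"
      using insert.hyps(2) by (rule inj_combinator)
    then have "(\<Sum>\<beta>\<in>insert e B \<rightarrow>\<^sub>E {..K}. g \<beta>) = (\<Sum>(k, \<beta>)\<in>{..K} \<times> (B \<rightarrow>\<^sub>E {..K}). g (\<beta>(e := k)))"
      by (simp add: PiE_insert_eq sum.reindex case_prod_unfold)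
    then show ?thesis by (simp add: sum.cartesian_product)
  qed
  obtain \<beta>0 where \<beta>0: "\<beta>0 \<in> insert e B \<rightarrow>\<^sub>E {..K}" "c \<beta>0 \<noteq> 0" using insert.prems by blast
  then obtain k0 \<beta>1 where k0: "k0 \<le> K" "\<beta>1 \<in> B \<rightarrow>\<^sub>E {..K}" "\<beta>0 = \<beta>1(e := k0)"
    by (auto simp: PiE_insert_eq)
  then obtain y where y: "\<And>e. \<bar>y e\<bar> \<le> \<epsilon>"
    "(\<Sum>\<beta>\<in>B \<rightarrow>\<^sub>E {..K}. c (\<beta>(e := k0)) * (\<Prod>e\<in>B. y e ^ \<beta> e)) \<noteq> 0"
    using insert.IH[of "\<lambda>\<beta>. c (\<beta>(e := k0))"] \<beta>0(2) insert.prems(2) by blast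
  define a where "a k = (\<Sum>\<beta>\<in>B \<rightarrow>\<^sub>E {..K}. c (\<beta>(e := k)) * (\<Prod>e\<in>B. y e ^ \<beta> e))" for k
  have "finite {s. (\<Sum>k\<le>K. a k * s ^ k) = 0}"
    using y(2) k0(1) by (subst polyfun_finite_roots) (auto simp: a_def)
  moreover have "infinite {0<..<\<epsilon>}" using insert.prems(2) by (rule infinite_Ioo)
  ultimately have "\<not> {0<..<\<epsilon>} \<subseteq> {s. (\<Sum>k\<le>K. a k * s ^ k) = 0}" using finite_subset by blast
  then obtain s where "s \<in> {0<..<\<epsilon>}" "s \<notin> {s. (\<Sum>k\<le>K. a k * s ^ k) = 0}" by blast
  then have s: "0 < s" "s < \<epsilon>" "(\<Sum>k\<le>K. a k * s ^ k) \<noteq> 0" by simp_all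
  have eq: "(\<Prod>i\<in>insert e B. (y(e := s)) i ^ (\<beta>(e := k)) i) = s ^ k * (\<Prod>i\<in>B. y i ^ \<beta> i)" for \<beta> k
  proof -
    have "(\<Prod>i\<in>B. (y(e := s)) i ^ (\<beta>(e := k)) i) = (\<Prod>i\<in>B. y i ^ \<beta> i)"
      by (rule prod.cong) (use insert.hyps in auto)
    then show ?thesis using insert.hyps by simp
  qed
  have "(\<Sum>\<beta>\<in>insert e B \<rightarrow>\<^sub>E {..K}. c \<beta> * (\<Prod>i\<in>insert e B. (y(e := s)) i ^ \<beta> i)) = (\<Sum>k\<le>K. a k * s ^ k)"
    unfolding reindex eq a_def by (simp add: sum_distrib_left mult_ac)
  then show ?case using s y(1) by (intro exI[of _ "y(e := s)"]) auto
qed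

section \<open>Perturbation, eigenvectors and kernels in Euclidean spaces\<close>

text \<open>The image has the same dimension as the subspace that contains it.\<close>

lemma injective_on_subspace_surjective:
  fixes B :: "'v::euclidean_space \<Rightarrow> 'v"
  assumes W: "subspace W" and B: "linear B" and maps: "\<And>v. v \<in> W \<Longrightarrow> B v \<in> W"
    and inj: "\<And>v. v \<in> W \<Longrightarrow> B v = 0 \<Longrightarrow> v = 0"
  shows "B ` W = W"
proof -
  have inj': "inj_on B W" using linear_injective_on_subspace_0[OF B W] inj by auto
  have "B ` W \<subseteq> W" using maps by auto
  moreover have "subspace (B ` W)" using B W by (rule linear_subspace_image)
  moreover have "dim (B ` W) = dim W"
    using dim_image_eq[OF B, of W] inj' by (simp only: span_eq_iff[THEN iffD2, OF W])
  ultimately show ?thesis using W by (metis subspace_dim_equal order_refl)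
qed

text \<open>A substitute for the implicit function theorem that needs continuity only. If \<open>B\<close> is the linear map at the base
parameter, then for nearby parameters the map \<open>v \<mapsto> v - inverse B (F p v)\<close> is uniformly small on a ball of \<open>W\<close>, and Brouwer's
theorem gives a fixed point.\<close>

lemma perturbed_linear_zero:
  fixes F :: "'p::euclidean_space \<Rightarrow> 'v::euclidean_space \<Rightarrow> 'v"
  assumes W: "subspace W"
    and cont: "continuous_on UNIV (\<lambda>z. F (fst z) (snd z))"
    and maps: "\<And>p v. v \<in> W \<Longrightarrow> F p v \<in> W"
    and B: "linear B" "\<And>v. v \<in> W \<Longrightarrow> F p0 v = B v"
    and inj: "\<And>v. v \<in> W \<Longrightarrow> B v = 0 \<Longrightarrow> v = 0"
    and e: "0 < e"
  shows "\<forall>\<^sub>F p in nhds p0. \<exists>v\<in>W. norm v \<le> e \<and> F p v = 0"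
proof -
  have inj': "inj_on B W" using linear_injective_on_subspace_0[OF B(1) W] inj by auto
  obtain B' where B': "linear B'" "\<And>v. v \<in> W \<Longrightarrow> B' (B v) = v"
    using linear_exists_left_inverse_on[OF B(1) W inj'] by auto
  have BW: "B ` W = W"
  proof (rule injective_on_subspace_surjective[OF W B(1) _ inj])
    show "B v \<in> W" if "v \<in> W" for v using maps[OF that, of p0] B(2)[OF that] by simp
  qed
  have B'W: "B' w \<in> W \<and> B (B' w) = w" if "w \<in> W" for w
    using that B'(2) BW by (metis imageE)
  define K where "K = W \<inter> cball 0 e"
  have K: "compact K" "convex K" "K \<noteq> {}"
  proof -
    show "compact K" unfolding K_def
      by (rule closed_Int_compact[OF closed_subspace[OF W] compact_cball])
    show "convex K" unfolding K_def by (intro convex_Int subspace_imp_convex W convex_cball)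
    show "K \<noteq> {}" using e subspace_0[OF W] by (auto simp: K_def)
  qed
  define H where "H z = B' (F (fst z) (snd z))" for z
  have contH: "continuous_on UNIV H" unfolding H_def
    by (rule bounded_linear.continuous_on[OF _ cont]) (use B'(1) in \<open>simp add: linear_conv_bounded_linear\<close>)
  have "uniformly_continuous_on (cball p0 1 \<times> K) H"
    by (rule compact_uniformly_continuous)
      (use K in \<open>auto intro: compact_Times continuous_on_subset[OF contH]\<close>)
  then obtain d where d: "0 < d" "\<And>z z'. z \<in> cball p0 1 \<times> K \<Longrightarrow> z' \<in> cball p0 1 \<times> K \<Longrightarrow> dist z' z < d
      \<Longrightarrow> dist (H z') (H z) < e"
    using e unfolding uniformly_continuous_on_def by metis
  have main: "\<exists>v\<in>W. norm v \<le> e \<and> F p v = 0" if p: "dist p p0 < min d 1" for p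
  proof -
    define \<phi> where "\<phi> v = v - H (p, v)" for v
    have "\<phi> v \<in> K" if v: "v \<in> K" for v
    proof -
      have vW: "v \<in> W" using v by (simp add: K_def)
      have "dist (H (p, v)) (H (p0, v)) < e"
        by (rule d(2)) (use p v in \<open>auto simp: dist_commute dist_Pair_Pair\<close>)
      moreover have "H (p0, v) = v" using vW by (simp add: H_def B B')
      ultimately have "norm (\<phi> v) \<le> e" by (simp add: \<phi>_def dist_norm norm_minus_commute)
      moreover have "\<phi> v \<in> W" unfolding \<phi>_def H_def
        using W vW maps[OF vW] B'W by (simp add: subspace_diff)
      ultimately show ?thesis by (simp add: K_def)
    qed
    moreover have "continuous_on K \<phi>" unfolding \<phi>_def
      by (intro continuous_intros continuous_on_compose2[OF contH]) auto
    ultimately obtain v where v: "v \<in> K" "\<phi> v = v"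
      using brouwer[OF K, of \<phi>] by blast
    then have vW: "v \<in> W" "norm v \<le> e" by (auto simp: K_def)
    have "B' (F p v) = 0" using v by (simp add: \<phi>_def H_def)
    then have "F p v = 0" using B'W[OF maps[OF vW(1), of p]] linear_0[OF B(1)] by auto
    then show ?thesis using vW by auto
  qed
  show ?thesis unfolding eventually_nhds_metric
    by (rule exI[of _ "min d 1"]) (use d main in auto)
qed

text \<open>At a maximiser of the Rayleigh quotient the form \<open>l * b - a\<close> is semidefinite on \<open>W\<close> and vanishes at \<open>w\<close>, so \<open>w\<close> lies in its radical. The inequality is recorded for the sake of \<open>PSD_smaller_rank\<close>.\<close>

lemma max_ratio_eigenvector:
  fixes a b :: "'v::euclidean_space \<Rightarrow> 'v \<Rightarrow> real"
  assumes W: "subspace W" "w0 \<in> W" "w0 \<noteq> 0"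
    and a: "bilinear a" "\<And>x y. a x y = a y x" and b: "bilinear b" "\<And>x y. b x y = b y x"
    and pos: "\<And>x. x \<in> W \<Longrightarrow> x \<noteq> 0 \<Longrightarrow> 0 < b x x"
  obtains l w where "w \<in> W" "w \<noteq> 0" "\<And>u. u \<in> W \<Longrightarrow> a u u \<le> l * b u u"
    "\<And>u. u \<in> W \<Longrightarrow> a u w = l * b u w"
proof -
  define K where "K = W \<inter> sphere 0 1"
  have K: "compact K" unfolding K_def
    by (rule closed_Int_compact[OF closed_subspace[OF W(1)] compact_sphere])
  have "w0 /\<^sub>R norm w0 \<in> K" using W by (simp add: K_def subspace_scale)
  then have K0: "K \<noteq> {}" by auto
  have bl: "bounded_bilinear a" "bounded_bilinear b"
    using a b by (auto simp: bilinear_conv_bounded_bilinear)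
  have Kpos: "0 < b u u" if "u \<in> K" for u using that pos by (force simp: K_def)
  have "continuous_on K (\<lambda>u. a u u / b u u)"
    using Kpos by (intro continuous_intros bounded_bilinear.continuous_on[OF bl(1)]
        bounded_bilinear.continuous_on[OF bl(2)]) force
  then obtain w where w: "w \<in> K" "\<And>u. u \<in> K \<Longrightarrow> a u u / b u u \<le> a w w / b w w"
    using continuous_attains_sup[OF K K0] by blast
  define l where "l = a w w / b w w"
  have le: "a u u \<le> l * b u u" if u: "u \<in> W" for u
  proof (cases "u = 0")
    case True
    then show ?thesis using bilinear_lzero[OF a(1)] bilinear_lzero[OF b(1)] by simp
  next
    case False
    define v where "v = u /\<^sub>R norm u"
    have v: "v \<in> K" using u W False by (simp add: K_def v_def subspace_scale)
    have uv: "u = norm u *\<^sub>R v" using False by (simp add: v_def)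
    have "a v v \<le> l * b v v" using w(2)[OF v] Kpos[OF v] by (simp add: l_def field_simps)
    then have "(norm u)\<^sup>2 * a v v \<le> (norm u)\<^sup>2 * (l * b v v)" by (simp add: mult_left_mono)
    moreover have "a u u = (norm u)\<^sup>2 * a v v" "b u u = (norm u)\<^sup>2 * b v v"
      by (subst (1 2) uv, simp add: bilinear_lmul[OF a(1)] bilinear_rmul[OF a(1)]
          bilinear_lmul[OF b(1)] bilinear_rmul[OF b(1)] power2_eq_square)+
    ultimately show ?thesis by (simp add: algebra_simps)
  qed
  have wW: "w \<in> W" "w \<noteq> 0" using w(1) by (auto simp: K_def)
  have eqw: "a w w = l * b w w" using Kpos[OF w(1)] by (simp add: l_def)
  have "a u w = l * b u w" if u: "u \<in> W" for u
  proof -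
    define p where "p = l * b u w - a u w"
    define q where "q = l * b u u - a u u"
    have "0 \<le> t * (2 * p + t * q)" for t
    proof -
      have "w + t *\<^sub>R u \<in> W" using W u wW by (simp add: subspace_add subspace_scale)
      then have "0 \<le> l * b (w + t *\<^sub>R u) (w + t *\<^sub>R u) - a (w + t *\<^sub>R u) (w + t *\<^sub>R u)" using le by simp
      also have "\<dots> = t * (2 * p + t * q)"
        using eqw a(2)[of w u] b(2)[of w u]
        by (simp add: bilinear_ladd[OF a(1)] bilinear_radd[OF a(1)] bilinear_lmul[OF a(1)] bilinear_rmul[OF a(1)]
            bilinear_ladd[OF b(1)] bilinear_radd[OF b(1)] bilinear_lmul[OF b(1)] bilinear_rmul[OF b(1)]
            p_def q_def algebra_simps)
      finally show ?thesis .
    qed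
    then have "p = 0" by (rule nonneg_quadratic_linear_part_zero)
    then show ?thesis by (simp add: p_def)
  qed
  with that[OF wW le] show ?thesis by blast
qed

text \<open>First-order perturbation of a kernel. On a complement \<open>C\<close> of the kernel at \<open>p0\<close> the limit map is injective, and the
rescaled images of \<open>N\<close> converge to a vector outside its image. So the maps are eventually injective on \<open>C\<close>
enlarged by \<open>N\<close>, which bounds their kernels. The proof assumes the contrary and extracts a
limit of normalised kernel vectors.\<close>

lemma kernel_dim_drop:
  fixes \<Phi> :: "'p::metric_space \<Rightarrow> 'v::euclidean_space \<Rightarrow> 'w::euclidean_space"
  assumes U: "subspace U"
    and lin: "\<And>p. linear (\<Phi> p)"
    and cont: "continuous_on UNIV (\<lambda>z. \<Phi> (fst z) (snd z))"
    and p: "p \<longlonglongrightarrow> p0"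
    and N: "N \<in> U" "\<Phi> p0 N = 0"
    and D: "(\<lambda>j. inverse (t j) *\<^sub>R \<Phi> (p j) N) \<longlonglongrightarrow> D" "D \<notin> \<Phi> p0 ` U"
    and t: "\<And>j. t j \<noteq> 0"
  shows "\<exists>j. dim {x\<in>U. \<Phi> (p j) x = 0} < dim {x\<in>U. \<Phi> p0 x = 0}"
proof (rule ccontr)
  assume "\<not> ?thesis"
  then have big: "dim {x\<in>U. \<Phi> p0 x = 0} \<le> dim {x\<in>U. \<Phi> (p j) x = 0}" for j by (meson not_le)
  define K where "K = {x\<in>U. \<Phi> p0 x = 0}"
  define C where "C = {y\<in>U. \<forall>x\<in>K. orthogonal x y}"
  have K: "subspace K" "K \<subseteq> U"
    using lin[of p0] U unfolding K_def subspace_def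
    by (auto simp: linear_0 linear_add linear_scale)
  have dC: "dim C + dim K = dim U"
    unfolding C_def by (rule dim_subspace_orthogonal_to_vectors[OF K(1) U K(2)])
  have C: "subspace C" "C \<subseteq> U"
    using U unfolding C_def subspace_def by (auto simp: orthogonal_clauses)
  have CK: "x = 0" if "x \<in> C" "\<Phi> p0 x = 0" for x
  proof -
    have "x \<in> K" using that C by (auto simp: K_def)
    then have "orthogonal x x" using that by (auto simp: C_def)
    then show ?thesis by (simp add: orthogonal_self)
  qed
  have "0 \<in> \<Phi> p0 ` U" using lin[of p0] U by (metis image_eqI linear_0 subspace_0)
  then have D0: "D \<noteq> 0" using D(2) by auto
  have "N \<noteq> 0"
  proof
    assume "N = 0"
    then have "(\<lambda>j. inverse (t j) *\<^sub>R \<Phi> (p j) N) = (\<lambda>j. 0)" using linear_0[OF lin] by auto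
    then show False using D(1) D0 LIMSEQ_unique tendsto_const by metis
  qed
  define C' where "C' = {x + y |x y. x \<in> C \<and> y \<in> span {N}}"
  have C': "subspace C'" "C' \<subseteq> U"
  proof -
    show "subspace C'" unfolding C'_def by (rule subspace_sums[OF C(1) subspace_span])
    have "span {N} \<subseteq> U" using N U by (simp add: span_minimal)
    then show "C' \<subseteq> U" using C(2) U unfolding C'_def by (blast intro: subspace_add)
  qed
  have CN: "C \<inter> span {N} = {0}"
  proof -
    have "x = 0" if x: "x \<in> C" "x \<in> span {N}" for x
    proof -
      obtain k where "x = k *\<^sub>R N" using x(2) by (auto simp: span_singleton)
      then have "\<Phi> p0 x = 0" using N lin[of p0] by (simp add: linear_scale)
      then show ?thesis using CK x by auto
    qed
    then show ?thesis using C(1) by (auto simp: subspace_0 span_zero)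
  qed
  have dC': "dim C' = dim C + 1"
    using dim_sums_Int[OF C(1) subspace_span[of "{N}"]] \<open>N \<noteq> 0\<close> CN by (simp add: C'_def)
  \<comment> \<open>The coefficient of \<open>N\<close> is multiplied by \<open>t j\<close> before normalising: this is the scale on which the images of \<open>N\<close> are of order one.\<close>
  have ex: "\<exists>c b. c \<in> C \<and> norm (c, b) = 1 \<and> \<Phi> (p j) c + b *\<^sub>R (inverse (t j) *\<^sub>R \<Phi> (p j) N) = 0" for j
  proof -
    let ?K = "{x\<in>U. \<Phi> (p j) x = 0}"
    have sK: "subspace ?K" using lin U unfolding subspace_def
      by (auto simp: linear_0 linear_add linear_scale)
    have "dim {x + y |x y. x \<in> C' \<and> y \<in> ?K} \<le> dim U"
      by (rule dim_subset) (use C'(2) U in \<open>auto simp: subspace_add\<close>)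
    then have "0 < dim (C' \<inter> ?K)"
      using dim_sums_Int[OF C'(1) sK] big[of j] dC dC' unfolding K_def by linarith
    then have "\<not> C' \<inter> ?K \<subseteq> {0}" by (metis dim_eq_0 less_irrefl)
    then obtain x where x: "x \<in> C'" "\<Phi> (p j) x = 0" "x \<noteq> 0" by blast
    then obtain c k where ck: "c \<in> C" "x = c + k *\<^sub>R N" by (auto simp: C'_def span_singleton)
    have nz: "(c, k * t j) \<noteq> (0, 0)" using x(3) ck(2) t[of j] by auto
    define s where "s = norm (c, k * t j)"
    have s: "s \<noteq> 0" using nz by (simp add: s_def zero_prod_def)
    have e: "\<Phi> (p j) c + k *\<^sub>R \<Phi> (p j) N = 0"
      using x(2) ck(2) lin[of "p j"] by (simp add: linear_add linear_scale)
    have "norm (c /\<^sub>R s, k * t j / s) = 1"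
    proof -
      have "(c /\<^sub>R s, k * t j / s) = (c, k * t j) /\<^sub>R s" by (simp add: divide_inverse mult.commute)
      moreover have "norm ((c, k * t j) /\<^sub>R s) = 1" using s unfolding s_def by (simp only: norm_scaleR) simp
      ultimately show ?thesis by (simp only:)
    qed
    moreover have "\<Phi> (p j) (c /\<^sub>R s) + (k * t j / s) *\<^sub>R (inverse (t j) *\<^sub>R \<Phi> (p j) N)
        = (\<Phi> (p j) c + k *\<^sub>R \<Phi> (p j) N) /\<^sub>R s"
      using t[of j] lin[of "p j"] by (simp add: linear_scale scaleR_add_right divide_inverse mult.commute)
    moreover have "c /\<^sub>R s \<in> C" using ck(1) C(1) by (simp add: subspace_scale)
    ultimately have "c /\<^sub>R s \<in> C \<and> norm (c /\<^sub>R s, k * t j / s) = 1 \<and>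
        \<Phi> (p j) (c /\<^sub>R s) + (k * t j / s) *\<^sub>R (inverse (t j) *\<^sub>R \<Phi> (p j) N) = 0"
      using e by simp
    then show ?thesis by blast
  qed
  then obtain c b where cb: "\<And>j. c j \<in> C" "\<And>j. norm (c j, b j) = 1"
    "\<And>j. \<Phi> (p j) (c j) + b j *\<^sub>R (inverse (t j) *\<^sub>R \<Phi> (p j) N) = (0::'w)"
    by metis
  have "compact (sphere (0 :: 'v \<times> real) 1)" by (rule compact_sphere)
  moreover have "\<forall>j. (c j, b j) \<in> sphere 0 1" using cb(2) by simp
  ultimately obtain l r where l: "l \<in> sphere 0 1" "strict_mono r" "((\<lambda>j. (c j, b j)) \<circ> r) \<longlonglongrightarrow> l"
    unfolding compact_def by meson
  obtain c0 b0 where l0: "l = (c0, b0)" by fastforce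
  have cc: "(\<lambda>j. c (r j)) \<longlonglongrightarrow> c0" and bb: "(\<lambda>j. b (r j)) \<longlonglongrightarrow> b0"
    using tendsto_fst[OF l(3)] tendsto_snd[OF l(3)] by (simp_all add: l0 o_def)
  have c0: "c0 \<in> C" using closed_sequentially[OF closed_subspace[OF C(1)] _ cc] cb(1) by auto
  have lim1: "(\<lambda>j. \<Phi> (p (r j)) (c (r j))) \<longlonglongrightarrow> \<Phi> p0 c0"
  proof -
    have "(\<lambda>j. (p (r j), c (r j))) \<longlonglongrightarrow> (p0, c0)"
      using tendsto_Pair[OF LIMSEQ_subseq_LIMSEQ[OF p l(2)] cc] by (simp add: o_def)
    from continuous_on_tendsto_compose[OF cont this] show ?thesis by simp
  qed
  have lim2: "(\<lambda>j. b (r j) *\<^sub>R (inverse (t (r j)) *\<^sub>R \<Phi> (p (r j)) N)) \<longlonglongrightarrow> b0 *\<^sub>R D"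
    using tendsto_scaleR[OF bb LIMSEQ_subseq_LIMSEQ[OF D(1) l(2)]] by (simp add: o_def)
  have "(\<lambda>j. 0 :: 'w) \<longlonglongrightarrow> \<Phi> p0 c0 + b0 *\<^sub>R D"
    using tendsto_add[OF lim1 lim2] cb(3) by simp
  then have eq: "\<Phi> p0 c0 + b0 *\<^sub>R D = 0" using LIMSEQ_unique tendsto_const by metis
  have "b0 = 0"
  proof (rule ccontr)
    assume "b0 \<noteq> 0"
    have "D = (- inverse b0) *\<^sub>R \<Phi> p0 c0"
    proof -
      have "b0 *\<^sub>R D = - \<Phi> p0 c0" using eq by (simp add: add_eq_0_iff)
      then have "inverse b0 *\<^sub>R (b0 *\<^sub>R D) = inverse b0 *\<^sub>R (- \<Phi> p0 c0)" by simp
      then show ?thesis using \<open>b0 \<noteq> 0\<close> by simp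
    qed
    then have "D = \<Phi> p0 ((- inverse b0) *\<^sub>R c0)" using linear_scale[OF lin] by metis
    moreover have "(- inverse b0) *\<^sub>R c0 \<in> U" using c0 C U by (meson subsetD subspace_scale)
    ultimately show False using D(2) by blast
  qed
  then have "c0 = 0" using eq CK c0 by simp
  then show False using l(1) l0 \<open>b0 = 0\<close> by (simp add: zero_prod_def[symmetric])
qed

lemma subspace_projection:
  fixes S :: "'a::euclidean_space set"
  assumes "subspace S"
  obtains \<pi> where "linear \<pi>" "\<And>x. \<pi> x \<in> S" "\<And>x y. y \<in> S \<Longrightarrow> y \<bullet> \<pi> x = y \<bullet> x" "\<And>x. x \<in> S \<Longrightarrow> \<pi> x = x"
proof -
  obtain B where B: "B \<subseteq> S" "pairwise orthogonal B" "\<And>x. x \<in> B \<Longrightarrow> norm x = 1"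
    "independent B" "span B = S"
    using orthonormal_basis_subspace[OF assms] by (metis (no_types))
  have fin: "finite B" using B(4) by (rule independent_imp_finite)
  define \<pi> where "\<pi> x = (\<Sum>b\<in>B. (b \<bullet> x) *\<^sub>R b)" for x
  have lin: "linear \<pi>" unfolding \<pi>_def
    by (rule linearI) (simp_all add: inner_add_right scaleR_add_left sum.distrib scaleR_sum_right)
  have mem: "\<pi> x \<in> S" for x unfolding \<pi>_def
    using B assms by (auto intro!: subspace_sum subspace_scale)
  have ip: "c \<bullet> \<pi> x = c \<bullet> x" if c: "c \<in> B" for c x
  proof -
    have "c \<bullet> \<pi> x = (\<Sum>b\<in>B. (b \<bullet> x) * (c \<bullet> b))" by (simp add: \<pi>_def inner_sum_right)
    also have "\<dots> = (\<Sum>b\<in>B. if b = c then c \<bullet> x else 0)"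
    proof (rule sum.cong[OF refl])
      fix b assume b: "b \<in> B"
      show "(b \<bullet> x) * (c \<bullet> b) = (if b = c then c \<bullet> x else 0)"
        using B(2,3) b c by (auto simp: pairwise_def orthogonal_commute norm_eq_1)
          (simp add: Linear_Algebra.orthogonal_def)
    qed
    also have "\<dots> = c \<bullet> x" using c fin by simp
    finally show ?thesis .
  qed
  have ip': "y \<bullet> \<pi> x = y \<bullet> x" if "y \<in> S" for x y
    using that unfolding B(5)[symmetric]
    by (induction rule: span_induct_alt) (simp_all add: inner_add_left ip)
  have "\<pi> x = x" if "x \<in> S" for x
  proof -
    have "(\<pi> x - x) \<bullet> (\<pi> x - x) = 0"
      using ip'[of "\<pi> x - x" x] mem[of x] that assms
      by (simp add: inner_diff_right subspace_diff)
    then show ?thesis by simp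
  qed
  with that lin mem ip' show ?thesis by blast
qed

section \<open>Low-rank elements of a linear section of the semidefinite cone\<close>

definition sym_perp :: "(real^'n^'n) set \<Rightarrow> (real^'n^'n) set" where
  "sym_perp L = {N \<in> Sym. \<forall>X\<in>L. X \<bullet> N = 0}"

lemma subspace_sym_perp: "subspace (sym_perp L)"
  using subspace_Sym unfolding sym_perp_def subspace_def
  by (auto simp: inner_add_right)

lemma sym_perp_dim:
  fixes L :: "(real^'n^'n) set"
  assumes "subspace L" "L \<subseteq> Sym"
  shows "dim (sym_perp L) + dim L = dim (Sym :: (real^'n^'n) set)"
  using dim_subspace_orthogonal_to_vectors[OF assms(1) subspace_Sym assms(2)]
  by (simp add: sym_perp_def Linear_Algebra.orthogonal_def)

text \<open>The complement is taken inside the symmetric matrices, so the double complement recovers \<open>L\<close> only among symmetric matrices.\<close>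

lemma sym_perp_perp:
  fixes L :: "(real^'n^'n) set"
  assumes L: "subspace L" "L \<subseteq> Sym" and X: "X \<in> Sym" "\<And>N. N \<in> sym_perp L \<Longrightarrow> X \<bullet> N = 0"
  shows "X \<in> L"
proof -
  obtain \<pi> where \<pi>: "linear \<pi>" "\<And>x. \<pi> x \<in> L" "\<And>x y. y \<in> L \<Longrightarrow> y \<bullet> \<pi> x = y \<bullet> x"
    by (rule subspace_projection[OF L(1)]) blast
  have "\<pi> X \<in> Sym" using \<pi>(2) L(2) by blast
  then have "X - \<pi> X \<in> Sym" using X(1) subspace_diff[OF subspace_Sym] by blast
  then have "X - \<pi> X \<in> sym_perp L" using \<pi>(3) by (auto simp: sym_perp_def inner_diff_right)
  then have "X \<bullet> (X - \<pi> X) = 0" "\<pi> X \<bullet> (X - \<pi> X) = 0"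
    using X(2) \<pi>(2) by (auto simp: sym_perp_def)
  then have "(X - \<pi> X) \<bullet> (X - \<pi> X) = 0" by (simp add: inner_diff_left)
  then show ?thesis using \<pi>(2)[of X] by simp
qed

definition outer :: "real^'n \<Rightarrow> real^'n \<Rightarrow> real^'n^'n" where
  "outer x y = (\<chi> i j. x $ i * y $ j)"

lemma outer_mult: "outer x y *v z = (y \<bullet> z) *\<^sub>R x"
  by (simp add: outer_def matrix_vector_mult_def vec_eq_iff inner_vec_def sum_distrib_left mult_ac)

lemma transpose_outer: "transpose (outer x y) = outer y x"
  by (simp add: outer_def transpose_def vec_eq_iff mult_ac)

lemma mult_outer: "A ** outer x y = outer (A *v x) y"
  by (simp add: outer_def matrix_matrix_mult_def matrix_vector_mult_def vec_eq_iff sum_distrib_left mult_ac)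

lemma outer_mult_right: "outer x y ** A = outer x (transpose A *v y)"
proof -
  have "transpose (outer x y ** A) = transpose (outer x (transpose A *v y))"
    by (simp only: matrix_transpose_mul transpose_outer mult_outer)
  then show ?thesis by (metis Finite_Cartesian_Product.transpose_transpose)
qed

lemma outer_inner: "outer x y \<bullet> outer z w = (x \<bullet> z) * (y \<bullet> w)"
  unfolding outer_def inner_matrix inner_vec_def
  by (subst sum_product, intro sum.cong refl) (simp add: mult_ac)

lemma card_upper_triangle: "card {(i, j). i \<in> {..<k} \<and> j \<in> {..<k} \<and> i \<le> (j::nat)} = (k + 1) choose 2"
proof (induction k)
  case 0
  then show ?case by (simp add: numeral_2_eq_2)
next
  case (Suc k)
  have "{(i, j). i \<in> {..<Suc k} \<and> j \<in> {..<Suc k} \<and> i \<le> (j::nat)} =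
    {(i, j). i \<in> {..<k} \<and> j \<in> {..<k} \<and> i \<le> (j::nat)} \<union> (\<lambda>i. (i, k)) ` {..k}" by auto
  moreover have "card ((\<lambda>i. (i, k)) ` {..k}) = Suc k"
    by (subst card_image) (auto simp: inj_on_def)
  moreover have "finite {(i, j). i \<in> {..<k} \<and> j \<in> {..<k} \<and> i \<le> (j::nat)}"
    by (rule finite_subset[of _ "{..<k} \<times> {..<k}"]) auto
  ultimately have "card {(i, j). i \<in> {..<Suc k} \<and> j \<in> {..<Suc k} \<and> i \<le> (j::nat)} =
      card {(i, j). i \<in> {..<k} \<and> j \<in> {..<k} \<and> i \<le> (j::nat)} + Suc k"
    by (simp add: card_Un_disjoint disjoint_iff image_iff)
  then show ?case using Suc by (simp add: numeral_2_eq_2)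
qed

text \<open>The range of \<open>A\<close> has an orthonormal basis \<open>b\<close> with \<open>rank A\<close> elements, and the symmetrised products of \<open>b i\<close> and \<open>b j\<close> with \<open>i \<le> j\<close> are pairwise orthogonal sandwiches.\<close>

lemma dim_sandwich_Sym_ge:
  assumes A: "A \<in> (Sym :: (real^'n^'n) set)"
  shows "(rank A + 1) choose 2 \<le> dim ((\<lambda>X. A ** X ** A) ` Sym)"
proof -
  define k where "k = rank A"
  have "subspace (range ((*v) A))" by (simp add: linear_subspace_image subspace_UNIV)
  then obtain B where B: "B \<subseteq> range ((*v) A)" "pairwise orthogonal B" "\<And>x. x \<in> B \<Longrightarrow> norm x = 1"
    "independent B" "card B = dim (range ((*v) A))"
    by (rule orthonormal_basis_subspace) blast
  have cB: "card B = k" using B by (simp add: k_def rank_dim_range)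
  have "finite B" using B(4) by (rule independent_imp_finite)
  then obtain b where b: "bij_betw b {..<k} B" using cB ex_bij_betw_nat_finite[of B] by (auto simp: atLeast0LessThan)
  have orth: "b i \<bullet> b j = (if i = j then 1 else 0)" if "i < k" "j < k" for i j
  proof (cases "i = j")
    case True
    have "norm (b i) = 1" using B(3) b that by (auto simp: bij_betw_def)
    then show ?thesis using True by (simp add: norm_eq_1)
  next
    case False
    then have "b i \<noteq> b j" using b that by (auto simp: bij_betw_def inj_on_def)
    moreover have "b i \<in> B" "b j \<in> B" using b that by (auto simp: bij_betw_def)
    ultimately show ?thesis using B(2) False by (auto simp: pairwise_def Linear_Algebra.orthogonal_def)
  qed
  define e where "e p = outer (b (fst p)) (b (snd p)) + outer (b (snd p)) (b (fst p))" for p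
  define I where "I = {(i, j). i \<in> {..<k} \<and> j \<in> {..<k} \<and> i \<le> j}"
  have ee: "e p \<bullet> e q = (if p = q then (if fst p = snd p then 4 else 2) else 0)" if "p \<in> I" "q \<in> I" for p q
  proof -
    obtain i j i' j' where pq: "p = (i, j)" "q = (i', j')" by fastforce
    have lt: "i < k" "j < k" "i' < k" "j' < k" "i \<le> j" "i' \<le> j'" using that pq by (auto simp: I_def)
    have "e p \<bullet> e q = 2 * ((b i \<bullet> b i') * (b j \<bullet> b j') + (b i \<bullet> b j') * (b j \<bullet> b i'))"
      by (simp add: e_def pq inner_add_left inner_add_right outer_inner algebra_simps)
    also have "\<dots> = (if p = q then (if fst p = snd p then 4 else 2) else 0)"
      using lt(5,6) by (auto simp: orth[OF lt(1) lt(3)] orth[OF lt(2) lt(4)] orth[OF lt(1) lt(4)] orth[OF lt(2) lt(3)] pq)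
    finally show ?thesis .
  qed
  have injI: "inj_on e I"
  proof (rule inj_onI)
    fix p q assume pq: "p \<in> I" "q \<in> I" "e p = e q"
    then have "e p \<bullet> e q \<noteq> 0" using ee[of p p] by (auto split: if_splits)
    then show "p = q" using ee[of p q] pq by (auto split: if_splits)
  qed
  have "independent (e ` I)"
  proof (rule pairwise_orthogonal_independent)
    show "pairwise orthogonal (e ` I)"
      unfolding pairwise_def Linear_Algebra.orthogonal_def using ee by auto
    show "0 \<notin> e ` I" 
    proof
      assume "0 \<in> e ` I"
      then obtain p where "p \<in> I" "e p = 0" by auto
      then show False using ee[of p p] by (auto split: if_splits)
    qed
  qed
  moreover have "e ` I \<subseteq> (\<lambda>X. A ** X ** A) ` Sym"
  proof
    fix z assume "z \<in> e ` I"
    then obtain p where p: "p \<in> I" "z = e p" by auto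
    have "b (fst p) \<in> B" "b (snd p) \<in> B" using p b by (auto simp: I_def bij_betw_def)
    then obtain x y where xy: "b (fst p) = A *v x" "b (snd p) = A *v y" using B(1) by blast
    have tA: "transpose A = A" using A by (simp add: Sym_iff)
    have "z = A ** (outer x y + outer y x) ** A"
      using p(2) by (simp add: e_def xy mm.add_left mm.add_right mult_outer outer_mult_right tA
          del: transpose_matrix_vector)
    moreover have "outer x y + outer y x \<in> Sym"
      by (simp add: Sym_iff transpose_add transpose_outer add.commute)
    ultimately show "z \<in> (\<lambda>X. A ** X ** A) ` Sym" by blast
  qed
  ultimately have "card (e ` I) \<le> dim ((\<lambda>X. A ** X ** A) ` Sym)"
    by (intro independent_card_le_dim)
  moreover have "card (e ` I) = (k + 1) choose 2"
    using card_upper_triangle[of k] injI by (simp add: card_image I_def)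
  ultimately show ?thesis by (simp add: k_def)
qed

lemma linear_sandwich: "linear (\<lambda>X. A ** X ** B)" for A B :: "real^'n^'n"
  by (rule linearI) (simp_all add: mm.add_left mm.add_right mm.scaleR_left mm.scaleR_right)

lemma inner_sandwich: "(A ** X ** B) \<bullet> Y = X \<bullet> (transpose A ** Y ** transpose B)"
  for A B X Y :: "real^'n^'n"
  by (simp add: inner_mult_left[of A X] inner_mult_right[of "A ** X" B] matrix_mul_assoc)

text \<open>A sandwich \<open>A ** X ** A\<close> is orthogonal to the kernel of the self-adjoint map \<open>Y \<mapsto> A ** Y ** A\<close>.\<close>

lemma sandwich_zero:
  assumes A: "A \<in> Sym" and Y: "Y \<in> (\<lambda>X. A ** X ** A) ` Sym" "A ** Y ** A = 0"
  shows "Y = 0"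
proof -
  obtain X where X: "Y = A ** X ** A" using Y by auto
  have tA: "transpose A = A" using A by (simp add: Sym_iff)
  have "Y \<bullet> Y = X \<bullet> (A ** Y ** A)"
    by (subst X, simp add: inner_sandwich tA)
  then show ?thesis using Y by simp
qed

text \<open>The sandwiches of \<open>A\<close> that are orthogonal to the sandwiched complement \<open>A ** N ** A\<close>, \<open>N \<in> sym_perp L\<close>, form a space of
dimension at least two. Sandwiching them once more is injective and lands in \<open>L\<close>, because this moves the
factors \<open>A\<close> to the other side of the inner product.\<close>

lemma exists_independent_sandwich:
  assumes L: "subspace L" "L \<subseteq> (Sym :: (real^'n^'n) set)" and A: "A \<in> Sym"
    and d: "dim ((\<lambda>N. A ** N ** A) ` sym_perp L) + 2 \<le> (rank A + 1) choose 2"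
  obtains X where "X \<in> Sym" "A ** X ** A \<in> L" "A ** X ** A \<notin> span {A}"
proof -
  define f where "f X = A ** X ** A" for X
  define V where "V = f ` Sym"
  define I where "I = f ` sym_perp L"
  define V' where "V' = {Y\<in>V. \<forall>N\<in>I. orthogonal N Y}"
  have lin: "linear f" unfolding f_def by (rule linear_sandwich)
  have tA: "transpose A = A" using A by (simp add: Sym_iff)
  have V: "subspace V" unfolding V_def by (rule linear_subspace_image[OF lin subspace_Sym])
  have I: "subspace I" unfolding I_def by (rule linear_subspace_image[OF lin subspace_sym_perp])
  have "I \<subseteq> V" by (auto simp: I_def V_def sym_perp_def)
  then have "dim V' + dim I = dim V" unfolding V'_def by (rule dim_subspace_orthogonal_to_vectors[OF I V])
  moreover have "(rank A + 1) choose 2 \<le> dim V"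
    using dim_sandwich_Sym_ge[OF A] by (simp add: V_def f_def)
  ultimately have dV': "2 \<le> dim V'" using d by (simp add: I_def f_def)
  have sV': "subspace V'" unfolding V'_def using V
    by (auto simp: subspace_def orthogonal_clauses)
  have "inj_on f V'"
    using linear_injective_on_subspace_0[OF lin sV'] sandwich_zero[OF A]
    by (auto simp: V'_def V_def f_def[abs_def])
  then have "inj_on f (span V')" using sV' by (metis span_eq_iff)
  then have "dim (f ` V') = dim V'" by (rule dim_image_eq[OF lin])
  then have "\<not> dim (f ` V') \<le> dim (span {A})"
    using dV' dim_le_card[of "span {A}" "{A}"] by auto
  then have "\<not> f ` V' \<subseteq> span {A}" using dim_subset by blast
  then obtain Y where Y: "Y \<in> V'" "f Y \<notin> span {A}" by auto
  have SV: "V \<subseteq> Sym" using A by (auto simp: V_def f_def Sym_sandwich)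
  have YS: "Y \<in> Sym" using Y SV by (auto simp: V'_def)
  have "f Y \<in> L"
  proof (rule sym_perp_perp[OF L])
    show "f Y \<in> Sym" using A YS by (simp add: f_def Sym_sandwich)
    fix N assume "N \<in> sym_perp L"
    then have "orthogonal (f N) Y" using Y by (auto simp: V'_def I_def)
    moreover have "f Y \<bullet> N = Y \<bullet> f N" by (simp only: f_def inner_sandwich tA)
    ultimately show "f Y \<bullet> N = 0" by (simp add: Linear_Algebra.orthogonal_def inner_commute)
  qed
  with that YS Y show ?thesis by (simp add: f_def)
qed

lemma range_Sym_iff_orthogonal_null_space:
  assumes A: "A \<in> Sym"
  shows "x \<in> range ((*v) A) \<longleftrightarrow> (\<forall>y\<in>null_space A. x \<bullet> y = 0)"
proof
  assume "x \<in> range ((*v) A)"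
  then show "\<forall>y\<in>null_space A. x \<bullet> y = 0" using A by (auto simp: Sym_inner null_space_def)
next
  assume x: "\<forall>y\<in>null_space A. x \<bullet> y = 0"
  have "subspace (range ((*v) A))" by (simp add: linear_subspace_image subspace_UNIV)
  then obtain \<pi> where \<pi>: "\<And>x. \<pi> x \<in> range ((*v) A)" "\<And>x y. y \<in> range ((*v) A) \<Longrightarrow> y \<bullet> \<pi> x = y \<bullet> x"
    by (rule subspace_projection) blast
  have "(A *v (x - \<pi> x)) \<bullet> (A *v (x - \<pi> x)) = (A *v (A *v (x - \<pi> x))) \<bullet> (x - \<pi> x)"
    by (simp add: Sym_inner[OF A])
  also have "\<dots> = 0" using \<pi> by (simp add: inner_diff_right)
  finally have "x - \<pi> x \<in> null_space A" by (simp add: null_space_def)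
  moreover from this have "\<pi> x \<bullet> (x - \<pi> x) = 0" using \<pi>(1)[of x] A
    by (auto simp: null_space_def Sym_inner)
  ultimately have "(x - \<pi> x) \<bullet> (x - \<pi> x) = 0" using x by (simp add: inner_diff_left)
  then show "x \<in> range ((*v) A)" using \<pi>(1)[of x] by simp
qed

lemma range_null_space_decomp:
  assumes A: "A \<in> Sym"
  obtains y z where "y \<in> range ((*v) A)" "z \<in> null_space A" "x = y + z"
proof -
  obtain \<pi> where \<pi>: "\<And>x. \<pi> x \<in> null_space A" "\<And>x y. y \<in> null_space A \<Longrightarrow> y \<bullet> \<pi> x = y \<bullet> x"
    by (rule subspace_projection[OF subspace_null_space[of A]]) blast
  have "x - \<pi> x \<in> range ((*v) A)"
    unfolding range_Sym_iff_orthogonal_null_space[OF A]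
  proof
    fix y assume "y \<in> null_space A"
    then have "y \<bullet> \<pi> x = y \<bullet> x" by (rule \<pi>(2))
    then have "y \<bullet> (x - \<pi> x) = 0" by (simp add: inner_diff_right)
    then show "(x - \<pi> x) \<bullet> y = 0" by (simp only: inner_commute)
  qed
  then show ?thesis using \<pi>(1)[of x] that[of "x - \<pi> x" "\<pi> x"] by simp
qed

lemma PSD_pos_on_range:
  assumes "A \<in> PSD" "x \<in> range ((*v) A)" "x \<noteq> 0"
  shows "0 < x \<bullet> (A *v x)"
proof -
  have "x \<bullet> (A *v x) \<noteq> 0"
  proof
    assume "x \<bullet> (A *v x) = 0"
    then have "x \<in> null_space A" using PSD_form_zero assms by (auto simp: null_space_def)
    then have "x \<bullet> x = 0" using range_Sym_iff_orthogonal_null_space[of A x] assms by (auto simp: PSD_imp)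
    then show False using assms by simp
  qed
  then show ?thesis using PSD_imp(2)[OF assms(1), of x] by linarith
qed

lemma bilinear_form: "bilinear (\<lambda>x y. x \<bullet> (A *v y))" for A :: "real^'n^'n"
  unfolding bilinear_def
  by (auto intro!: linearI simp: inner_add_left inner_add_right mv.add_right mv.scaleR_right)

text \<open>On the line through \<open>- (A ** X ** A)\<close> in direction \<open>A\<close>, the first semidefinite matrix is singular on the range of
\<open>A\<close>: its parameter is the largest generalised eigenvalue of the pair.\<close>

lemma PSD_smaller_rank:
  assumes A: "A \<in> PSD" "A \<noteq> 0" and X: "X \<in> Sym" "A ** X ** A \<notin> span {A}"
  obtains \<mu> where "\<mu> *\<^sub>R A - A ** X ** A \<in> PSD" "\<mu> *\<^sub>R A - A ** X ** A \<noteq> 0"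
    "rank (\<mu> *\<^sub>R A - A ** X ** A) < rank A"
proof -
  have AS: "A \<in> Sym" using A by (simp add: PSD_imp)
  define C where "C = A ** X ** A"
  have CS: "C \<in> Sym" using AS X by (simp add: C_def Sym_sandwich)
  have sub: "subspace (range ((*v) A))" by (simp add: linear_subspace_image subspace_UNIV)
  obtain w0 where w0: "w0 \<in> range ((*v) A)" "w0 \<noteq> 0"
  proof -
    have "rank A \<noteq> 0" using A by (simp add: rank_eq_0)
    then have "\<not> range ((*v) A) \<subseteq> {0}" unfolding rank_dim_range dim_eq_0 .
    then show ?thesis using that by blast
  qed
  have symC: "x \<bullet> (C *v y) = y \<bullet> (C *v x)" for x y using Sym_inner[OF CS, of x y] by (simp only: inner_commute)
  have symA: "x \<bullet> (A *v y) = y \<bullet> (A *v x)" for x y using Sym_inner[OF AS, of x y] by (simp only: inner_commute)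
  obtain \<mu> w where w: "w \<in> range ((*v) A)" "w \<noteq> 0"
    "\<And>u. u \<in> range ((*v) A) \<Longrightarrow> u \<bullet> (C *v u) \<le> \<mu> * (u \<bullet> (A *v u))"
    "\<And>u. u \<in> range ((*v) A) \<Longrightarrow> u \<bullet> (C *v w) = \<mu> * (u \<bullet> (A *v w))"
  proof (rule max_ratio_eigenvector[OF sub w0 bilinear_form[of C] symC bilinear_form[of A] symA])
    show "0 < x \<bullet> (A *v x)" if "x \<in> range ((*v) A)" "x \<noteq> 0" for x
      using PSD_pos_on_range[OF A(1) that] .
  qed (rule that)
  define D where "D = \<mu> *\<^sub>R A - C"
  have DS: "D \<in> Sym" unfolding D_def
    by (intro subspace_diff[OF subspace_Sym] subspace_scale[OF subspace_Sym] AS CS)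
  have null_D: "D *v z = 0" if "z \<in> null_space A" for z
    using that by (simp add: D_def C_def null_space_def mv.diff_left mv.scaleR_left flip: matrix_vector_mul_assoc)
  have form: "u \<bullet> (D *v v) = \<mu> * (u \<bullet> (A *v v)) - u \<bullet> (C *v v)" for u v
    by (simp add: D_def mv.diff_left mv.scaleR_left inner_diff_right)
  have psd: "D \<in> PSD"
  proof -
    have "0 \<le> x \<bullet> (D *v x)" for x
    proof -
      obtain y z where yz: "y \<in> range ((*v) A)" "z \<in> null_space A" "x = y + z"
        by (rule range_null_space_decomp[OF AS])
      have "x \<bullet> (D *v x) = y \<bullet> (D *v y)"
        using null_D[OF yz(2)] Sym_inner[OF DS, of z y] yz(3)
        by (simp add: mv.add_right inner_add_left)
      also have "\<dots> \<ge> 0" using w(3)[OF yz(1)] by (simp add: form)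
      finally show ?thesis .
    qed
    then show ?thesis using DS by (simp add: PSD_def)
  qed
  have wD: "D *v w = 0"
  proof (rule PSD_form_zero[OF psd])
    show "w \<bullet> (D *v w) = 0" using w(4)[OF w(1)] by (simp add: form)
  qed
  have "w \<notin> null_space A" using w(1,2) range_Sym_iff_orthogonal_null_space[OF AS, of w] by auto
  moreover have "null_space A \<subseteq> null_space D" using null_D by (auto simp: null_space_def)
  moreover have "w \<in> null_space D" using wD by (simp add: null_space_def)
  ultimately have "null_space A \<subset> null_space D" by auto
  then have "dim (null_space A) < dim (null_space D)"
    using dim_psubset[of "null_space A" "null_space D"] by (simp only: span_eq_iff[THEN iffD2, OF subspace_null_space])
  then have "rank D < rank A"
    using rank_plus_dim_null_space[of A] rank_plus_dim_null_space[of D] by linarith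
  moreover have "D \<noteq> 0"
  proof
    assume "D = 0"
    then have "A ** X ** A = \<mu> *\<^sub>R A" by (simp add: D_def C_def)
    then show False using X(2) by (simp add: span_base span_scale)
  qed
  ultimately show ?thesis using that psd by (simp add: D_def C_def)
qed

text \<open>The Pataki bound: a semidefinite element of minimal rank spans an extreme ray, so its face meets \<open>L\<close> in dimension one only.\<close>

lemma exists_low_rank_PSD:
  assumes L: "subspace L" "L \<subseteq> (Sym :: (real^'n^'n) set)"
    and c: "dim (sym_perp L) < (r + 1) choose 2"
    and A: "A \<in> PSD \<inter> L" "A \<noteq> 0"
  obtains B where "B \<in> PSD \<inter> L" "B \<noteq> 0" "rank B \<le> r"
proof -
  have "\<exists>B. B \<in> PSD \<inter> L \<and> B \<noteq> 0" using A by blast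
  then obtain B where B: "B \<in> PSD \<inter> L \<and> B \<noteq> 0"
    and min: "\<And>C. C \<in> PSD \<inter> L \<and> C \<noteq> 0 \<Longrightarrow> rank B \<le> rank C"
    using ex_has_least_nat[of "\<lambda>B. B \<in> PSD \<inter> L \<and> B \<noteq> 0" _ rank] by blast
  have BS: "B \<in> Sym" using B by (simp add: PSD_imp)
  have "rank B \<le> r"
  proof (rule ccontr)
    assume "\<not> rank B \<le> r"
    \<comment> \<open>One more dimension of the range adds \<open>r + 1\<close> to the dimension of the face, and \<open>r\<close> is positive.\<close>
    then have "(r + 2) choose 2 \<le> (rank B + 1) choose 2" by (intro binomial_right_mono) simp
    moreover have "(r + 2) choose 2 = ((r + 1) choose 2) + (r + 1)"
      by (simp add: numeral_2_eq_2)
    moreover have "dim ((\<lambda>N. B ** N ** B) ` sym_perp L) \<le> dim (sym_perp L)"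
      by (rule dim_image_le[OF linear_sandwich])
    moreover have "r \<noteq> 0" using c by (cases "r = 0") (auto simp: numeral_2_eq_2)
    ultimately have "dim ((\<lambda>N. B ** N ** B) ` sym_perp L) + 2 \<le> (rank B + 1) choose 2"
      using c by linarith
    from exists_independent_sandwich[OF L BS this]
    obtain X where X: "X \<in> Sym" "B ** X ** B \<in> L" "B ** X ** B \<notin> span {B}" by blast
    obtain \<mu> where \<mu>: "\<mu> *\<^sub>R B - B ** X ** B \<in> PSD" "\<mu> *\<^sub>R B - B ** X ** B \<noteq> 0"
      "rank (\<mu> *\<^sub>R B - B ** X ** B) < rank B"
      using PSD_smaller_rank[of B X] B X by blast
    have "\<mu> *\<^sub>R B - B ** X ** B \<in> L" using L(1) B X by (simp add: subspace_diff subspace_scale)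
    then show False using min[of "\<mu> *\<^sub>R B - B ** X ** B"] \<mu> by auto
  qed
  with that B show ?thesis by blast
qed

section \<open>Moving inside a transversal subspace\<close>

lemma PSD_congr: fixes G :: "real^'n^'n" shows "A \<in> PSD \<Longrightarrow> transpose G ** A ** G \<in> PSD"
proof -
  assume A: "A \<in> PSD"
  have "0 \<le> x \<bullet> ((transpose G ** A ** G) *v x)" for x
  proof -
    have "x \<bullet> ((transpose G ** A ** G) *v x) = (G *v x) \<bullet> (A *v (G *v x))"
      using inner_matrix_vector[of G x "A *v (G *v x)"]
      by (simp add: matrix_vector_mul_assoc matrix_mul_assoc del: transpose_matrix_vector)
    then show ?thesis using PSD_imp(2)[OF A] by simp
  qed
  then show ?thesis using A by (simp add: PSD_def Sym_congr)
qed

lemma Sym_add_transpose: "A \<in> Sym \<Longrightarrow> A ** K + transpose K ** A \<in> Sym"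
  by (simp add: Sym_iff transpose_add matrix_transpose_mul add.commute)

lemma inj_one_plus:
  fixes K :: "real^'n^'n"
  assumes "\<bar>t\<bar> * norm K < 1"
  shows "inj ((*v) (mat 1 + t *\<^sub>R K))"
proof (subst linear_injective_0)
  show "linear ((*v) (mat 1 + t *\<^sub>R K))" by simp
  show "\<forall>x. (mat 1 + t *\<^sub>R K) *v x = 0 \<longrightarrow> x = 0"
  proof (intro allI impI)
    fix x assume "(mat 1 + t *\<^sub>R K) *v x = 0"
    then have "x = - (t *\<^sub>R (K *v x))"
      by (simp add: mv.add_left mv.scaleR_left eq_neg_iff_add_eq_0)
    then have "norm x = norm (t *\<^sub>R (K *v x))" by (metis norm_minus_cancel)
    then have "norm x = \<bar>t\<bar> * norm (K *v x)" by simp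
    also have "\<dots> \<le> \<bar>t\<bar> * (norm K * norm x)" by (intro mult_left_mono norm_matrix_vector_le) simp
    finally have "norm x * (1 - \<bar>t\<bar> * norm K) \<le> 0" by (simp add: algebra_simps)
    then show "x = 0" using assms by (simp add: mult_le_0_iff)
  qed
qed

text \<open>The condition that holds for all \<open>L\<close> off the exceptional set.\<close>

locale transversal_subspace =
  fixes L :: "(real^'n^'n) set"
  assumes sub: "subspace L" and LSym: "L \<subseteq> Sym"
    and transversal: "\<And>A N. A \<in> L \<Longrightarrow> N \<in> sym_perp L \<Longrightarrow> A ** N = 0 \<Longrightarrow> A = 0 \<or> N = 0"
begin

abbreviation W where "W \<equiv> sym_perp L"

lemma W_Sym: "N \<in> W \<Longrightarrow> transpose N = N"
  by (simp add: sym_perp_def Sym_iff)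

lemma L_Sym: "A \<in> L \<Longrightarrow> transpose A = A"
  using LSym by (auto simp: Sym_iff)

lemma projection_zero_iff:
  assumes \<pi>: "\<And>x. \<pi> x \<in> W" "\<And>x y. y \<in> W \<Longrightarrow> y \<bullet> \<pi> x = y \<bullet> x"
    and X: "X \<in> Sym"
  shows "\<pi> X = 0 \<longleftrightarrow> X \<in> L"
proof
  assume 0: "\<pi> X = 0"
  show "X \<in> L"
  proof (rule sym_perp_perp[OF sub LSym X])
    fix N assume "N \<in> W"
    then have "N \<bullet> X = 0" using \<pi>(2)[of N X] 0 by simp
    then show "X \<bullet> N = 0" by (simp only: inner_commute)
  qed
next
  assume "X \<in> L"
  then have "X \<bullet> \<pi> X = 0" using \<pi>(1)[of X] by (simp add: sym_perp_def)
  then have "\<pi> X \<bullet> \<pi> X = 0" using \<pi>(2)[OF \<pi>(1), of X X] by (simp add: inner_commute)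
  then show "\<pi> X = 0" by simp
qed

text \<open>Paired with \<open>v\<close>, the argument of \<open>\<pi>\<close> gives the sum of the squared norms of \<open>A ** v\<close> and \<open>v ** A\<close>, so \<open>A ** v = 0\<close>, and transversality applies.\<close>

lemma linearised_congruence_injective:
  assumes \<pi>: "\<And>x y. y \<in> W \<Longrightarrow> y \<bullet> \<pi> x = y \<bullet> x"
    and A: "A \<in> L" "A \<noteq> 0" and v: "v \<in> W" "\<pi> (A ** (A ** v) + v ** A ** A) = 0"
  shows "v = 0"
proof -
  have 1: "v \<bullet> (A ** (A ** v)) = (A ** v) \<bullet> (A ** v)"
    using inner_mult_left[of A v "A ** v"] L_Sym[OF A(1)] by simp
  have 2: "v \<bullet> (v ** A ** A) = (v ** A) \<bullet> (v ** A)"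
    using inner_mult_right[of v A "v ** A"] L_Sym[OF A(1)] by simp
  have "v \<bullet> (A ** (A ** v) + v ** A ** A) = 0" using \<pi>[OF v(1)] v(2) by (metis inner_zero_right)
  then have "(A ** v) \<bullet> (A ** v) + (v ** A) \<bullet> (v ** A) = 0" by (simp add: inner_add_right 1 2)
  then have "(A ** v) \<bullet> (A ** v) = 0"
    using inner_ge_zero[of "A ** v"] inner_ge_zero[of "v ** A"] by linarith
  then show ?thesis using transversal[OF A(1) v(1)] A(2) by simp
qed

text \<open>Expanding the congruence gives \<open>A + t *\<^sub>R R t\<close>, where the value of \<open>R\<close> at \<open>t = 0\<close> is the matrix that the assumption on \<open>K0\<close> puts into \<open>L\<close>. For small
\<open>t\<close> the projection of \<open>R t\<close> to \<open>W\<close> is killed by a small correction \<open>K = K0 + A ** v\<close> with \<open>v \<in> W\<close>. A congruence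
is used rather than an additive correction because it preserves semidefiniteness and the rank of
\<open>A + t *\<^sub>R E\<close>.\<close>

lemma perturb_by_congruence:
  assumes A: "A \<in> L" "A \<noteq> 0" and E: "E \<in> Sym"
    and K0: "E + A ** K0 + transpose K0 ** A \<in> L" and e: "0 < e"
  shows "\<forall>\<^sub>F t in nhds (0::real). \<exists>K. norm (K - K0) \<le> e \<and>
    transpose (mat 1 + t *\<^sub>R K) ** (A + t *\<^sub>R E) ** (mat 1 + t *\<^sub>R K) \<in> L"
proof -
  obtain \<pi> where \<pi>: "linear \<pi>" "\<And>x. \<pi> x \<in> W" "\<And>x y. y \<in> W \<Longrightarrow> y \<bullet> \<pi> x = y \<bullet> x"
    by (rule subspace_projection[OF subspace_sym_perp[of L]]) blast
  note lin = linear_add[OF \<pi>(1)] linear_scale[OF \<pi>(1)]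
  have bl: "bounded_linear \<pi>" using \<pi>(1) by (simp add: linear_conv_bounded_linear)
  have tA: "transpose A = A" using L_Sym A by simp
  have tE: "transpose E = E" using E by (simp add: Sym_iff)
  define K where "K v = K0 + A ** v" for v
  define R where "R t v = E + (A ** K v + transpose (K v) ** A)
      + t *\<^sub>R ((E ** K v + transpose (K v) ** E) + transpose (K v) ** A ** K v)
      + t\<^sup>2 *\<^sub>R (transpose (K v) ** E ** K v)" for t :: real and v
  have expand: "transpose (mat 1 + t *\<^sub>R K v) ** (A + t *\<^sub>R E) ** (mat 1 + t *\<^sub>R K v) = A + t *\<^sub>R R t v" for t v
    by (simp add: R_def transpose_add transpose_scaleR mm.add_left mm.add_right mm.scaleR_left
        mm.scaleR_right power2_eq_square algebra_simps)
  have RS: "R t v \<in> Sym" for t v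
    unfolding R_def using A LSym E
    by (intro subspace_add[OF subspace_Sym] subspace_scale[OF subspace_Sym] Sym_add_transpose Sym_congr) auto
  define B where "B v = \<pi> (A ** (A ** v) + v ** A ** A)" for v
  have linB: "linear B" unfolding B_def
    by (rule linearI) (simp_all add: mm.add_left mm.add_right mm.scaleR_left mm.scaleR_right
        lin algebra_simps)
  have "\<exists>M>0. \<forall>(a :: real^'n^'n) (b :: real^'n^'n). norm (a ** b) \<le> norm a * norm b * M"
    by (rule mm.pos_bounded)
  then obtain M where M: "0 < M" "\<forall>(a :: real^'n^'n) (b :: real^'n^'n). norm (a ** b) \<le> norm a * norm b * M"
    by (elim exE conjE)
  \<comment> \<open>With \<open>norm v \<le> e'\<close> the correction \<open>A ** v\<close> has norm at most \<open>e\<close>.\<close>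
  define e' where "e' = e / (norm A * M + 1)"
  have NM: "0 \<le> norm A * M" using M(1) by simp
  have e': "0 < e'" unfolding e'_def using e NM by (intro divide_pos_pos) auto
  have "\<forall>\<^sub>F t in nhds (0::real). \<exists>v\<in>W. norm v \<le> e' \<and> \<pi> (R t v) = 0"
  proof (rule perturbed_linear_zero[OF subspace_sym_perp _ _ linB _ _ e'])
    show "continuous_on UNIV (\<lambda>z. \<pi> (R (fst z) (snd z)))"
      unfolding R_def K_def
      by (intro bounded_linear.continuous_on[OF bl] continuous_intros mm.continuous_on)
    show "\<pi> (R t v) \<in> W" if "v \<in> W" for t v by (rule \<pi>(2))
    show "\<pi> (R 0 v) = B v" if v: "v \<in> W" for v
    proof -
      have "R 0 v = (E + A ** K0 + transpose K0 ** A) + (A ** (A ** v) + v ** A ** A)"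
        by (simp add: R_def K_def transpose_add matrix_transpose_mul tA W_Sym[OF v] mm.add_left mm.add_right)
      moreover have "\<pi> (E + A ** K0 + transpose K0 ** A) = 0"
        using projection_zero_iff[OF \<pi>(2,3)] K0 LSym by blast
      ultimately show ?thesis by (simp only: lin B_def) simp
    qed
    show "v = 0" if "v \<in> W" "B v = 0" for v
      by (rule linearised_congruence_injective[OF \<pi>(3) A that(1)]) (use that(2) in \<open>simp_all add: B_def\<close>)
  qed
  then show ?thesis
  proof (rule eventually_mono)
    fix t :: real assume "\<exists>v\<in>W. norm v \<le> e' \<and> \<pi> (R t v) = 0"
    then obtain v where v: "v \<in> W" "norm v \<le> e'" "\<pi> (R t v) = 0" by blast
    have "R t v \<in> L" using projection_zero_iff[OF \<pi>(2,3) RS] v(3) by blast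
    then have "A + t *\<^sub>R R t v \<in> L" using sub A by (simp add: subspace_add subspace_scale)
    moreover have "norm (K v - K0) \<le> e"
    proof -
      have "norm (K v - K0) \<le> norm A * norm v * M" using M(2)[rule_format, of A v] by (simp add: K_def)
      also have "\<dots> = (norm A * M) * norm v" by simp
      also have "\<dots> \<le> (norm A * M) * e'" using v(2) NM by (rule mult_left_mono)
      also have "\<dots> \<le> e" unfolding e'_def using e NM by (simp add: field_simps)
      finally show ?thesis .
    qed
    ultimately show "\<exists>K. norm (K - K0) \<le> e \<and>
      transpose (mat 1 + t *\<^sub>R K) ** (A + t *\<^sub>R E) ** (mat 1 + t *\<^sub>R K) \<in> L"
      using expand[of t v] by (intro exI[of _ "K v"]) simp
  qed
qed

text \<open>Adding a small positive multiple of \<open>outer x x\<close> with \<open>x\<close> in the null space raises the rank by one but may leave \<open>L\<close>; a congruence near the identity brings the result back.\<close>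

lemma raise_rank:
  assumes A: "A \<in> PSD \<inter> L" "A \<noteq> 0" "rank A < CARD('n)"
  shows "\<exists>B \<in> PSD \<inter> L. rank B = Suc (rank A)"
proof -
  have AL: "A \<in> L" and AP: "A \<in> PSD" using A by auto
  have AS: "A \<in> Sym" using AP by (simp add: PSD_imp)
  have tA: "transpose A = A" using L_Sym AL by simp
  have "dim (null_space A) \<noteq> 0" using rank_plus_dim_null_space[of A] A(3) by linarith
  then have "\<not> null_space A \<subseteq> {0}" unfolding dim_eq_0 .
  then obtain x where x: "x \<in> null_space A" "x \<noteq> 0" by blast
  define E where "E = outer x x"
  have E: "E \<in> Sym" by (simp add: E_def Sym_iff transpose_outer)
  have Ev: "E *v z = (x \<bullet> z) *\<^sub>R x" for z by (simp add: E_def outer_mult)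
  obtain \<pi> where \<pi>: "linear \<pi>" "\<And>x. \<pi> x \<in> W" "\<And>x y. y \<in> W \<Longrightarrow> y \<bullet> \<pi> x = y \<bullet> x"
    by (rule subspace_projection[OF subspace_sym_perp[of L]]) blast
  note lin = linear_add[OF \<pi>(1)] linear_scale[OF \<pi>(1)]
  define B where "B v = \<pi> (A ** (A ** v) + v ** A ** A)" for v
  have linB: "linear B" unfolding B_def
    by (rule linearI) (simp_all add: mm.add_left mm.add_right mm.scaleR_left mm.scaleR_right
        lin algebra_simps)
  have "B ` W = W"
  proof (rule injective_on_subspace_surjective[OF subspace_sym_perp linB])
    show "B v \<in> W" for v by (simp add: B_def \<pi>)
    show "v = 0" if "v \<in> W" "B v = 0" for v
      by (rule linearised_congruence_injective[OF \<pi>(3) AL A(2) that(1)]) (use that(2) in \<open>simp_all add: B_def\<close>)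
  qed
  moreover have "- \<pi> E \<in> W" by (intro subspace_neg[OF subspace_sym_perp] \<pi>)
  ultimately obtain v where v: "v \<in> W" "B v = - \<pi> E" by (metis imageE)
  define K0 where "K0 = A ** v"
  have sum_eq: "E + A ** K0 + transpose K0 ** A = E + (A ** (A ** v) + v ** A ** A)"
    by (simp add: K0_def matrix_transpose_mul tA W_Sym[OF v(1)])
  have K0L: "E + A ** K0 + transpose K0 ** A \<in> L"
  proof -
    have "E + A ** K0 + transpose K0 ** A \<in> Sym"
      using subspace_add[OF subspace_Sym E Sym_add_transpose[OF AS, of K0]] by (simp add: add.assoc)
    moreover have "\<pi> (E + A ** K0 + transpose K0 ** A) = 0"
      unfolding sum_eq using v(2) by (simp only: lin B_def) simp
    ultimately show ?thesis using projection_zero_iff[OF \<pi>(2,3)] by blast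
  qed
  obtain d where d: "0 < d" "\<And>t. dist t 0 < d \<Longrightarrow> \<exists>K. norm (K - K0) \<le> 1 \<and>
    transpose (mat 1 + t *\<^sub>R K) ** (A + t *\<^sub>R E) ** (mat 1 + t *\<^sub>R K) \<in> L"
    using perturb_by_congruence[OF AL A(2) E K0L, of 1] unfolding eventually_nhds_metric by auto
  define t where "t = min (d / 2) (1 / (norm K0 + 2))"
  have t: "0 < t" "dist t 0 < d" "t * (norm K0 + 2) \<le> 1"
  proof -
    have p: "0 < norm K0 + 2" by (simp add: add_nonneg_pos)
    show "0 < t" using d(1) p by (simp add: t_def)
    then show "dist t 0 < d" using d(1) by (simp add: t_def)
    have "t \<le> 1 / (norm K0 + 2)" by (simp add: t_def)
    then show "t * (norm K0 + 2) \<le> 1" using p by (simp add: pos_le_divide_eq)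
  qed
  obtain K where K: "norm (K - K0) \<le> 1"
    "transpose (mat 1 + t *\<^sub>R K) ** (A + t *\<^sub>R E) ** (mat 1 + t *\<^sub>R K) \<in> L"
    using d(2)[OF t(2)] by blast
  define G where "G = mat 1 + t *\<^sub>R K"
  define M where "M = A + t *\<^sub>R E"
  have "norm K \<le> norm K0 + 1" using K(1) norm_triangle_sub[of K K0] by linarith
  then have "t * norm K \<le> t * (norm K0 + 1)" using t(1) by (intro mult_left_mono) auto
  also have "\<dots> < 1" using t(1,3) by (simp add: algebra_simps)
  finally have "inj ((*v) G)" unfolding G_def using t(1) by (intro inj_one_plus) simp
  then have rG: "rank (transpose G ** M ** G) = rank M" by (rule rank_congr)
  have form: "z \<bullet> (M *v z) = z \<bullet> (A *v z) + t * (x \<bullet> z)\<^sup>2" for z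
    by (simp add: M_def mv.add_left mv.scaleR_left Ev inner_add_right power2_eq_square inner_commute)
  have MP: "M \<in> PSD"
  proof -
    have "M \<in> Sym" unfolding M_def by (intro subspace_add[OF subspace_Sym] subspace_scale[OF subspace_Sym] AS E)
    moreover have "0 \<le> z \<bullet> (M *v z)" for z
      unfolding form using PSD_imp(2)[OF AP, of z] t(1) by simp
    ultimately show ?thesis by (simp add: PSD_def)
  qed
  have null_M: "null_space M = {z\<in>null_space A. \<forall>y\<in>span {x}. orthogonal y z}"
  proof (intro equalityI subsetI)
    fix z assume "z \<in> null_space M"
    then have "z \<bullet> (A *v z) + t * (x \<bullet> z)\<^sup>2 = 0" using form[of z] by (simp add: null_space_def)
    moreover have "0 \<le> z \<bullet> (A *v z)" "0 \<le> t * (x \<bullet> z)\<^sup>2" using PSD_imp(2)[OF AP, of z] t(1) by auto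
    ultimately have z: "z \<bullet> (A *v z) = 0" "t * (x \<bullet> z)\<^sup>2 = 0" by linarith+
    have "z \<in> null_space A" using PSD_form_zero[OF AP z(1)] by (simp add: null_space_def)
    then show "z \<in> {z\<in>null_space A. \<forall>y\<in>span {x}. orthogonal y z}"
      using z(2) t(1) by (auto simp: span_singleton Linear_Algebra.orthogonal_def)
  next
    fix z assume z: "z \<in> {z\<in>null_space A. \<forall>y\<in>span {x}. orthogonal y z}"
    then have "orthogonal x z" by (simp add: span_base)
    then show "z \<in> null_space M"
      using z by (simp add: null_space_def M_def mv.add_left mv.scaleR_left Ev Linear_Algebra.orthogonal_def)
  qed
  have "dim (null_space M) + dim (span {x}) = dim (null_space A)"
    unfolding null_M using x
    by (intro dim_subspace_orthogonal_to_vectors subspace_span subspace_null_space span_minimal) auto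
  moreover have "dim (span {x}) = 1" using x by simp
  ultimately have "rank M = Suc (rank A)"
    using rank_plus_dim_null_space[of A] rank_plus_dim_null_space[of M] by linarith
  moreover have "transpose G ** M ** G \<in> PSD \<inter> L" using K(2) PSD_congr[OF MP] by (simp add: G_def M_def)
  ultimately show ?thesis using rG by (intro bexI[of _ "transpose G ** M ** G"]) simp_all
qed

lemma exists_rank_eq:
  assumes A: "A \<in> PSD \<inter> L" "A \<noteq> 0" "rank A \<le> r" "r \<le> CARD('n)"
  shows "\<exists>B \<in> PSD \<inter> L. rank B = r"
proof -
  have "\<exists>B \<in> PSD \<inter> L. B \<noteq> 0 \<and> rank B = r"
    using A(3,4)
  proof (induction r rule: dec_induct)
    case base
    then show ?case using A by blast
  next
    case (step k)
    then obtain B where B: "B \<in> PSD \<inter> L" "B \<noteq> 0" "rank B = k" by auto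
    then obtain C where C: "C \<in> PSD \<inter> L" "rank C = Suc k" using raise_rank[of B] step by auto
    then have "C \<noteq> 0" using rank_0 by (metis nat.distinct(1))
    then show ?case using C by blast
  qed
  then show ?thesis by blast
qed

end

section \<open>Transversality to a face\<close>

context transversal_subspace
begin

text \<open>If \<open>A ** X ** A ** N\<close> were outside \<open>A ** W\<close>, its component \<open>K0\<close> orthogonal to \<open>A ** W\<close> would be a direction tangent to
\<open>L\<close>, since orthogonality to \<open>A ** W\<close> says that \<open>A ** K0 + transpose K0 ** A\<close> is orthogonal to \<open>W\<close>. Moving \<open>A\<close> in this direction, the derivative of
\<open>A ** N ** A\<close> has a nonzero inner product with \<open>X\<close>, although \<open>X\<close> is orthogonal to \<open>A ** M ** A\<close> for all
\<open>M \<in> W\<close>. So the space of annihilated elements would shrink, against the minimality.\<close>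

lemma first_order_rigidity:
  assumes A: "A \<in> PSD \<inter> L" "A \<noteq> 0"
    and min: "\<And>B. B \<in> PSD \<inter> L \<Longrightarrow> rank B = rank A \<Longrightarrow>
      dim {N\<in>W. A ** N ** A = 0} \<le> dim {N\<in>W. B ** N ** B = 0}"
    and X: "X \<in> Sym" "A ** X ** A \<in> L"
    and N: "N \<in> W" "A ** N ** A = 0"
  shows "\<exists>N'\<in>W. A ** X ** A ** N = A ** N'"
proof (rule ccontr)
  assume no: "\<not> ?thesis"
  have AL: "A \<in> L" and AP: "A \<in> PSD" using A by auto
  have AS: "A \<in> Sym" using AP by (simp add: PSD_imp)
  have tA: "transpose A = A" using L_Sym AL by simp
  have tN: "transpose N = N" using W_Sym N by simp
  have tX: "transpose X = X" using X(1) by (simp add: Sym_iff)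
  define C where "C = A ** X ** A ** N"
  have linA: "linear (\<lambda>M :: real^'n^'n. A ** M)"
    by (rule linearI) (simp_all add: mm.add_right mm.scaleR_right)
  define I where "I = (\<lambda>M. A ** M) ` W"
  have sI: "subspace I" unfolding I_def by (rule linear_subspace_image[OF linA subspace_sym_perp])
  have CI: "C \<notin> I" using no by (auto simp: I_def C_def)
  obtain \<pi> where \<pi>: "linear \<pi>" "\<And>x. \<pi> x \<in> I" "\<And>x y. y \<in> I \<Longrightarrow> y \<bullet> \<pi> x = y \<bullet> x"
    by (rule subspace_projection[OF sI]) blast
  define K0 where "K0 = C - \<pi> C"
  have K0I: "M \<bullet> K0 = 0" if "M \<in> I" for M using \<pi>(3)[OF that, of C] by (simp add: K0_def inner_diff_right)
  have K0C: "K0 \<bullet> C \<noteq> 0"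
  proof
    assume "K0 \<bullet> C = 0"
    moreover have "K0 \<bullet> \<pi> C = 0" using K0I[OF \<pi>(2), of C] by (simp only: inner_commute)
    ultimately have "K0 \<bullet> K0 = 0" by (simp add: K0_def inner_diff_right)
    then have "C = \<pi> C" by (simp add: K0_def)
    then show False using CI \<pi>(2)[of C] by simp
  qed
  have K0L: "0 + A ** K0 + transpose K0 ** A \<in> L"
  proof (rule sym_perp_perp[OF sub LSym])
    show "0 + A ** K0 + transpose K0 ** A \<in> Sym" using Sym_add_transpose[OF AS, of K0] by simp
    fix M assume M: "M \<in> W"
    have 1: "(A ** K0) \<bullet> M = (A ** M) \<bullet> K0"
      using inner_mult_left[of A K0 M] by (simp add: tA inner_commute)
    have "(transpose K0 ** A) \<bullet> M = transpose (A ** K0) \<bullet> transpose M"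
      by (simp add: matrix_transpose_mul tA W_Sym[OF M])
    also have "\<dots> = (A ** M) \<bullet> K0" by (simp only: inner_transpose 1)
    finally have 2: "(transpose K0 ** A) \<bullet> M = (A ** M) \<bullet> K0" .
    have "(A ** M) \<bullet> K0 = 0" by (rule K0I) (use M in \<open>simp add: I_def\<close>)
    then show "(0 + A ** K0 + transpose K0 ** A) \<bullet> M = 0" by (simp add: inner_add_left 1 2)
  qed
  have "\<exists>t K. 0 < t \<and> t \<le> 1 / real (Suc j) \<and> norm (K - K0) \<le> 1 / real (Suc j) \<and> t * norm K < 1 \<and>
      transpose (mat 1 + t *\<^sub>R K) ** A ** (mat 1 + t *\<^sub>R K) \<in> L" for j
  proof -
    have z: "(0 :: real^'n^'n) \<in> Sym" using subspace_Sym by (rule subspace_0)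
    have "0 < 1 / real (Suc j)" by simp
    from perturb_by_congruence[OF AL A(2) z K0L this]
    obtain d where d: "0 < d" "\<And>t. dist t 0 < d \<Longrightarrow> \<exists>K. norm (K - K0) \<le> 1 / real (Suc j) \<and>
      transpose (mat 1 + t *\<^sub>R K) ** (A + t *\<^sub>R 0) ** (mat 1 + t *\<^sub>R K) \<in> L"
      unfolding eventually_nhds_metric by auto
    define t where "t = min (d / 2) (min (1 / (norm K0 + 2)) (1 / real (Suc j)))"
    have p: "0 < norm K0 + 2" by (simp add: add_nonneg_pos)
    have t: "0 < t" using d(1) p by (simp add: t_def)
    have "dist t 0 < d" using d(1) t by (simp add: t_def)
    then obtain K where K: "norm (K - K0) \<le> 1 / real (Suc j)"
      "transpose (mat 1 + t *\<^sub>R K) ** (A + t *\<^sub>R 0) ** (mat 1 + t *\<^sub>R K) \<in> L" using d(2) by blast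
    have "t \<le> 1 / (norm K0 + 2)" by (simp add: t_def)
    then have t2: "t * (norm K0 + 2) \<le> 1" using p by (simp add: pos_le_divide_eq)
    have "1 / real (Suc j) \<le> 1" by simp
    then have "norm K \<le> norm K0 + 1" using K(1) norm_triangle_sub[of K K0] by linarith
    then have "t * norm K \<le> t * (norm K0 + 1)" using t by (intro mult_left_mono) auto
    also have "\<dots> < 1" using t t2 by (simp add: algebra_simps)
    finally have "t * norm K < 1" .
    moreover have "t \<le> 1 / real (Suc j)" by (simp add: t_def)
    ultimately show ?thesis using t K by auto
  qed
  then obtain t K where tK: "\<And>j. 0 < t j" "\<And>j. t j \<le> 1 / real (Suc j)"
    "\<And>j. norm (K j - K0) \<le> 1 / real (Suc j)" "\<And>j. t j * norm (K j) < 1"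
    "\<And>j. transpose (mat 1 + t j *\<^sub>R K j) ** A ** (mat 1 + t j *\<^sub>R K j) \<in> L"
    by metis
  have t0: "t \<longlonglongrightarrow> 0"
    by (rule tendsto_sandwich[OF _ _ tendsto_const LIMSEQ_Suc[OF lim_1_over_n]])
      (use tK(1,2) in \<open>auto intro!: always_eventually less_imp_le\<close>)
  have KK: "K \<longlonglongrightarrow> K0"
  proof (rule LIM_zero_cancel, rule Lim_null_comparison)
    show "\<forall>\<^sub>F j in sequentially. norm (K j - K0) \<le> 1 / real (Suc j)" using tK(3) by simp
    show "(\<lambda>j. 1 / real (Suc j)) \<longlonglongrightarrow> 0" by (rule LIMSEQ_Suc[OF lim_1_over_n])
  qed
  define G where "G j = mat 1 + t j *\<^sub>R K j" for j
  have G1: "G \<longlonglongrightarrow> mat 1 + 0 *\<^sub>R K0" unfolding G_def[abs_def]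
    by (intro tendsto_intros t0 KK)
  then have G1': "G \<longlonglongrightarrow> mat 1" by simp
  \<comment> \<open>Up to an invertible congruence this is the map \<open>x \<mapsto> B ** x ** B\<close> for \<open>B = transpose p ** A ** p\<close>.\<close>
  define \<Phi> where "\<Phi> p x = A ** p ** x ** transpose p ** A" for p x :: "real^'n^'n"
  define D where "D = A ** (K0 ** N + N ** transpose K0) ** A"
  have \<Phi>1: "\<Phi> (mat 1) x = A ** x ** A" for x
    by (simp add: \<Phi>_def Finite_Cartesian_Product.transpose_mat)
  have "\<exists>j. dim {x\<in>W. \<Phi> (G j) x = 0} < dim {x\<in>W. \<Phi> (mat 1) x = 0}"
  proof (rule kernel_dim_drop[where N = N and D = D and t = t])
    show "subspace W" by (rule subspace_sym_perp)
    show "linear (\<Phi> p)" for p unfolding \<Phi>_def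
      by (rule linearI) (simp_all add: mm.add_left mm.add_right mm.scaleR_left mm.scaleR_right)
    show "continuous_on UNIV (\<lambda>z. \<Phi> (fst z) (snd z))"
      unfolding \<Phi>_def by (intro continuous_intros mm.continuous_on)
    show "G \<longlonglongrightarrow> mat 1" by (rule G1')
    show "N \<in> W" "\<Phi> (mat 1) N = 0" using N by (simp_all add: \<Phi>1)
    show "t j \<noteq> 0" for j using tK(1)[of j] by simp
    show "(\<lambda>j. inverse (t j) *\<^sub>R \<Phi> (G j) N) \<longlonglongrightarrow> D"
    proof -
      have "\<Phi> (G j) N = t j *\<^sub>R (A ** (K j ** N + N ** transpose (K j)) ** A
          + t j *\<^sub>R (A ** K j ** N ** transpose (K j) ** A))" for j
        unfolding \<Phi>_def G_def using N(2)
        by (simp add: transpose_add transpose_scaleR mm.add_left mm.add_right mm.scaleR_left mm.scaleR_right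
            scaleR_add_right matrix_mul_assoc Finite_Cartesian_Product.transpose_mat)
      then have "inverse (t j) *\<^sub>R \<Phi> (G j) N = A ** (K j ** N + N ** transpose (K j)) ** A
          + t j *\<^sub>R (A ** K j ** N ** transpose (K j) ** A)" for j
        using tK(1)[of j] by simp
      moreover have "(\<lambda>j. A ** (K j ** N + N ** transpose (K j)) ** A
          + t j *\<^sub>R (A ** K j ** N ** transpose (K j) ** A)) \<longlonglongrightarrow>
          A ** (K0 ** N + N ** transpose K0) ** A + 0 *\<^sub>R (A ** K0 ** N ** transpose K0 ** A)"
        by (intro tendsto_add tendsto_scaleR mm.tendsto tendsto_const tendsto_transpose KK t0)
      ultimately show ?thesis by (simp add: D_def)
    qed
    show "D \<notin> \<Phi> (mat 1) ` W"
    proof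
      assume "D \<in> \<Phi> (mat 1) ` W"
      then obtain M where M: "M \<in> W" "D = A ** M ** A" by (auto simp: \<Phi>1)
      have "X \<bullet> D = (A ** X ** A) \<bullet> M" using inner_sandwich[of A X A M] by (simp add: M(2) tA)
      also have "\<dots> = 0" using X(2) M(1) by (simp add: sym_perp_def)
      finally have 0: "X \<bullet> D = 0" .
      define Y where "Y = A ** X ** A"
      have tY: "transpose Y = Y" by (simp add: Y_def matrix_transpose_mul tA tX matrix_mul_assoc)
      have "X \<bullet> D = Y \<bullet> (K0 ** N + N ** transpose K0)"
        using inner_sandwich[of A X A "K0 ** N + N ** transpose K0"] by (simp add: D_def tA Y_def)
      also have "\<dots> = Y \<bullet> (K0 ** N) + Y \<bullet> (N ** transpose K0)" by (rule inner_add_right)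
      also have "Y \<bullet> (N ** transpose K0) = transpose Y \<bullet> transpose (N ** transpose K0)"
        by (simp only: inner_transpose)
      also have "\<dots> = Y \<bullet> (K0 ** N)" by (simp add: tY matrix_transpose_mul tN)
      also have "Y \<bullet> (K0 ** N) = K0 \<bullet> C"
        using inner_mult_right[of K0 N Y] by (simp add: tN Y_def C_def inner_commute)
      finally show False using 0 K0C by simp
    qed
  qed
  then obtain j where j: "dim {x\<in>W. \<Phi> (G j) x = 0} < dim {x\<in>W. A ** x ** A = 0}"
    by (auto simp: \<Phi>1)
  define B where "B = transpose (G j) ** A ** G j"
  have BL: "B \<in> PSD \<inter> L" using tK(5)[of j] PSD_congr[OF AP, of "G j"] by (simp add: B_def G_def)
  have injG: "inj ((*v) (G j))" unfolding G_def
    using tK(1,4)[of j] by (intro inj_one_plus) simp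
  have rB: "rank B = rank A" unfolding B_def by (rule rank_congr[OF injG])
  \<comment> \<open>An inverse of \<open>G j\<close> removes the outer factors of \<open>B ** x ** B\<close>.\<close>
  obtain H where H: "H ** G j = mat 1" using injG matrix_left_invertible_injective by blast
  have H': "transpose (G j) ** transpose H = mat 1"
    by (metis H matrix_transpose_mul Finite_Cartesian_Product.transpose_mat)
  have H2: "G j ** H = mat 1" "transpose H ** transpose (G j) = mat 1"
    using H H' matrix_left_right_inverse by blast+
  have "\<Phi> (G j) x = 0" if "B ** x ** B = 0" for x
  proof -
    have "transpose H ** (B ** x ** B) ** H = (transpose H ** transpose (G j)) ** A ** G j ** x **
        transpose (G j) ** A ** (G j ** H)"
      by (simp add: B_def matrix_mul_assoc)
    then show ?thesis using that by (simp add: H2 \<Phi>_def)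
  qed
  then have "{x\<in>W. B ** x ** B = 0} \<subseteq> {x\<in>W. \<Phi> (G j) x = 0}" by auto
  then have "dim {x\<in>W. B ** x ** B = 0} \<le> dim {x\<in>W. \<Phi> (G j) x = 0}" by (rule dim_subset)
  then show False using min[OF BL rB] j by linarith
qed

lemma bilinear_matrix_form: "bilinear (\<lambda>(N :: real^'n^'n) (M :: real^'n^'n). N \<bullet> (C ** M))" for C :: "real^'n^'n"
  unfolding bilinear_def
  by (auto intro!: linearI simp: inner_add_left inner_add_right mm.add_right mm.scaleR_right)

text \<open>The conclusion says that \<open>L\<close> and the sandwiches of \<open>A\<close> together span all symmetric matrices. If it failed for the \<open>A\<close>
with the fewest annihilated elements, the partner map of \<open>first_order_rigidity\<close> on these elements would have an
eigenvector, and this contradicts transversality.\<close>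

lemma exists_face_transversal_point:
  assumes r: "0 < r" and c: "dim W < (r + 1) choose 2"
    and ex: "A0 \<in> PSD \<inter> L" "rank A0 = r"
  obtains A where "A \<in> PSD \<inter> L" "rank A = r" "\<And>N. N \<in> W \<Longrightarrow> A ** N ** A = 0 \<Longrightarrow> N = 0"
proof -
  define k where "k B = dim {N\<in>W. B ** N ** B = 0}" for B :: "real^'n^'n"
  have "\<exists>A. A \<in> PSD \<inter> L \<and> rank A = r" using ex by blast
  then obtain A where A: "A \<in> PSD \<inter> L \<and> rank A = r"
    and min: "\<And>B. B \<in> PSD \<inter> L \<and> rank B = r \<Longrightarrow> k A \<le> k B"
    using ex_has_least_nat[of "\<lambda>A. A \<in> PSD \<inter> L \<and> rank A = r" _ k] by blast
  have AL: "A \<in> L" and AP: "A \<in> PSD" using A by auto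
  have AS: "A \<in> Sym" using AP by (simp add: PSD_imp)
  have A0: "A \<noteq> 0" using A r rank_0 by (metis less_irrefl)
  have tA: "transpose A = A" using L_Sym AL by simp
  define S where "S = {N\<in>W. A ** N ** A = 0}"
  have lin: "linear (\<lambda>N. A ** N ** A)" by (rule linear_sandwich)
  have sS: "subspace S" unfolding S_def
    using subspace_inter[OF subspace_sym_perp[of L] linear_subspace_kernel[OF lin]] by (simp add: Int_def)
  have "S \<subseteq> {0}"
  proof (rule ccontr)
    assume "\<not> S \<subseteq> {0}"
    then have dS: "dim S \<noteq> 0" unfolding dim_eq_0 .
    from \<open>\<not> S \<subseteq> {0}\<close> obtain w0 where w0: "w0 \<in> S" "w0 \<noteq> 0" by blast
    have "dim W = dim S + dim ((\<lambda>N. A ** N ** A) ` W)"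
      unfolding S_def by (rule dim_kernel_plus_dim_image[OF lin subspace_sym_perp])
    moreover have rA: "rank A = r" using A by simp
    ultimately have "dim ((\<lambda>N. A ** N ** A) ` W) + 2 \<le> (rank A + 1) choose 2"
      unfolding rA using dS c by linarith
    then obtain X where X: "X \<in> Sym" "A ** X ** A \<in> L" "A ** X ** A \<notin> span {A}"
      by (rule exists_independent_sandwich[OF sub LSym AS])
    define Y where "Y = A ** X ** A"
    have tY: "transpose Y = Y" unfolding Y_def using X(2) L_Sym by simp
    have symY: "N \<bullet> (Y ** M) = M \<bullet> (Y ** N)" for N M :: "real^'n^'n"
      using inner_mult_left[of Y N M] by (simp add: tY inner_commute)
    have symA: "N \<bullet> (A ** M) = M \<bullet> (A ** N)" for N M :: "real^'n^'n"
      using inner_mult_left[of A N M] by (simp add: tA inner_commute)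
    have Apos: "A ** N = 0 \<Longrightarrow> N = 0" if "N \<in> W" for N using transversal[OF AL that] A0 by blast
    \<comment> \<open>The form \<open>N \<bullet> (A ** M)\<close> is definite on \<open>S\<close> by transversality.\<close>
    obtain l w where w: "w \<in> S" "w \<noteq> 0" "\<And>u. u \<in> S \<Longrightarrow> u \<bullet> (Y ** w) = l * (u \<bullet> (A ** w))"
    proof (rule max_ratio_eigenvector[OF sS w0 bilinear_matrix_form[of Y] symY bilinear_matrix_form[of A] symA])
      show "0 < N \<bullet> (A ** N)" if N: "N \<in> S" "N \<noteq> 0" for N
      proof -
        have "N \<bullet> (A ** N) \<noteq> 0" using PSD_inner_mult_zero[OF AP, of N] Apos[of N] N by (auto simp: S_def)
        then show ?thesis using PSD_inner_mult_nonneg[OF AP, of N] by linarith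
      qed
    qed (rule that)
    have wW: "w \<in> W" "A ** w ** A = 0" using w(1) by (auto simp: S_def)
    have "\<exists>N'\<in>W. A ** X ** A ** w = A ** N'"
    proof (rule first_order_rigidity[OF _ A0 _ X(1,2) wW])
      show "A \<in> PSD \<inter> L" using A by blast
      show "dim {N \<in> W. A ** N ** A = 0} \<le> dim {N \<in> W. B ** N ** B = 0}"
        if "B \<in> PSD \<inter> L" "rank B = rank A" for B
        using min[of B] that A by (simp add: k_def)
    qed
    then obtain N' where N': "N' \<in> W" "Y ** w = A ** N'" by (auto simp: Y_def)
    have "A ** N' ** A = A ** X ** (A ** w ** A)"
      by (simp add: N'(2)[symmetric] Y_def matrix_mul_assoc)
    then have "N' \<in> S" using N' wW by (simp add: S_def)
    \<comment> \<open>The eigenvector equation holds weakly, against \<open>S\<close>; testing it with \<open>u\<close> itself makes it hold exactly.\<close>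
    define u where "u = N' - l *\<^sub>R w"
    have uS: "u \<in> S" unfolding u_def by (intro subspace_diff[OF sS] subspace_scale[OF sS] w \<open>N' \<in> S\<close>)
    have Au: "A ** u = Y ** w - l *\<^sub>R (A ** w)" by (simp add: u_def mm.diff_right mm.scaleR_right N'(2))
    have "u \<bullet> (A ** u) = 0" unfolding Au using w(3)[OF uS] by (simp add: inner_diff_right)
    then have "A ** u = 0" by (rule PSD_inner_mult_zero[OF AP])
    then have "(Y - l *\<^sub>R A) ** w = 0" using Au by (simp add: mm.diff_left mm.scaleR_left)
    moreover have "Y - l *\<^sub>R A \<in> L" unfolding Y_def by (intro subspace_diff[OF sub] subspace_scale[OF sub] X AL)
    ultimately have "Y - l *\<^sub>R A = 0" using transversal[of "Y - l *\<^sub>R A" w] wW(1) w(2) by blast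
    then have "Y = l *\<^sub>R A" by simp
    then show False using X(3) by (simp add: Y_def span_base span_scale)
  qed
  then have "N = 0" if "N \<in> W" "A ** N ** A = 0" for N using that by (auto simp: S_def)
  with that A show ?thesis by blast
qed

end

section \<open>Kernels near a transversal point\<close>

lemma abs_form_le_norm: "\<bar>x \<bullet> (M *v x)\<bar> \<le> norm M * (x \<bullet> x)" for M :: "real^'n^'n"
proof -
  have "\<bar>x \<bullet> (M *v x)\<bar> \<le> norm x * norm (M *v x)" by (rule Cauchy_Schwarz_ineq2)
  also have "\<dots> \<le> norm x * (norm M * norm x)" by (intro mult_left_mono norm_matrix_vector_le) simp
  also have "\<dots> = norm M * (x \<bullet> x)" by (simp add: dot_square_norm power2_eq_square)
  finally show ?thesis .
qed

lemma form_coercive_on_subspace: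
  fixes A :: "real^'n^'n"
  assumes S: "subspace S" and pos: "\<And>x. x \<in> S \<Longrightarrow> x \<noteq> 0 \<Longrightarrow> 0 < x \<bullet> (A *v x)"
  obtains \<alpha> where "0 < \<alpha>" "\<And>x. x \<in> S \<Longrightarrow> \<alpha> * (x \<bullet> x) \<le> x \<bullet> (A *v x)"
proof (cases "S \<subseteq> {0}")
  case True
  then show ?thesis by (intro that[of 1]) auto
next
  case False
  then obtain w where w: "w \<in> S" "w \<noteq> 0" by blast
  define K where "K = S \<inter> sphere 0 1"
  have K: "compact K" unfolding K_def
    by (rule closed_Int_compact[OF closed_subspace[OF S] compact_sphere])
  have "w /\<^sub>R norm w \<in> K" using w S by (simp add: K_def subspace_scale)
  then have "K \<noteq> {}" by auto
  moreover have "continuous_on K (\<lambda>x. x \<bullet> (A *v x))"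
    by (intro continuous_intros mv.continuous_on)
  ultimately obtain u where u: "u \<in> K" "\<And>x. x \<in> K \<Longrightarrow> u \<bullet> (A *v u) \<le> x \<bullet> (A *v x)"
    using continuous_attains_inf[OF K] by blast
  have "0 < u \<bullet> (A *v u)" using u(1) by (intro pos) (auto simp: K_def)
  moreover have "u \<bullet> (A *v u) * (x \<bullet> x) \<le> x \<bullet> (A *v x)" if x: "x \<in> S" for x
  proof (cases "x = 0")
    case False
    define y where "y = x /\<^sub>R norm x"
    have y: "y \<in> K" using x S False by (simp add: K_def y_def subspace_scale)
    have xy: "x = norm x *\<^sub>R y" using False by (simp add: y_def)
    have "x \<bullet> (A *v x) = (norm x)\<^sup>2 * (y \<bullet> (A *v y))"
      by (subst (1 2) xy) (simp add: mv.scaleR_right power2_eq_square)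
    moreover have "(norm x)\<^sup>2 * (u \<bullet> (A *v u)) \<le> (norm x)\<^sup>2 * (y \<bullet> (A *v y))"
      using u(2)[OF y] by (intro mult_left_mono) auto
    ultimately show ?thesis by (simp add: dot_square_norm mult.commute)
  qed simp
  ultimately show ?thesis by (rule that)
qed

text \<open>The range of \<open>S\<close> lies in the null space of \<open>X\<close> and is a complement of \<open>V\<close>, so the form of \<open>X\<close> is determined by its restriction to \<open>V\<close>.\<close>

lemma PSD_of_complementary_kernel:
  fixes X S :: "real^'n^'n"
  assumes X: "X \<in> Sym" "X ** S = 0" and V: "subspace V"
    and pos: "\<And>x. x \<in> V \<Longrightarrow> x \<noteq> 0 \<Longrightarrow> 0 < x \<bullet> (X *v x)"
    and d: "CARD('n) \<le> dim V + rank S"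
  shows "X \<in> PSD" "rank X = dim V"
proof -
  define R where "R = range ((*v) S)"
  have R: "subspace R" "dim R = rank S" unfolding R_def
    by (simp_all add: linear_subspace_image subspace_UNIV rank_dim_range)
  have XR: "X *v z = 0" if z: "z \<in> R" for z
  proof -
    obtain y where "z = S *v y" using z unfolding R_def by (rule rangeE)
    then have "X *v z = (X ** S) *v y" by (simp add: matrix_vector_mul_assoc)
    then show ?thesis using X(2) by simp
  qed
  have int: "V \<inter> R = {0}"
  proof -
    have "z = 0" if "z \<in> V" "z \<in> R" for z using pos[of z] XR[of z] that by force
    then show ?thesis using V R(1) by (auto simp: subspace_0)
  qed
  have "dim {x + y |x y. x \<in> V \<and> y \<in> R} = dim V + rank S"
    using dim_sums_Int[OF V R(1)] int R(2) by simp
  then have dd: "dim {x + y |x y. x \<in> V \<and> y \<in> R} \<ge> DIM(real^'n)" "dim V + rank S = CARD('n)"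
    using d dim_subset_UNIV[of "{x + y |x y. x \<in> V \<and> y \<in> R}"] by auto
  have "{x + y |x y. x \<in> V \<and> y \<in> R} = UNIV"
    using dd(1) subspace_sums[OF V R(1)] by (intro subspace_dim_equal) auto
  then have dec: "\<exists>y\<in>V. \<exists>z\<in>R. x = y + z" for x by blast
  have "0 \<le> x \<bullet> (X *v x)" for x
  proof -
    obtain y z where yz: "y \<in> V" "z \<in> R" "x = y + z" using dec[of x] by blast
    have "x \<bullet> (X *v x) = y \<bullet> (X *v y)"
      using XR[OF yz(2)] Sym_inner[OF X(1), of z y] yz(3) by (simp add: mv.add_right inner_add_left)
    then show ?thesis using pos[OF yz(1)] by (cases "y = 0") auto
  qed
  then show "X \<in> PSD" using X(1) by (simp add: PSD_def)
  have "R \<subseteq> null_space X" using XR by (auto simp: null_space_def)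
  then have "rank S \<le> dim (null_space X)" using R(2) dim_subset by metis
  moreover have "V \<inter> null_space X \<subseteq> {0}" using pos by (force simp: null_space_def)
  then have "V \<inter> null_space X = {0}" using V subspace_null_space[of X] by (auto simp: subspace_0)
  then have "dim V + dim (null_space X) \<le> CARD('n)"
    using dim_sums_Int[OF V subspace_null_space[of X]] dim_subset_UNIV[of "{x + y |x y. x \<in> V \<and> y \<in> null_space X}"] by simp
  ultimately show "rank X = dim V"
    using rank_plus_dim_null_space[of X] dd(2) by linarith
qed

lemma null_space_projection:
  assumes A: "A \<in> (Sym :: (real^'n^'n) set)"
  obtains P where "P \<in> PSD" "P ** P = P" "A ** P = 0" "P ** A = 0" "\<And>x. x \<in> null_space A \<Longrightarrow> P *v x = x"
    "rank P = dim (null_space A)"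
proof -
  obtain \<pi> where \<pi>: "linear \<pi>" "\<And>x. \<pi> x \<in> null_space A" "\<And>x y. y \<in> null_space A \<Longrightarrow> y \<bullet> \<pi> x = y \<bullet> x" "\<And>x. x \<in> null_space A \<Longrightarrow> \<pi> x = x"
    by (rule subspace_projection[OF subspace_null_space[of A]]) blast
  define P where "P = matrix \<pi>"
  have P: "P *v x = \<pi> x" for x unfolding P_def by (rule matrix_works) (use \<pi>(1) in \<open>simp add: linear_matrix_vector_mul_eq\<close>)
  have ip: "x \<bullet> \<pi> y = \<pi> x \<bullet> \<pi> y" for x y
    using \<pi>(3)[OF \<pi>(2)[of y], of x] by (simp add: inner_commute)
  have "x \<bullet> (transpose P *v y) = x \<bullet> (P *v y)" for x y
    using inner_matrix_vector[of P x y] ip[of x y] ip[of y x] by (simp add: P inner_commute del: transpose_matrix_vector)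
  then have "transpose P *v y = P *v y" for y using vector_eq_ldot[of "transpose P *v y" "P *v y"] by blast
  then have tP: "transpose P = P" by (simp add: matrix_eq del: transpose_matrix_vector)
  have "0 \<le> x \<bullet> (P *v x)" for x by (simp add: P ip[of x x])
  then have PP: "P \<in> PSD" using tP by (simp add: PSD_def Sym_iff)
  have "(P ** P) *v x = P *v x" for x
    by (simp only: P \<pi>(4)[OF \<pi>(2)] matrix_vector_mul_assoc[symmetric])
  then have P2: "P ** P = P" unfolding matrix_eq by blast
  have "(A ** P) *v x = 0 *v x" for x
    using \<pi>(2)[of x] by (simp add: P null_space_def matrix_vector_mul_assoc[symmetric])
  then have AP: "A ** P = 0" unfolding matrix_eq by blast
  have "transpose (A ** P) = P ** A" using tP A by (simp only: matrix_transpose_mul Sym_iff)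
  then have PA: "P ** A = 0" using AP linear_0[OF linear_transpose] by metis
  have "range ((*v) P) = null_space A"
  proof
    show "range ((*v) P) \<subseteq> null_space A" using \<pi>(2) by (auto simp: P)
    show "null_space A \<subseteq> range ((*v) P)"
    proof
      fix x assume "x \<in> null_space A"
      then have "x = P *v x" using \<pi>(4)[of x] by (simp only: P)
      then show "x \<in> range ((*v) P)" by (rule range_eqI)
    qed
  qed
  then have "rank P = dim (null_space A)" by (simp add: rank_dim_range)
  with that[OF PP P2 AP PA] \<pi>(4) show ?thesis by (simp add: P)
qed

context transversal_subspace
begin

text \<open>Two applications of \<open>perturbed_linear_zero\<close>. The first deforms the projection \<open>Q\<close> onto the range of \<open>A\<close> into a
matrix \<open>H\<close> with \<open>S ** H = 0\<close>; here the bound on the rank of \<open>S\<close> matters: it makes \<open>P\<close> injective on the range of \<open>S\<close>,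
so that \<open>P ** S ** H = 0\<close> suffices. The second finds a symmetric perturbation of \<open>A\<close>, supported on the range of \<open>A\<close>, whose congruence
by \<open>H\<close> lies in \<open>L\<close>. This matrix is killed by \<open>S\<close> and is close to \<open>A\<close>.\<close>

lemma nearby_kernels_are_hit:
  assumes A: "A \<in> PSD \<inter> L" and inj: "\<And>N. N \<in> W \<Longrightarrow> A ** N ** A = 0 \<Longrightarrow> N = 0"
    and P: "P \<in> PSD" "P ** P = P" "A ** P = 0" "P ** A = 0" "\<And>x. x \<in> null_space A \<Longrightarrow> P *v x = x"
  shows "\<forall>\<^sub>F S in nhds P. S \<in> PSD_rank_le (dim (null_space A)) \<longrightarrow>
    (\<exists>X\<in>PSD \<inter> L. rank X = rank A \<and> X ** S = 0)"
proof -
  have AL: "A \<in> L" and AP: "A \<in> PSD" using A by auto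
  have AS: "A \<in> Sym" using AP by (simp add: PSD_imp)
  have tA: "transpose A = A" using L_Sym AL by simp
  have tP: "transpose P = P" using P(1) by (simp add: PSD_imp Sym_iff[symmetric])
  define Q where "Q = mat 1 - P"
  have tQ: "transpose Q = Q" by (simp add: Q_def transpose_diff tP Finite_Cartesian_Product.transpose_mat)
  have QA: "Q ** A = A" "A ** Q = A" by (simp_all add: Q_def mm.diff_left mm.diff_right P)
  define V where "V = range ((*v) A)"
  have V: "subspace V" "dim V = rank A" unfolding V_def
    by (simp_all add: linear_subspace_image subspace_UNIV rank_dim_range)
  obtain \<alpha> where \<alpha>: "0 < \<alpha>" "\<And>x. x \<in> V \<Longrightarrow> \<alpha> * (x \<bullet> x) \<le> x \<bullet> (A *v x)"
  proof (rule form_coercive_on_subspace[OF V(1)])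
    show "0 < x \<bullet> (A *v x)" if "x \<in> V" "x \<noteq> 0" for x
      using PSD_pos_on_range[OF AP, of x] that by (simp add: V_def)
  qed (rule that)
  obtain \<pi> where \<pi>: "linear \<pi>" "\<And>x. \<pi> x \<in> W" "\<And>x y. y \<in> W \<Longrightarrow> y \<bullet> \<pi> x = y \<bullet> x"
    by (rule subspace_projection[OF subspace_sym_perp[of L]]) blast
  note lin = linear_add[OF \<pi>(1)] linear_scale[OF \<pi>(1)]
  have bl: "bounded_linear \<pi>" using \<pi>(1) by (simp add: linear_conv_bounded_linear)
  \<comment> \<open>Two factors \<open>A\<close> on each side, so that \<open>v \<bullet> D v\<close> is the squared norm of \<open>A ** v ** A\<close>.\<close>
  define D where "D v = A ** A ** v ** A ** A" for v
  define Y where "Y H v = H ** (A + D v) ** transpose H" for H v :: "real^'n^'n"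
  have contY: "continuous_on UNIV (\<lambda>z. Y (fst z) (snd z))"
    unfolding Y_def D_def by (intro continuous_intros mm.continuous_on)
  have YQ: "Y Q v = A + D v" for v
    by (simp add: Y_def tQ D_def mm.add_left mm.add_right QA matrix_mul_assoc)
       (simp add: QA flip: matrix_mul_assoc)
  have linD: "linear D" unfolding D_def
    by (rule linearI) (simp_all add: mm.add_left mm.add_right mm.scaleR_left mm.scaleR_right)
  have YS: "Y H v \<in> Sym" if "v \<in> W" for H v
  proof -
    have "D v \<in> Sym" using W_Sym[OF that]
      by (simp add: D_def Sym_iff matrix_transpose_mul tA matrix_mul_assoc)
    then show ?thesis unfolding Y_def
      by (intro Sym_congr' subspace_add[OF subspace_Sym] AS)
  qed
  \<comment> \<open>The distance from \<open>A\<close> must stay below the coercivity constant of \<open>A\<close> on its range.\<close>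
  have "isCont (\<lambda>z. Y (fst z) (snd z)) (Q, 0)"
    using contY by (simp add: continuous_on_eq_continuous_at)
  then obtain \<delta> where \<delta>: "0 < \<delta>"
    "\<And>z. dist z (Q, 0) < \<delta> \<Longrightarrow> dist (Y (fst z) (snd z)) (Y Q 0) < \<alpha>"
    unfolding continuous_at_eps_delta using \<alpha>(1) by fastforce
  have YQ0: "Y Q 0 = A" unfolding YQ using linear_0[OF linD] by simp
  have close: "norm (Y H v - A) < \<alpha>" if "norm (H - Q) < \<delta> / 2" "norm v \<le> \<delta> / 3" for H v
  proof -
    have "norm (H - Q, v) \<le> norm (H - Q) + norm v" by (rule norm_Pair_le)
    also have "\<dots> < \<delta>" using that \<delta>(1) by linarith
    finally have "dist (H, v) (Q, 0) < \<delta>" by (simp add: dist_norm)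
    from \<delta>(2)[OF this] show ?thesis by (simp add: YQ0 dist_norm)
  qed
  have solve: "\<forall>\<^sub>F H in nhds Q. \<exists>v\<in>W. norm v \<le> \<delta> / 3 \<and> \<pi> (Y H v) = 0"
  proof (rule perturbed_linear_zero[OF subspace_sym_perp])
    show "continuous_on UNIV (\<lambda>z. \<pi> (Y (fst z) (snd z)))"
      by (rule bounded_linear.continuous_on[OF bl contY])
    show "\<pi> (Y p v) \<in> W" for p v by (rule \<pi>(2))
    show "linear (\<lambda>v. \<pi> (D v))" using linear_compose[OF linD \<pi>(1)] by (simp add: o_def)
    show "\<pi> (Y Q v) = \<pi> (D v)" for v
    proof -
      have "\<pi> A = 0" using projection_zero_iff[OF \<pi>(2,3) AS] AL by blast
      then show ?thesis unfolding YQ lin by simp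
    qed
    show "v = 0" if v: "v \<in> W" "\<pi> (D v) = 0" for v
    proof -
      have "v \<bullet> D v = 0" using \<pi>(3)[OF v(1), of "D v"] v(2) by simp
      moreover have "(A ** v ** A) \<bullet> (A ** v ** A) = v \<bullet> D v"
        using inner_sandwich[of A v A "A ** v ** A"] by (simp add: D_def tA matrix_mul_assoc)
      ultimately have "A ** v ** A = 0" by simp
      then show ?thesis by (rule inj[OF v(1)])
    qed
    show "0 < \<delta> / 3" using \<delta>(1) by simp
  qed
  then obtain \<eta> where \<eta>: "0 < \<eta>" "\<And>H. dist H Q < \<eta> \<Longrightarrow> \<exists>v\<in>W. norm v \<le> \<delta> / 3 \<and> \<pi> (Y H v) = 0"
    unfolding eventually_nhds_metric by blast
  define e where "e = min (\<delta> / 3) (\<eta> / 2)"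
  have e: "0 < e" using \<delta>(1) \<eta>(1) by (simp add: e_def)
  have linP: "linear (\<lambda>C :: real^'n^'n. P ** C)"
    by (rule linearI) (simp_all add: mm.add_right mm.scaleR_right)
  have "\<forall>\<^sub>F S in nhds P. \<exists>C\<in>{C :: real^'n^'n. P ** C = C}. norm C \<le> e \<and> P ** S ** (Q - C) = 0"
  proof (rule perturbed_linear_zero[where B = uminus])
    show "subspace {C :: real^'n^'n. P ** C = C}"
      unfolding subspace_def by (auto simp: mm.add_right mm.scaleR_right)
    show "continuous_on UNIV (\<lambda>z. P ** fst z ** (Q - snd z))"
      by (intro continuous_intros mm.continuous_on)
    show "P ** S ** (Q - C) \<in> {C :: real^'n^'n. P ** C = C}" for S C
      by (simp add: matrix_mul_assoc P(2))
    show "linear (uminus :: real^'n^'n \<Rightarrow> _)" by (rule linear_uminus)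
    show "P ** P ** (Q - C) = - C" if "C \<in> {C :: real^'n^'n. P ** C = C}" for C
      using that by (simp add: P(2) mm.diff_right Q_def)
    show "0 < e" by (rule e)
  qed simp
  moreover have "\<forall>\<^sub>F S in nhds P. norm (S - P) < 1"
    unfolding eventually_nhds_metric by (intro exI[of _ 1]) (simp add: dist_norm)
  ultimately show ?thesis
  proof eventually_elim
    case (elim S)
    show ?case
    proof
      assume S: "S \<in> PSD_rank_le (dim (null_space A))"
      then have SP: "S \<in> PSD" "rank S \<le> dim (null_space A)" by (auto simp: PSD_rank_le_def)
      have SS: "S \<in> Sym" using SP by (simp add: PSD_imp)
      have Spos: "0 < x \<bullet> (S *v x)" if x: "x \<in> null_space A" "x \<noteq> 0" for x
      proof -
        have "x \<bullet> (S *v x) = x \<bullet> x + x \<bullet> ((S - P) *v x)"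
          using P(5)[OF x(1)] by (simp add: mv.diff_left inner_diff_right)
        moreover have "\<bar>x \<bullet> ((S - P) *v x)\<bar> \<le> norm (S - P) * (x \<bullet> x)" by (rule abs_form_le_norm)
        moreover have "norm (S - P) * (x \<bullet> x) < x \<bullet> x" using elim(2) x(2) by simp
        ultimately show ?thesis by linarith
      qed
      have "dim ((*v) S ` null_space A) = dim (null_space A)"
      proof (rule dim_image_eq)
        show "linear ((*v) S)" by simp
        have "inj_on ((*v) S) (null_space A)"
          using linear_injective_on_subspace_0[of "(*v) S" "null_space A"] Spos subspace_null_space[of A] by force
        then show "inj_on ((*v) S) (span (null_space A))" by (simp only: span_eq_iff[THEN iffD2, OF subspace_null_space])
      qed
      then have dS: "(*v) S ` null_space A = range ((*v) S)" and rS: "dim (null_space A) \<le> rank S"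
        using SP(2) subspace_dim_equal[of "(*v) S ` null_space A" "range ((*v) S)"]
          dim_subset[of "(*v) S ` null_space A" "range ((*v) S)"]
        by (simp_all add: rank_dim_range linear_subspace_image subspace_null_space subspace_UNIV image_mono)
      obtain C where C: "P ** C = C" "norm C \<le> e" "P ** S ** (Q - C) = 0" using elim(1) by blast
      define H where "H = Q - C"
      have "S *v (H *v y) = 0" for y
      proof -
        \<comment> \<open>The range of \<open>S\<close> is the image of the null space of \<open>A\<close>, on which \<open>S\<close> is positive definite.\<close>
        obtain w where w: "w \<in> null_space A" "S *v (H *v y) = S *v w" using dS by blast
        have "P *v (S *v w) = (P ** S ** H) *v y" by (simp add: w(2)[symmetric] matrix_vector_mul_assoc matrix_mul_assoc)
        then have 0: "P *v (S *v w) = 0" using C(3) by (simp add: H_def)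
        have "w \<bullet> (S *v w) = (P *v w) \<bullet> (S *v w)" using P(5)[OF w(1)] by simp
        also have "\<dots> = w \<bullet> (P *v (S *v w))" by (rule Sym_inner) (use P(1) in \<open>simp add: PSD_imp\<close>)
        also have "\<dots> = 0" using 0 by simp
        finally have "w = 0" using Spos[OF w(1)] by force
        then show ?thesis using w(2) by simp
      qed
      then have "(S ** H) *v y = 0 *v y" for y by (simp flip: matrix_vector_mul_assoc)
      then have SH: "S ** H = 0" unfolding matrix_eq by blast
      have nH: "norm (H - Q) \<le> e" using C(2) by (simp add: H_def)
      have "dist H Q < \<eta>" using nH \<eta>(1) by (simp add: dist_norm e_def)
      then obtain v where v: "v \<in> W" "norm v \<le> \<delta> / 3" "\<pi> (Y H v) = 0" using \<eta>(2) by blast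
      define X where "X = Y H v"
      have XS: "X \<in> Sym" unfolding X_def by (rule YS[OF v(1)])
      have XL: "X \<in> L" using projection_zero_iff[OF \<pi>(2,3) XS] v(3) by (simp add: X_def)
      have "transpose H ** S = transpose (S ** H)" using SS by (simp add: matrix_transpose_mul Sym_iff)
      then have "transpose H ** S = 0" by (simp add: SH linear_0[OF linear_transpose])
      moreover have "X ** S = H ** (A + D v) ** (transpose H ** S)"
        by (simp only: X_def Y_def matrix_mul_assoc)
      ultimately have XS0: "X ** S = 0" by simp
      have nX: "norm (X - A) < \<alpha>" unfolding X_def
        using nH \<delta>(1) by (intro close v(2)) (simp add: e_def)
      have Xpos: "0 < x \<bullet> (X *v x)" if x: "x \<in> V" "x \<noteq> 0" for x
      proof -
        have "x \<bullet> (X *v x) = x \<bullet> (A *v x) + x \<bullet> ((X - A) *v x)"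
          by (simp add: mv.diff_left inner_diff_right)
        moreover have "\<bar>x \<bullet> ((X - A) *v x)\<bar> \<le> norm (X - A) * (x \<bullet> x)" by (rule abs_form_le_norm)
        moreover have "norm (X - A) * (x \<bullet> x) < \<alpha> * (x \<bullet> x)" using nX x(2) by simp
        ultimately show ?thesis using \<alpha>(2)[OF x(1)] by linarith
      qed
      have "CARD('n) \<le> dim V + rank S" using rS rank_plus_dim_null_space[of A] V(2) by linarith
      from PSD_of_complementary_kernel[OF XS XS0 V(1) Xpos this]
      show "\<exists>X\<in>PSD \<inter> L. rank X = rank A \<and> X ** S = 0"
        using XL XS0 V(2) by (intro bexI[of _ X]) simp_all
    qed
  qed
qed

theorem open_set_of_kernels:
  assumes r: "r = CARD('n) - d" "d < CARD('n)" and c: "dim W < (r + 1) choose 2"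
    and PD: "L \<inter> PD \<noteq> {}"
  shows "\<exists>U. U \<noteq> {} \<and> openin (top_of_set (PSD_rank_le d)) U \<and>
        (\<forall>S\<in>U. \<exists>\<Omega>\<in>PSD \<inter> L. rank \<Omega> = CARD('n) - d \<and> \<Omega> ** S = 0)"
proof -
  have r0: "0 < r" "r \<le> CARD('n)" using r by auto
  obtain M where M: "M \<in> L" "M \<in> PD" using PD by blast
  have "M \<in> PSD" using M(2) unfolding PSD_def PD_def
    by (auto, metis inner_zero_left less_eq_real_def)
  moreover have "M \<noteq> 0"
  proof
    assume "M = 0"
    obtain i :: 'n where True by blast
    have "axis i (1::real) \<noteq> (0 :: real^'n)" by (simp add: axis_eq_0_iff)
    then show False using M(2) \<open>M = 0\<close> by (auto simp: PD_def)
  qed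
  ultimately obtain A1 where A1: "A1 \<in> PSD \<inter> L" "A1 \<noteq> 0" "rank A1 \<le> r"
    using exists_low_rank_PSD[OF sub LSym c, of M] M(1) by blast
  obtain A0 where A0: "A0 \<in> PSD \<inter> L" "rank A0 = r"
    using exists_rank_eq[OF A1 r0(2)] by blast
  obtain A where A: "A \<in> PSD \<inter> L" "rank A = r" "\<And>N. N \<in> W \<Longrightarrow> A ** N ** A = 0 \<Longrightarrow> N = 0"
    by (rule exists_face_transversal_point[OF r0(1) c A0]) (rule that)
  have "A \<in> Sym" using A(1) by (simp add: PSD_imp)
  then obtain P where P: "P \<in> PSD" "P ** P = P" "A ** P = 0" "P ** A = 0" "\<And>x. x \<in> null_space A \<Longrightarrow> P *v x = x"
    "rank P = dim (null_space A)" by (rule null_space_projection) blast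
  have dn: "dim (null_space A) = d" using rank_plus_dim_null_space[of A] A(2) r by linarith
  obtain T where T: "open T" "P \<in> T" "\<And>S. S \<in> T \<Longrightarrow> S \<in> PSD_rank_le d \<Longrightarrow>
    (\<exists>X\<in>PSD \<inter> L. rank X = rank A \<and> X ** S = 0)"
    using nearby_kernels_are_hit[OF A(1,3) P(1-5)] unfolding eventually_nhds dn by blast
  show ?thesis
  proof (intro exI conjI ballI)
    show "PSD_rank_le d \<inter> T \<noteq> {}" using P T(2) dn by (auto simp: PSD_rank_le_def)
    show "openin (top_of_set (PSD_rank_le d)) (PSD_rank_le d \<inter> T)" using T(1) by (simp add: openin_open_Int)
    show "\<exists>\<Omega>\<in>PSD \<inter> L. rank \<Omega> = CARD('n) - d \<and> \<Omega> ** S = 0" if "S \<in> PSD_rank_le d \<inter> T" for S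
      using T(3)[of S] that A(2) r by auto
  qed
qed

end

section \<open>Orthogonal pairs of symmetric matrices and a chart of the Grassmannian\<close>

lemma matrix_eqI: "(\<And>i j. X $ i $ j = Y $ i $ j) \<Longrightarrow> X = Y"
  by (simp add: vec_eq_iff)

lemma Sym_entry: assumes "X \<in> Sym" shows "X $ i $ j = X $ j $ i"
proof -
  have "transpose X $ i $ j = X $ j $ i" by (simp add: transpose_def)
  then show ?thesis using assms by (simp add: Sym_iff)
qed

text \<open>A maximal independent subfamily; independence is stated for the indexed family, so repeated vectors are harmless.\<close>

lemma row_basis:
  fixes v :: "'n::finite \<Rightarrow> 'v::real_vector"
  obtains R C where "\<And>i. i \<notin> R \<Longrightarrow> v i = (\<Sum>j\<in>R. C i j *\<^sub>R v j)"
    "\<And>a. (\<Sum>j\<in>R. a j *\<^sub>R v j) = 0 \<Longrightarrow> \<forall>j\<in>R. a j = (0::real)"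
proof -
  define ind where "ind R \<longleftrightarrow> (\<forall>a. (\<Sum>j\<in>R. a j *\<^sub>R v j) = 0 \<longrightarrow> (\<forall>j\<in>R. a j = (0::real)))" for R
  have "finite {R. ind R}" by simp
  moreover have "ind {}" by (simp add: ind_def)
  ultimately obtain R where R: "ind R" "\<And>R'. ind R' \<Longrightarrow> R \<subseteq> R' \<Longrightarrow> R' = R"
    using finite_has_maximal[of "{R. ind R}"] by auto
  have "\<exists>c. v i = (\<Sum>j\<in>R. c j *\<^sub>R v j)" if i: "i \<notin> R" for i
  proof -
    have "\<not> ind (insert i R)" using R(2)[of "insert i R"] i by auto
    then obtain a j where a: "(\<Sum>j\<in>insert i R. a j *\<^sub>R v j) = 0" "j \<in> insert i R" "a j \<noteq> 0"
      by (auto simp: ind_def)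
    have s: "a i *\<^sub>R v i + (\<Sum>j\<in>R. a j *\<^sub>R v j) = 0" using a(1) i by simp
    have ai: "a i \<noteq> 0"
    proof
      assume "a i = 0"
      then have "(\<Sum>j\<in>R. a j *\<^sub>R v j) = 0" using s by simp
      then have "\<forall>j\<in>R. a j = 0" using R(1) by (simp add: ind_def)
      then show False using a(2,3) \<open>a i = 0\<close> by auto
    qed
    have "a i *\<^sub>R v i = - (\<Sum>j\<in>R. a j *\<^sub>R v j)" using s by (simp add: eq_neg_iff_add_eq_0)
    then have "inverse (a i) *\<^sub>R (a i *\<^sub>R v i) = inverse (a i) *\<^sub>R (- (\<Sum>j\<in>R. a j *\<^sub>R v j))" by simp
    then have "v i = (\<Sum>j\<in>R. (- inverse (a i) * a j) *\<^sub>R v j)"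
      using ai by (simp add: scaleR_sum_right sum_negf)
    then show ?thesis by (intro exI[of _ "\<lambda>j. - inverse (a i) * a j"])
  qed
  then have "\<exists>C. \<forall>i. i \<notin> R \<longrightarrow> v i = (\<Sum>j\<in>R. C i j *\<^sub>R v j)" by (intro choice) auto
  then show ?thesis using that R(1) by (auto simp: ind_def)
qed

definition upper_positions :: "('n::linorder \<times> 'n) set" where
  "upper_positions = {(i, j). i \<le> j}"

definition entry :: "real^'n^'n \<Rightarrow> 'n \<times> 'n \<Rightarrow> real" where
  "entry X p = X $ fst p $ snd p"

text \<open>Symmetric matrices are parametrised by their entries at the positions \<open>(i, j)\<close> with \<open>i \<le> j\<close>.\<close>

definition sym_lookup :: "('n::linorder \<times> 'n \<Rightarrow> real) \<Rightarrow> 'n \<Rightarrow> 'n \<Rightarrow> real" where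
  "sym_lookup y i j = y (min i j, max i j)"

text \<open>A symmetric matrix whose rows in \<open>R\<close> form a basis of its row space is \<open>Y ** Q ** transpose Y\<close>, where \<open>Q\<close> is its block on
\<open>R\<close> and \<open>Y\<close> is the identity on \<open>R\<close>. The matrix \<open>Y\<close> is the image frame. The columns of the kernel frame \<open>Z\<close> span
the orthogonal complement of those of \<open>Y\<close>, so every \<open>N\<close> with product zero is \<open>Z ** Q' ** transpose Z\<close>. The parameters of \<open>Q\<close>, of \<open>Q'\<close>
and of the common free block of \<open>Y\<close> and \<open>Z\<close> occupy the positions in \<open>R \<times> R\<close>, in the
product of the complement with itself, and the mixed ones. Together they form one symmetric matrix \<open>y\<close>.\<close>

definition image_frame :: "'n::linorder set \<Rightarrow> ('n \<times> 'n \<Rightarrow> real) \<Rightarrow> 'n \<Rightarrow> 'n \<Rightarrow> real" where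
  "image_frame R y a i = (if a \<in> R then (if a = i then 1 else 0) else sym_lookup y a i)"

definition kernel_frame :: "'n::linorder set \<Rightarrow> ('n \<times> 'n \<Rightarrow> real) \<Rightarrow> 'n \<Rightarrow> 'n \<Rightarrow> real" where
  "kernel_frame R y a i = (if a \<notin> R then (if a = i then 1 else 0) else - sym_lookup y i a)"

definition conormal_fst :: "'n::linorder set \<Rightarrow> ('n \<times> 'n \<Rightarrow> real) \<Rightarrow> 'n \<Rightarrow> 'n \<Rightarrow> real" where
  "conormal_fst R y a b = (\<Sum>i\<in>R. \<Sum>j\<in>R. image_frame R y a i * sym_lookup y i j * image_frame R y b j)"

definition conormal_snd :: "'n::linorder set \<Rightarrow> ('n \<times> 'n \<Rightarrow> real) \<Rightarrow> 'n \<Rightarrow> 'n \<Rightarrow> real" where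
  "conormal_snd R y a b = (\<Sum>i\<in>-R. \<Sum>j\<in>-R. kernel_frame R y a i * sym_lookup y i j * kernel_frame R y b j)"

text \<open>The rows of \<open>\<Omega>\<close> outside \<open>R\<close> are combinations of those in \<open>R\<close>. Substituting this into \<open>\<Omega> ** N = 0\<close> and using the independence of the rows in \<open>R\<close> expresses the rows of \<open>N\<close> in \<open>R\<close> by the others.\<close>

lemma conormal_pair_param:
  fixes \<Omega> N :: "real^'n::{finite,linorder}^'n::{finite,linorder}"
  assumes S: "\<Omega> \<in> Sym" "N \<in> Sym" and z: "\<Omega> ** N = 0"
  obtains R y where "\<And>a b. \<Omega> $ a $ b = conormal_fst R y a b" "\<And>a b. N $ a $ b = conormal_snd R y a b"
proof -
  obtain R C where C: "\<And>i. i \<notin> R \<Longrightarrow> \<Omega> $ i = (\<Sum>j\<in>R. C i j *\<^sub>R \<Omega> $ j)"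
    and ind: "\<And>a. (\<Sum>j\<in>R. a j *\<^sub>R \<Omega> $ j) = 0 \<Longrightarrow> \<forall>j\<in>R. a j = (0::real)"
    using row_basis[of "\<lambda>i. \<Omega> $ i"] by blast
  have sO: "\<Omega> $ a $ b = \<Omega> $ b $ a" for a b
    by (rule Sym_entry[OF S(1)])
  have sN: "N $ a $ b = N $ b $ a" for a b
    by (rule Sym_entry[OF S(2)])
  define y where "y p = (if fst p \<in> R then (if snd p \<in> R then \<Omega> $ fst p $ snd p else C (snd p) (fst p))
      else (if snd p \<in> R then C (fst p) (snd p) else N $ fst p $ snd p))" for p
  have y1: "sym_lookup y i j = \<Omega> $ i $ j" if "i \<in> R" "j \<in> R" for i j
    using that sO[of i j] by (auto simp: sym_lookup_def y_def min_def max_def)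
  have y2: "sym_lookup y i j = N $ i $ j" if "i \<notin> R" "j \<notin> R" for i j
    using that sN[of i j] by (auto simp: sym_lookup_def y_def min_def max_def)
  have y3: "sym_lookup y a i = C a i" if "a \<notin> R" "i \<in> R" for a i
    using that by (auto simp: sym_lookup_def y_def min_def max_def)
  have y4: "sym_lookup y i a = C a i" if "a \<notin> R" "i \<in> R" for a i
    using that by (auto simp: sym_lookup_def y_def min_def max_def)
  have rowO: "\<Omega> $ a $ b = (\<Sum>i\<in>R. image_frame R y a i * \<Omega> $ i $ b)" for a b
  proof (cases "a \<in> R")
    case True
    then have "(\<Sum>i\<in>R. image_frame R y a i * \<Omega> $ i $ b) = (\<Sum>i\<in>R. if i = a then \<Omega> $ a $ b else 0)"
      by (intro sum.cong) (auto simp: image_frame_def)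
    then show ?thesis using True by simp
  next
    case False
    then have "(\<Sum>i\<in>R. image_frame R y a i * \<Omega> $ i $ b) = (\<Sum>i\<in>R. C a i * \<Omega> $ i $ b)"
      by (intro sum.cong) (auto simp: image_frame_def y3)
    also have "\<dots> = \<Omega> $ a $ b" using arg_cong[OF C[OF False], of "\<lambda>v. v $ b"] by simp
    finally show ?thesis by simp
  qed
  \<comment> \<open>The coefficients \<open>e j\<close> of the relation among the independent rows must vanish.\<close>
  have rowN0: "N $ a $ b = - (\<Sum>i\<in>-R. C i a * N $ i $ b)" if a: "a \<in> R" for a b
  proof -
    define e where "e j = N $ j $ b + (\<Sum>i\<in>-R. C i j * N $ i $ b)" for j
    have "(\<Sum>j\<in>R. e j * \<Omega> $ j $ k) = 0" for k
    proof -
      have "0 = (\<Omega> ** N) $ k $ b" using z by simp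
      also have "\<dots> = (\<Sum>i\<in>UNIV. \<Omega> $ i $ k * N $ i $ b)"
        by (simp add: matrix_matrix_mult_def sO[of k])
      also have "\<dots> = (\<Sum>i\<in>R. \<Omega> $ i $ k * N $ i $ b) + (\<Sum>i\<in>-R. \<Omega> $ i $ k * N $ i $ b)"
        by (subst sum.union_disjoint[symmetric]) auto
      also have "(\<Sum>i\<in>-R. \<Omega> $ i $ k * N $ i $ b) = (\<Sum>i\<in>-R. \<Sum>j\<in>R. C i j * \<Omega> $ j $ k * N $ i $ b)"
        by (rule sum.cong[OF refl]) (simp add: C sum_distrib_right)
      also have "\<dots> = (\<Sum>j\<in>R. \<Sum>i\<in>-R. C i j * \<Omega> $ j $ k * N $ i $ b)" by (rule sum.swap)
      also have "(\<Sum>i\<in>R. \<Omega> $ i $ k * N $ i $ b) + \<dots> = (\<Sum>j\<in>R. e j * \<Omega> $ j $ k)"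
        by (simp add: e_def distrib_left sum.distrib sum_distrib_left mult_ac)
      finally show ?thesis by simp
    qed
    then have "(\<Sum>j\<in>R. e j *\<^sub>R \<Omega> $ j) = 0" by (simp add: vec_eq_iff)
    then have "e a = 0" using ind[of e] a by blast
    then show ?thesis by (simp add: e_def eq_neg_iff_add_eq_0)
  qed
  have rowN: "N $ a $ b = (\<Sum>i\<in>-R. kernel_frame R y a i * N $ i $ b)" for a b
  proof (cases "a \<in> R")
    case True
    then have "(\<Sum>i\<in>-R. kernel_frame R y a i * N $ i $ b) = (\<Sum>i\<in>-R. - (C i a * N $ i $ b))"
      by (intro sum.cong) (auto simp: kernel_frame_def y3)
    then show ?thesis using rowN0[OF True] by (simp add: sum_negf)
  next
    case False
    then have "(\<Sum>i\<in>-R. kernel_frame R y a i * N $ i $ b) = (\<Sum>i\<in>-R. if i = a then N $ a $ b else 0)"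
      by (intro sum.cong) (auto simp: kernel_frame_def)
    then show ?thesis using False by simp
  qed
  show ?thesis
  proof (rule that)
    fix a b
    have "\<Omega> $ i $ b = (\<Sum>j\<in>R. image_frame R y b j * \<Omega> $ i $ j)" for i
      unfolding sO[of i b] sO[of i] by (rule rowO)
    then have "\<Omega> $ a $ b = (\<Sum>i\<in>R. image_frame R y a i * (\<Sum>j\<in>R. image_frame R y b j * \<Omega> $ i $ j))"
      by (subst rowO) simp
    also have "\<dots> = conormal_fst R y a b"
      unfolding conormal_fst_def sum_distrib_left by (intro sum.cong refl) (simp add: y1)
    finally show "\<Omega> $ a $ b = conormal_fst R y a b" .
    have "N $ i $ b = (\<Sum>j\<in>-R. kernel_frame R y b j * N $ i $ j)" for i
      unfolding sN[of i b] sN[of i] by (rule rowN)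
    then have "N $ a $ b = (\<Sum>i\<in>-R. kernel_frame R y a i * (\<Sum>j\<in>-R. kernel_frame R y b j * N $ i $ j))"
      by (subst rowN) simp
    also have "\<dots> = conormal_snd R y a b"
      unfolding conormal_snd_def sum_distrib_left by (intro sum.cong refl) (simp add: y2)
    finally show "N $ a $ b = conormal_snd R y a b" .
  qed
qed

text \<open>Scaling the two matrices makes one parameter in each diagonal block equal to one. This saves the two parameters that the dimension count needs.\<close>

lemma conormal_pair_param_normalised:
  fixes \<Omega> N :: "real^'n::{finite,linorder}^'n::{finite,linorder}"
  assumes S: "\<Omega> \<in> Sym" "N \<in> Sym" and z: "\<Omega> ** N = 0" and nz: "\<Omega> \<noteq> 0" "N \<noteq> 0"
  obtains R y a b q r where "a \<in> upper_positions \<inter> R \<times> R" "b \<in> upper_positions \<inter> (-R) \<times> (-R)" "y a = 1" "y b = 1"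
    "q \<noteq> 0" "r \<noteq> 0" "\<And>i j. \<Omega> $ i $ j = q * conormal_fst R y i j" "\<And>i j. N $ i $ j = r * conormal_snd R y i j"
proof -
  obtain R y where Ry: "\<And>a b. \<Omega> $ a $ b = conormal_fst R y a b" "\<And>a b. N $ a $ b = conormal_snd R y a b"
    using conormal_pair_param[OF S z] by blast
  have "\<exists>i\<in>R. \<exists>j\<in>R. sym_lookup y i j \<noteq> 0"
  proof (rule ccontr)
    assume "\<not> ?thesis"
    then have "\<Omega> = 0" by (intro matrix_eqI) (simp add: Ry conormal_fst_def)
    then show False using nz by simp
  qed
  then obtain i j where ij: "i \<in> R" "j \<in> R" "sym_lookup y i j \<noteq> 0" by blast
  have "\<exists>i\<in>-R. \<exists>j\<in>-R. sym_lookup y i j \<noteq> 0"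
  proof (rule ccontr)
    assume "\<not> ?thesis"
    then have "N = 0" by (intro matrix_eqI) (simp add: Ry conormal_snd_def)
    then show False using nz by simp
  qed
  then obtain k l where kl: "k \<in> -R" "l \<in> -R" "sym_lookup y k l \<noteq> 0" by blast
  define a where "a = (min i j, max i j)"
  define b where "b = (min k l, max k l)"
  define y' where "y' p = (if p \<in> R \<times> R then y p / y a else if p \<in> (-R) \<times> (-R) then y p / y b else y p)" for p
  have a: "a \<in> upper_positions \<inter> R \<times> R" using ij by (auto simp: a_def upper_positions_def min_def max_def)
  have b: "b \<in> upper_positions \<inter> (-R) \<times> (-R)" using kl by (auto simp: b_def upper_positions_def min_def max_def)
  have ya: "y a \<noteq> 0" "y b \<noteq> 0" using ij kl by (simp_all add: sym_lookup_def a_def b_def)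
  have s1: "sym_lookup y' i j = sym_lookup y i j / y a" if "i \<in> R" "j \<in> R" for i j
    using that by (auto simp: sym_lookup_def y'_def min_def max_def)
  have s2: "sym_lookup y' i j = sym_lookup y i j / y b" if "i \<notin> R" "j \<notin> R" for i j
    using that by (auto simp: sym_lookup_def y'_def min_def max_def)
  have s3: "sym_lookup y' i j = sym_lookup y i j" if "i \<in> R \<longleftrightarrow> j \<notin> R" for i j
    using that by (auto simp: sym_lookup_def y'_def min_def max_def)
  have k1: "image_frame R y' c i = image_frame R y c i" if "i \<in> R" for c i
    using that s3 by (auto simp: image_frame_def)
  have k2: "kernel_frame R y' c i = kernel_frame R y c i" if "i \<notin> R" for c i
    using that s3 by (auto simp: kernel_frame_def)
  have f1: "conormal_fst R y i j = y a * conormal_fst R y' i j" for i j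
    using ya by (simp add: conormal_fst_def sum_distrib_left s1 k1)
  have f2: "conormal_snd R y i j = y b * conormal_snd R y' i j" for i j
    using ya by (simp add: conormal_snd_def sum_distrib_left s2 k2)
  show ?thesis
  proof (rule that[OF a b _ _ ya])
    show "y' a = 1" "y' b = 1" using a b ya by (auto simp: y'_def)
    show "\<Omega> $ i $ j = y a * conormal_fst R y' i j" for i j by (simp only: Ry f1)
    show "N $ i $ j = y b * conormal_snd R y' i j" for i j by (simp only: Ry f2)
  qed
qed

text \<open>The graph over the coordinates in \<open>I\<close>: for complementary sets \<open>I\<close> and \<open>J\<close> of positions these are the subspaces with nonzero Pluecker coordinate \<open>I\<close>.\<close>

definition chart_space :: "('n \<times> 'n) set \<Rightarrow> ('n \<times> 'n) set \<Rightarrow> (('n \<times> 'n) \<times> ('n \<times> 'n) \<Rightarrow> real)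
    \<Rightarrow> (real^'n^'n) set" where
  "chart_space I J A = {X \<in> Sym. \<forall>l\<in>J. entry X l = (\<Sum>p\<in>I. entry X p * A (p, l))}"

definition sym_matrix :: "('n \<times> 'n \<Rightarrow> real) \<Rightarrow> real^'n::{finite,linorder}^'n::{finite,linorder}" where
  "sym_matrix y = (\<chi> i j. sym_lookup y i j)"

text \<open>An off-diagonal position occurs twice in the trace inner product.\<close>

definition position_weight :: "'n \<times> 'n \<Rightarrow> real" where
  "position_weight p = (if fst p = snd p then 1 else 2)"

lemma sym_matrix_Sym: "sym_matrix y \<in> Sym"
  by (simp add: Sym_iff sym_matrix_def transpose_def vec_eq_iff sym_lookup_def min.commute max.commute)

lemma entry_sym_matrix: "p \<in> upper_positions \<Longrightarrow> entry (sym_matrix y) p = y p"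
  by (cases p) (simp add: entry_def sym_matrix_def sym_lookup_def upper_positions_def min_def max_def)

lemma Sym_eq_sym_matrix: "X \<in> Sym \<Longrightarrow> X = sym_matrix (entry X)"
  using Sym_entry[of X] by (intro matrix_eqI) (auto simp: sym_matrix_def sym_lookup_def entry_def min_def max_def)

lemma inner_Sym_entries:
  fixes X N :: "real^'n::{finite,linorder}^'n::{finite,linorder}"
  assumes "X \<in> Sym" "N \<in> Sym"
  shows "X \<bullet> N = (\<Sum>p\<in>upper_positions. position_weight p * entry X p * entry N p)"
proof -
  define g where "g p = entry X p * entry N p" for p
  define D where "D = {p :: 'n \<times> 'n. fst p = snd p}"
  define U where "U = {p :: 'n \<times> 'n. fst p < snd p}"
  define U' where "U' = {p :: 'n \<times> 'n. snd p < fst p}"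
  have "X \<bullet> N = (\<Sum>p\<in>UNIV. g p)"
    by (simp add: inner_matrix g_def entry_def sum.cartesian_product case_prod_unfold)
  also have "UNIV = D \<union> U \<union> U'" by (auto simp: D_def U_def U'_def)
  also have "(\<Sum>p\<in>D \<union> U \<union> U'. g p) = sum g D + sum g U + sum g U'"
    by (subst sum.union_disjoint, simp, simp, force simp: D_def U_def U'_def)
      (subst sum.union_disjoint, auto simp: D_def U_def U'_def)
  also have "sum g U' = sum g U"
    by (rule sum.reindex_bij_witness[of _ prod.swap prod.swap])
      (auto simp: U_def U'_def g_def entry_def Sym_entry[OF assms(1), of "fst _"] Sym_entry[OF assms(2), of "fst _"])
  also have "sum g D + sum g U + sum g U = (\<Sum>p\<in>D. position_weight p * g p) + (\<Sum>p\<in>U. position_weight p * g p)"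
  proof -
    have "(\<Sum>p\<in>D. position_weight p * g p) = sum g D" by (rule sum.cong) (auto simp: D_def position_weight_def)
    moreover have "(\<Sum>p\<in>U. position_weight p * g p) = (\<Sum>p\<in>U. 2 * g p)" by (rule sum.cong) (auto simp: U_def position_weight_def)
    ultimately show ?thesis by (simp flip: sum_distrib_left)
  qed
  also have "\<dots> = (\<Sum>p\<in>D \<union> U. position_weight p * g p)"
    by (subst sum.union_disjoint) (auto simp: D_def U_def)
  also have "D \<union> U = upper_positions" by (auto simp: D_def U_def upper_positions_def)
  finally show ?thesis by (simp add: g_def mult.assoc)
qed

text \<open>The matrix in the graph whose coordinates in \<open>I\<close> form the unit vector at \<open>p\<close>.\<close>

definition chart_vec :: "('n \<times> 'n) set \<Rightarrow> (('n \<times> 'n) \<times> ('n \<times> 'n) \<Rightarrow> real) \<Rightarrow> 'n \<times> 'n \<Rightarrow> real^'n::{finite,linorder}^'n::{finite,linorder}" where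
  "chart_vec I A p = sym_matrix (\<lambda>q. if q \<in> I then (if q = p then 1 else 0) else A (p, q))"

context
  fixes I J :: "('n::{finite,linorder} \<times> 'n) set"
  assumes IJ: "I \<union> J = upper_positions" "I \<inter> J = {}"
begin

lemma subspace_chart: "subspace (chart_space I J A)"
  unfolding chart_space_def using subspace_Sym
  by (auto simp: subspace_def entry_def distrib_right sum.distrib sum_distrib_left mult.assoc)

lemma entry_chart_vec: "p \<in> I \<Longrightarrow> q \<in> I \<Longrightarrow> entry (chart_vec I A p) q = (if q = p then 1 else 0)"
  "p \<in> I \<Longrightarrow> l \<in> J \<Longrightarrow> entry (chart_vec I A p) l = A (p, l)"
  using IJ by (subst chart_vec_def, subst entry_sym_matrix, auto)+

lemma chart_vec_in_chart: "p \<in> I \<Longrightarrow> chart_vec I A p \<in> chart_space I J A"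
proof -
  assume p: "p \<in> I"
  have "entry (chart_vec I A p) l = (\<Sum>q\<in>I. entry (chart_vec I A p) q * A (q, l))" if l: "l \<in> J" for l
  proof -
    have "(\<Sum>q\<in>I. entry (chart_vec I A p) q * A (q, l)) = (\<Sum>q\<in>I. if q = p then A (p, l) else 0)"
      by (rule sum.cong) (auto simp: entry_chart_vec p)
    then show ?thesis using p l by (simp add: entry_chart_vec)
  qed
  then show ?thesis by (simp add: chart_space_def chart_vec_def sym_matrix_Sym)
qed

lemma chart_decomp:
  assumes X: "X \<in> chart_space I J A"
  shows "X = (\<Sum>p\<in>I. entry X p *\<^sub>R chart_vec I A p)"
proof -
  have e: "entry (\<Sum>p\<in>I. entry X p *\<^sub>R chart_vec I A p) q = (\<Sum>p\<in>I. entry X p * entry (chart_vec I A p) q)" for q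
    by (simp add: entry_def)
  have SX: "X \<in> Sym" using X by (simp add: chart_space_def)
  have SY: "(\<Sum>p\<in>I. entry X p *\<^sub>R chart_vec I A p) \<in> Sym"
    by (intro subspace_sum[OF subspace_Sym] subspace_scale[OF subspace_Sym]) (simp add: chart_vec_def sym_matrix_Sym)
  have entq: "entry X q = entry (\<Sum>p\<in>I. entry X p *\<^sub>R chart_vec I A p) q" if "q \<in> upper_positions" for q
  proof (cases "q \<in> I")
    case True
    have "(\<Sum>p\<in>I. entry X p * entry (chart_vec I A p) q) = (\<Sum>p\<in>I. if p = q then entry X q else 0)"
      by (rule sum.cong) (auto simp: entry_chart_vec True)
    then show ?thesis using True by (simp add: e)
  next
    case False
    then have q: "q \<in> J" using that IJ by auto
    then show ?thesis using X by (simp add: e entry_chart_vec chart_space_def)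
  qed
  then have "sym_matrix (entry X) = sym_matrix (entry (\<Sum>p\<in>I. entry X p *\<^sub>R chart_vec I A p))"
  proof (intro matrix_eqI)
    fix i j :: 'n
    have "(min i j, max i j) \<in> upper_positions" by (auto simp: upper_positions_def min_def max_def)
    from entq[OF this]
    show "sym_matrix (entry X) $ i $ j = sym_matrix (entry (\<Sum>p\<in>I. entry X p *\<^sub>R chart_vec I A p)) $ i $ j"
      by (simp add: sym_matrix_def sym_lookup_def)
  qed
  then show ?thesis using Sym_eq_sym_matrix[OF SX] Sym_eq_sym_matrix[OF SY] by simp
qed

lemma chart_basis:
  "inj_on (chart_vec I A) I" "independent (chart_vec I A ` I)" "span (chart_vec I A ` I) = chart_space I J A"
proof -
  show inj: "inj_on (chart_vec I A) I"
    by (rule inj_onI) (metis entry_chart_vec(1) zero_neq_one)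
  show "independent (chart_vec I A ` I)"
    unfolding independent_explicit_finite_subsets
  proof (intro allI impI ballI)
    fix B u v assume B: "B \<subseteq> chart_vec I A ` I" "finite B" and s: "(\<Sum>v\<in>B. u v *\<^sub>R v) = 0" and v: "v \<in> B"
    obtain p where p: "p \<in> I" "v = chart_vec I A p" using B v by auto
    have "0 = entry (\<Sum>v\<in>B. u v *\<^sub>R v) p" unfolding s by (simp add: entry_def)
    also have "\<dots> = (\<Sum>w\<in>B. u w * entry w p)" by (simp add: entry_def)
    also have "\<dots> = (\<Sum>w\<in>B. if w = v then u v else 0)"
    proof (rule sum.cong[OF refl])
      fix w assume "w \<in> B"
      then obtain q where q: "q \<in> I" "w = chart_vec I A q" using B by auto
      show "u w * entry w p = (if w = v then u v else 0)"
        using p q inj by (auto simp: entry_chart_vec inj_on_def)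
    qed
    also have "\<dots> = u v" using B v by simp
    finally show "u v = 0" by simp
  qed
  show "span (chart_vec I A ` I) = chart_space I J A"
  proof
    show "span (chart_vec I A ` I) \<subseteq> chart_space I J A"
      by (rule span_minimal) (use chart_vec_in_chart subspace_chart in auto)
    show "chart_space I J A \<subseteq> span (chart_vec I A ` I)"
    proof
      fix X assume "X \<in> chart_space I J A"
      then have "X = (\<Sum>p\<in>I. entry X p *\<^sub>R chart_vec I A p)" by (rule chart_decomp)
      moreover have "\<dots> \<in> span (chart_vec I A ` I)" by (intro span_sum span_scale span_base) auto
      ultimately show "X \<in> span (chart_vec I A ` I)" by simp
    qed
  qed
qed

lemma dim_chart: "dim (chart_space I J A) = card I"
  using chart_basis[of A] by (metis card_image dim_eq_card_independent dim_span)

text \<open>In weighted coordinates the complement of the graph of \<open>A\<close> is the graph of minus the transpose of \<open>A\<close>.\<close>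

lemma perp_chart_relation:
  assumes N: "N \<in> sym_perp (chart_space I J A)" and p: "p \<in> I"
  shows "position_weight p * entry N p = - (\<Sum>l\<in>J. A (p, l) * (position_weight l * entry N l))"
proof -
  have NS: "N \<in> Sym" using N by (simp add: sym_perp_def)
  have "0 = chart_vec I A p \<bullet> N" using N chart_vec_in_chart[OF p, of A] by (simp add: sym_perp_def)
  also have "\<dots> = (\<Sum>q\<in>upper_positions. position_weight q * entry (chart_vec I A p) q * entry N q)"
    by (rule inner_Sym_entries) (simp_all add: chart_vec_def sym_matrix_Sym NS)
  also have "\<dots> = (\<Sum>q\<in>I. position_weight q * entry (chart_vec I A p) q * entry N q) + (\<Sum>q\<in>J. position_weight q * entry (chart_vec I A p) q * entry N q)"
    unfolding IJ(1)[symmetric] by (rule sum.union_disjoint) (use IJ in auto)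
  also have "(\<Sum>q\<in>I. position_weight q * entry (chart_vec I A p) q * entry N q) = (\<Sum>q\<in>I. if q = p then position_weight p * entry N p else 0)"
    by (rule sum.cong) (auto simp: entry_chart_vec p)
  also have "\<dots> = position_weight p * entry N p" using p by simp
  also have "(\<Sum>q\<in>J. position_weight q * entry (chart_vec I A p) q * entry N q) = (\<Sum>l\<in>J. A (p, l) * (position_weight l * entry N l))"
    by (rule sum.cong) (auto simp: entry_chart_vec p)
  finally show ?thesis by linarith
qed

end

section \<open>An equation satisfied by the non-transversal subspaces\<close>

text \<open>A chart \<open>(R, a, b, i, j)\<close> of the non-transversal subspaces records the row basis \<open>R\<close> of the first matrix of the pair, the
positions \<open>a\<close> and \<open>b\<close> of the parameters that are normalised to one, and coordinates \<open>i \<in> I\<close> of the first and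
\<open>j \<in> J\<close> of the second matrix that are not zero. Its variables are the remaining parameters of the pair and the entries
of the graph outside row \<open>i\<close> and column \<open>j\<close>.\<close>

type_synonym 'n chart = "'n set \<times> ('n \<times> 'n) \<times> ('n \<times> 'n) \<times> ('n \<times> 'n) \<times> ('n \<times> 'n)"
type_synonym 'n chart_var = "'n \<times> 'n + ('n \<times> 'n) \<times> ('n \<times> 'n)"

definition chart_y :: "'n \<times> 'n \<Rightarrow> 'n \<times> 'n \<Rightarrow> ('n chart_var \<Rightarrow> real) \<Rightarrow> 'n \<times> 'n \<Rightarrow> real" where
  "chart_y a b x p = (if p = a \<or> p = b then 1 else x (Inl p))"

text \<open>The coordinates of the first matrix and the weighted coordinates of the second.\<close>

definition chart_u :: "'n::linorder set \<Rightarrow> 'n \<times> 'n \<Rightarrow> 'n \<times> 'n \<Rightarrow> ('n chart_var \<Rightarrow> real) \<Rightarrow> 'n \<times> 'n \<Rightarrow> real" where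
  "chart_u R a b x p = conormal_fst R (chart_y a b x) (fst p) (snd p)"

definition chart_z :: "'n::linorder set \<Rightarrow> 'n \<times> 'n \<Rightarrow> 'n \<times> 'n \<Rightarrow> ('n chart_var \<Rightarrow> real) \<Rightarrow> 'n \<times> 'n \<Rightarrow> real" where
  "chart_z R a b x p = position_weight p * conormal_snd R (chart_y a b x) (fst p) (snd p)"

text \<open>The graph \<open>A\<close> contains the first matrix iff \<open>u l = (\<Sum>p\<in>I. u p * A (p, l))\<close> for \<open>l \<in> J\<close>, and its complement contains the second iff
\<open>z p = - (\<Sum>l\<in>J. A (p, l) * z l)\<close> for \<open>p \<in> I\<close>. These equations are solved for row \<open>i\<close> and column \<open>j\<close>; the corner
entry \<open>(i, j)\<close> is obtained by inserting column \<open>j\<close> into the equation for \<open>u j\<close>. All entries are brought to the common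
denominator \<open>u i * z j\<close>.\<close>

fun chart_den :: "'n::linorder chart \<Rightarrow> ('n chart_var \<Rightarrow> real) \<Rightarrow> real" where
  "chart_den (R, a, b, i, j) x = chart_u R a b x i * chart_z R a b x j"

fun chart_num :: "('n::linorder \<times> 'n) set \<Rightarrow> ('n \<times> 'n) set \<Rightarrow> 'n chart \<Rightarrow>
    ('n \<times> 'n) \<times> ('n \<times> 'n) \<Rightarrow> ('n chart_var \<Rightarrow> real) \<Rightarrow> real" where
  "chart_num I J (R, a, b, i, j) (p, l) x =
    (if p = i then
       if l = j then chart_z R a b x j * chart_u R a b x j
         + (\<Sum>p'\<in>I-{i}. chart_u R a b x p' * (chart_z R a b x p' + (\<Sum>l'\<in>J-{j}. x (Inr (p', l')) * chart_z R a b x l')))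
       else chart_z R a b x j * (chart_u R a b x l - (\<Sum>p'\<in>I-{i}. chart_u R a b x p' * x (Inr (p', l))))
     else if l = j then chart_u R a b x i * (- chart_z R a b x p - (\<Sum>l'\<in>J-{j}. x (Inr (p, l')) * chart_z R a b x l'))
     else x (Inr (p, l)) * (chart_u R a b x i * chart_z R a b x j))"

fun chart_vars :: "('n::linorder \<times> 'n) set \<Rightarrow> ('n \<times> 'n) set \<Rightarrow> 'n chart \<Rightarrow> 'n chart_var set" where
  "chart_vars I J (R, a, b, i, j) = Inl ` (upper_positions - {a, b}) \<union> Inr ` ((I - {i}) \<times> (J - {j}))"

definition charts :: "('n::linorder \<times> 'n) set \<Rightarrow> ('n \<times> 'n) set \<Rightarrow> 'n chart set" where
  "charts I J = {(R, a, b, i, j). a \<in> upper_positions \<and> b \<in> upper_positions \<and> a \<noteq> b \<and> i \<in> I \<and> j \<in> J}"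

context
  fixes I J :: "('n::{finite,linorder} \<times> 'n) set"
  assumes IJ: "I \<union> J = upper_positions" "I \<inter> J = {}"
begin

lemma finite_chart_vars: "finite (chart_vars I J t)"
  by (cases t) simp

text \<open>With \<open>m\<close> and \<open>q\<close> elements in \<open>I\<close> and \<open>J\<close> there are \<open>(m + q - 2) + (m - 1) * (q - 1) = m * q - 1\<close> variables.\<close>

lemma card_chart_vars:
  assumes "t \<in> charts I J" shows "card (chart_vars I J t) < card (I \<times> J)"
proof -
  obtain R a b i j where t: "t = (R, a, b, i, j)" by (cases t)
  have h: "a \<in> upper_positions" "b \<in> upper_positions" "a \<noteq> b" "i \<in> I" "j \<in> J" using assms by (auto simp: t charts_def)
  have "card I > 0" "card J > 0" using h by (auto simp: card_gt_0_iff)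
  then obtain m q where mq: "card I = Suc m" "card J = Suc q" by (metis gr0_implies_Suc)
  have cu: "card (upper_positions :: ('n \<times> 'n) set) = Suc m + Suc q"
    using card_Un_disjoint[of I J] IJ mq by simp
  have "card (chart_vars I J t) \<le> card (Inl ` (upper_positions - {a, b}) :: 'n chart_var set)
      + card (Inr ` ((I - {i}) \<times> (J - {j})) :: 'n chart_var set)"
    unfolding t chart_vars.simps by (rule card_Un_le)
  also have "\<dots> \<le> card (upper_positions - {a, b}) + card ((I - {i}) \<times> (J - {j}))"
    by (intro add_mono card_image_le) simp_all
  also have "card (upper_positions - {a, b}) = m + q" using h cu by (simp add: card_Diff_subset)
  also have "card ((I - {i}) \<times> (J - {j})) = m * q" using h mq by (simp add: card_cartesian_product)
  finally show ?thesis by (simp add: card_cartesian_product mq)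
qed

lemma chart_poly:
  assumes t: "t \<in> charts I J"
  shows "poly_function (chart_vars I J t) (chart_den t)"
    "e \<in> I \<times> J \<Longrightarrow> poly_function (chart_vars I J t) (chart_num I J t e)"
proof -
  obtain R a b i j where t': "t = (R, a, b, i, j)" by (cases t)
  define V where "V = chart_vars I J t"
  have V: "finite V" unfolding V_def by (rule finite_chart_vars)
  note pf = poly_function_const[OF V] poly_function_mult[OF V] poly_function_add[OF V]
    poly_function_uminus[OF V] poly_function_diff[OF V] poly_function_sum[OF V]
  have y: "poly_function V (\<lambda>x. chart_y a b x p)" if "p \<in> upper_positions" for p
  proof (cases "p = a \<or> p = b")
    case True
    then show ?thesis unfolding chart_y_def using poly_function_const[OF V, of 1] by (simp only: if_True simp_thms)
  next
    case False
    then have "Inl p \<in> V" using that by (auto simp: V_def t')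
    then show ?thesis using False poly_function_var[OF V] by (simp add: chart_y_def)
  qed
  have sym_lookup: "poly_function V (\<lambda>x. sym_lookup (chart_y a b x) k l)" for k l
    unfolding sym_lookup_def by (rule y) (auto simp: upper_positions_def min_def max_def)
  have ker: "poly_function V (\<lambda>x. image_frame R (chart_y a b x) k l)" for k l
    by (cases "k \<in> R") (simp_all add: image_frame_def sym_lookup pf(1))
  have coker: "poly_function V (\<lambda>x. kernel_frame R (chart_y a b x) k l)" for k l
    by (cases "k \<in> R") (simp_all add: kernel_frame_def pf(1) pf(4)[OF sym_lookup])
  have u: "poly_function V (\<lambda>x. chart_u R a b x p)" for p
    unfolding chart_u_def conormal_fst_def by (intro pf(2) pf(6) ker sym_lookup)
  have z: "poly_function V (\<lambda>x. chart_z R a b x p)" for p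
    unfolding chart_z_def conormal_snd_def by (intro pf(1) pf(2) pf(6) coker sym_lookup)
  have x: "poly_function V (\<lambda>x. x (Inr (p, l)))" if "p \<in> I - {i}" "l \<in> J - {j}" for p l
    by (rule poly_function_var[OF V]) (use that in \<open>auto simp: V_def t'\<close>)
  have "poly_function V (\<lambda>x. chart_den t x)"
    unfolding t' chart_den.simps by (intro pf(2) u z)
  then show "poly_function (chart_vars I J t) (chart_den t)" by (simp add: V_def)
  assume e: "e \<in> I \<times> J"
  obtain p l where pl: "e = (p, l)" "p \<in> I" "l \<in> J" using e by auto
  have "poly_function V (\<lambda>x. chart_num I J t e x)"
  proof (cases "p = i"; cases "l = j")
    assume "p = i" "l = j"
    then show ?thesis unfolding t' pl chart_num.simps
      by (simp only: if_True simp_thms) (intro pf(2,3,6) u z x)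
  next
    assume "p = i" "l \<noteq> j"
    then show ?thesis unfolding t' pl chart_num.simps using pl
      by (simp only: if_True if_False simp_thms) (intro pf(2,5,6) u z x, auto)
  next
    assume "p \<noteq> i" "l = j"
    then show ?thesis unfolding t' pl chart_num.simps using pl
      by (simp only: if_True if_False simp_thms) (intro pf(2,4,5,6) u z x, auto)
  next
    assume "p \<noteq> i" "l \<noteq> j"
    then show ?thesis unfolding t' pl chart_num.simps using pl
      by (simp only: if_True if_False simp_thms) (intro pf(2) u z x, auto)
  qed
  then show "poly_function (chart_vars I J t) (chart_num I J t e)" by (simp add: V_def)
qed

lemma chart_num_correct:
  assumes i: "i \<in> I" and j: "j \<in> J"
    and x: "\<And>p l. p \<in> I \<Longrightarrow> l \<in> J \<Longrightarrow> x (Inr (p, l)) = A (p, l)"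
    and u: "\<And>l. l \<in> J \<Longrightarrow> chart_u R a b x l = (\<Sum>p\<in>I. chart_u R a b x p * A (p, l))"
    and z: "\<And>p. p \<in> I \<Longrightarrow> chart_z R a b x p = - (\<Sum>l\<in>J. A (p, l) * chart_z R a b x l)"
    and pl: "p \<in> I" "l \<in> J"
  shows "chart_num I J (R, a, b, i, j) (p, l) x = A (p, l) * chart_den (R, a, b, i, j) x"
proof -
  let ?u = "chart_u R a b x" and ?z = "chart_z R a b x"
  have u': "(\<Sum>p'\<in>I-{i}. ?u p' * A (p', l)) = ?u l - ?u i * A (i, l)" if "l \<in> J" for l
    using u[OF that] i by (simp add: sum_diff1)
  have z': "(\<Sum>l'\<in>J-{j}. A (p, l') * ?z l') = - ?z p - A (p, j) * ?z j" if "p \<in> I" for p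
    using z[OF that] j by (simp add: sum_diff1)
  have ux: "(\<Sum>p'\<in>I-{i}. ?u p' * x (Inr (p', l))) = ?u l - ?u i * A (i, l)" if "l \<in> J" for l
    unfolding u'[OF that, symmetric] by (rule sum.cong) (use x that in auto)
  have zx: "(\<Sum>l'\<in>J-{j}. x (Inr (p, l')) * ?z l') = - ?z p - A (p, j) * ?z j" if "p \<in> I" for p
    unfolding z'[OF that, symmetric] by (rule sum.cong) (use x that in auto)
  have uz: "(\<Sum>p'\<in>I-{i}. ?u p' * (?z p' + (\<Sum>l'\<in>J-{j}. x (Inr (p', l')) * ?z l'))) =
      - ((?u j - ?u i * A (i, j)) * ?z j)"
  proof -
    have "(\<Sum>p'\<in>I-{i}. ?u p' * (?z p' + (\<Sum>l'\<in>J-{j}. x (Inr (p', l')) * ?z l')))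
        = (\<Sum>p'\<in>I-{i}. - (?u p' * A (p', j) * ?z j))"
      by (rule sum.cong) (simp_all add: zx)
    also have "\<dots> = - ((\<Sum>p'\<in>I-{i}. ?u p' * A (p', j)) * ?z j)"
      by (simp add: sum_negf sum_distrib_right)
    finally show ?thesis by (simp add: u'[OF j])
  qed
  show ?thesis
  proof (cases "p = i"; cases "l = j")
    assume "p = i" "l = j"
    then show ?thesis
      by (simp only: chart_num.simps chart_den.simps if_True simp_thms uz) (simp add: algebra_simps)
  next
    assume "p = i" "l \<noteq> j"
    then show ?thesis
      by (simp only: chart_num.simps chart_den.simps if_True if_False simp_thms ux[OF pl(2)])
        (simp add: algebra_simps)
  next
    assume "p \<noteq> i" "l = j"
    then show ?thesis
      by (simp only: chart_num.simps chart_den.simps if_True if_False simp_thms zx[OF pl(1)])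
        (simp add: algebra_simps)
  next
    assume "p \<noteq> i" "l \<noteq> j"
    then show ?thesis
      by (simp only: chart_num.simps chart_den.simps if_False simp_thms x[OF pl])
  qed
qed

text \<open>The values of the variables are read off from the normalised parametrisation and from \<open>A\<close> itself. Neither matrix vanishes, and the coordinates in \<open>I\<close> determine the first, those in \<open>J\<close> the second, so suitable \<open>i\<close> and \<open>j\<close> exist.\<close>

lemma nontransversal_in_chart:
  assumes \<Omega>: "\<Omega> \<in> chart_space I J A" "\<Omega> \<noteq> 0" and N: "N \<in> sym_perp (chart_space I J A)" "N \<noteq> 0"
    and z: "\<Omega> ** N = 0"
  shows "\<exists>t\<in>charts I J. \<exists>x. chart_den t x \<noteq> 0 \<and> (\<forall>e\<in>I \<times> J. A e = chart_num I J t e x / chart_den t x)"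
proof -
  have S: "\<Omega> \<in> Sym" "N \<in> Sym" using \<Omega> N by (simp_all add: chart_space_def sym_perp_def)
  obtain R y a b q r where Ry: "a \<in> upper_positions \<inter> R \<times> R" "b \<in> upper_positions \<inter> (-R) \<times> (-R)" "y a = 1" "y b = 1"
    "q \<noteq> 0" "r \<noteq> 0" "\<And>i j. \<Omega> $ i $ j = q * conormal_fst R y i j" "\<And>i j. N $ i $ j = r * conormal_snd R y i j"
    by (rule conormal_pair_param_normalised[OF S z \<Omega>(2) N(2)]) (rule that)
  define x where "x v = (case v of Inl p \<Rightarrow> y p | Inr e \<Rightarrow> A e)" for v
  have y: "chart_y a b x = y" using Ry(3,4) by (auto simp: chart_y_def x_def)
  have xA: "x (Inr e) = A e" for e by (simp add: x_def)
  have u: "entry \<Omega> p = q * chart_u R a b x p" for p by (simp add: entry_def chart_u_def y Ry)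
  have zz: "position_weight p * entry N p = r * chart_z R a b x p" for p by (simp add: entry_def chart_z_def y Ry)
  have urel: "chart_u R a b x l = (\<Sum>p\<in>I. chart_u R a b x p * A (p, l))" if "l \<in> J" for l
  proof -
    have "q * chart_u R a b x l = (\<Sum>p\<in>I. entry \<Omega> p * A (p, l))"
      using \<Omega>(1) that by (simp add: chart_space_def flip: u)
    also have "\<dots> = q * (\<Sum>p\<in>I. chart_u R a b x p * A (p, l))"
      by (simp add: u sum_distrib_left mult.assoc)
    finally show ?thesis using Ry(5) by simp
  qed
  have zrel: "chart_z R a b x p = - (\<Sum>l\<in>J. A (p, l) * chart_z R a b x l)" if "p \<in> I" for p
  proof -
    have "r * chart_z R a b x p = - (\<Sum>l\<in>J. A (p, l) * (position_weight l * entry N l))"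
      using perp_chart_relation[OF IJ N(1) that] by (simp add: zz)
    also have "\<dots> = r * (- (\<Sum>l\<in>J. A (p, l) * chart_z R a b x l))"
      by (simp add: zz sum_distrib_left sum_negf mult_ac)
    finally show ?thesis by (rule mult_left_cancel[OF Ry(6), THEN iffD1])
  qed
  have upper_zero: "X = 0" if "X \<in> Sym" "\<And>p. p \<in> upper_positions \<Longrightarrow> entry X p = 0" for X :: "real^'n::{finite,linorder}^'n::{finite,linorder}"
  proof (rule matrix_eqI)
    fix i j :: 'n
    have "(min i j, max i j) \<in> upper_positions" by (auto simp: upper_positions_def min_def max_def)
    then have "entry X (min i j, max i j) = 0" by (rule that(2))
    then show "X $ i $ j = 0 $ i $ j" using Sym_entry[OF that(1), of i j]
      by (auto simp: entry_def min_def max_def split: if_splits)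
  qed
  have "\<exists>i\<in>I. chart_u R a b x i \<noteq> 0"
  proof (rule ccontr)
    assume no: "\<not> ?thesis"
    have "chart_u R a b x p = 0" if "p \<in> upper_positions" for p
      using that no urel[of p] IJ(1) by (cases "p \<in> I") auto
    then show False using upper_zero[OF S(1)] u \<Omega>(2) by simp
  qed
  then obtain i where i: "i \<in> I" "chart_u R a b x i \<noteq> 0" by blast
  have "\<exists>j\<in>J. chart_z R a b x j \<noteq> 0"
  proof (rule ccontr)
    assume no: "\<not> ?thesis"
    have "entry N p = 0" if "p \<in> upper_positions" for p
    proof -
      have "chart_z R a b x p = 0" using that no zrel[of p] IJ(1) by (cases "p \<in> J") auto
      then have "position_weight p * entry N p = 0" by (simp add: zz)
      then show ?thesis by (simp add: position_weight_def split: if_splits)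
    qed
    then show False using upper_zero[OF S(2)] N(2) by simp
  qed
  then obtain j where j: "j \<in> J" "chart_z R a b x j \<noteq> 0" by blast
  have nz: "chart_den (R, a, b, i, j) x \<noteq> 0" using i j by simp
  have "A e = chart_num I J (R, a, b, i, j) e x / chart_den (R, a, b, i, j) x" if e: "e \<in> I \<times> J" for e
  proof -
    obtain p l where pl: "e = (p, l)" "p \<in> I" "l \<in> J" using e by auto
    have "chart_num I J (R, a, b, i, j) (p, l) x = A (p, l) * chart_den (R, a, b, i, j) x"
      by (rule chart_num_correct[OF i(1) j(1) xA urel zrel pl(2,3)])
    then show ?thesis
      by (simp only: pl(1)) (rule nonzero_mult_div_cancel_right[OF nz, symmetric])
  qed
  moreover have "(R, a, b, i, j) \<in> charts I J" using Ry(1,2) i j by (auto simp: charts_def)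
  ultimately show ?thesis using nz by blast
qed

lemma exists_transversality_polynomial:
  obtains K c where "\<exists>\<beta>\<in>I \<times> J \<rightarrow>\<^sub>E {..K::nat}. c \<beta> \<noteq> (0::real)"
    "\<And>A \<Omega> N. (\<Sum>\<beta>\<in>I \<times> J \<rightarrow>\<^sub>E {..K}. c \<beta> * (\<Prod>e\<in>I \<times> J. A e ^ \<beta> e)) \<noteq> 0 \<Longrightarrow>
      \<Omega> \<in> chart_space I J A \<Longrightarrow> N \<in> sym_perp (chart_space I J A) \<Longrightarrow> \<Omega> ** N = 0 \<Longrightarrow> \<Omega> = 0 \<or> N = 0"
proof -
  obtain K c where K: "\<exists>\<beta>\<in>I \<times> J \<rightarrow>\<^sub>E {..K::nat}. c \<beta> \<noteq> (0::real)"
    "\<And>t x. t \<in> charts I J \<Longrightarrow> chart_den t x \<noteq> 0 \<Longrightarrow>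
      (\<Sum>\<beta>\<in>I \<times> J \<rightarrow>\<^sub>E {..K}. c \<beta> * (\<Prod>e\<in>I \<times> J. (chart_num I J t e x / chart_den t x) ^ \<beta> e)) = 0"
  proof (rule common_vanishing_polynomial[of "I \<times> J" "charts I J" "chart_vars I J" "chart_num I J" chart_den])
    show "finite (I \<times> J)" "finite (charts I J)" by simp_all
  qed (use finite_chart_vars card_chart_vars chart_poly that in \<open>auto\<close>)
  show ?thesis
  proof (rule that[OF K(1)])
    fix A \<Omega> N
    assume nz: "(\<Sum>\<beta>\<in>I \<times> J \<rightarrow>\<^sub>E {..K}. c \<beta> * (\<Prod>e\<in>I \<times> J. A e ^ \<beta> e)) \<noteq> 0"
      and h: "\<Omega> \<in> chart_space I J A" "N \<in> sym_perp (chart_space I J A)" "\<Omega> ** N = 0"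
    show "\<Omega> = 0 \<or> N = 0"
    proof (rule ccontr)
      assume "\<not> (\<Omega> = 0 \<or> N = 0)"
      then obtain t x where tx: "t \<in> charts I J" "chart_den t x \<noteq> 0"
        "\<And>e. e \<in> I \<times> J \<Longrightarrow> A e = chart_num I J t e x / chart_den t x"
        using nontransversal_in_chart[OF h(1) _ h(2) _ h(3)] by blast
      have "(\<Prod>e\<in>I \<times> J. A e ^ \<beta> e) = (\<Prod>e\<in>I \<times> J. (chart_num I J t e x / chart_den t x) ^ \<beta> e)" for \<beta>
        by (rule prod.cong) (simp_all add: tx(3))
      then show False using nz K(2)[OF tx(1,2)] by simp
    qed
  qed
qed

end

section \<open>The equation in Pluecker coordinates\<close>

lemma plucker_eq:
  "plucker bs I = Determinant.det (Matrix.mat (length bs) (length bs) (\<lambda>(a, b). entry (bs ! a) (I ! b)))"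
  by (simp add: plucker_def entry_def)

definition subst_index :: "'p \<Rightarrow> 'p \<Rightarrow> 'p list \<Rightarrow> 'p list" where
  "subst_index p l Is = map (\<lambda>q. if q = p then l else q) Is"

text \<open>Cramer's rule: replacing one column of the coordinate matrix by a combination of its columns multiplies the determinant by the coefficient of the replaced column.\<close>

lemma plucker_subst_index:
  fixes bs :: "(real^'n::{finite,linorder}^'n::{finite,linorder}) list"
  assumes Is: "distinct Is" "length Is = length bs" and p: "p \<in> set Is"
    and rel: "\<And>a. a < length bs \<Longrightarrow> entry (bs ! a) l = (\<Sum>q\<in>set Is. entry (bs ! a) q * A q)"
  shows "plucker bs (subst_index p l Is) = A p * plucker bs Is"
proof -
  define m where "m = length bs"
  obtain k where k: "k < m" "Is ! k = p" using p Is by (metis in_set_conv_nth m_def)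
  define M where "M = Matrix.mat m m (\<lambda>(a, b). entry (bs ! a) (Is ! b))"
  define x where "x = Matrix.vec m (\<lambda>b. A (Is ! b))"
  have M: "M \<in> carrier_mat m m" and x: "x \<in> carrier_vec m" by (simp_all add: M_def x_def)
  have Mx: "vec_index (M *\<^sub>v x) a = entry (bs ! a) l" if a: "a < m" for a
  proof -
    have "vec_index (M *\<^sub>v x) a = (\<Sum>b<m. entry (bs ! a) (Is ! b) * A (Is ! b))"
      using a by (simp add: M_def x_def scalar_prod_def atLeast0LessThan)
    also have "\<dots> = (\<Sum>q\<in>set Is. entry (bs ! a) q * A q)"
      by (rule sum.reindex_bij_betw[OF bij_betw_nth]) (use Is in \<open>auto simp: m_def\<close>)
    finally show ?thesis using rel a by (simp add: m_def)
  qed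
  have "Matrix.mat m m (\<lambda>(a, b). entry (bs ! a) (subst_index p l Is ! b)) = replace_col M (M *\<^sub>v x) k"
  proof (rule eq_matI)
    fix a b assume "a < dim_row (replace_col M (M *\<^sub>v x) k)" "b < dim_col (replace_col M (M *\<^sub>v x) k)"
    then have ab: "a < m" "b < m" by (simp_all add: replace_col_def M_def)
    have "Is ! b = p \<longleftrightarrow> b = k" using k ab Is by (metis m_def nth_eq_iff_index_eq)
    then show "Matrix.mat m m (\<lambda>(a, b). entry (bs ! a) (subst_index p l Is ! b)) $$ (a, b) = replace_col M (M *\<^sub>v x) k $$ (a, b)"
      using ab Mx[OF ab(1)] Is by (auto simp: replace_col_def M_def subst_index_def m_def)
  qed (simp_all add: replace_col_def M_def)
  then have "plucker bs (subst_index p l Is) = Determinant.det (replace_col M (M *\<^sub>v x) k)"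
    by (simp add: plucker_eq m_def)
  also have "\<dots> = vec_index x k * Determinant.det M" by (rule cramer_lemma_mat[OF M x k(1)])
  finally show ?thesis using k by (simp add: plucker_eq M_def m_def x_def)
qed

text \<open>Conversely, if the determinant does not vanish, the column for \<open>l\<close> is such a combination, so the entries of the graph are quotients of Pluecker coordinates.\<close>

lemma plucker_nonzero_relation:
  fixes bs :: "(real^'n::{finite,linorder}^'n::{finite,linorder}) list"
  assumes Is: "distinct Is" "length Is = length bs" and nz: "plucker bs Is \<noteq> 0" and a: "a < length bs"
  shows "entry (bs ! a) l = (\<Sum>q\<in>set Is. entry (bs ! a) q * (plucker bs (subst_index q l Is) / plucker bs Is))"
proof -
  define m where "m = length bs"
  define M where "M = Matrix.mat m m (\<lambda>(a, b). entry (bs ! a) (Is ! b))"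
  define c where "c = Matrix.vec m (\<lambda>a. entry (bs ! a) l)"
  have M: "M \<in> carrier_mat m m" and c: "c \<in> carrier_vec m" by (simp_all add: M_def c_def)
  have dM: "Determinant.det M = plucker bs Is" by (simp add: plucker_eq M_def m_def)
  define x where "x = inverse (Determinant.det M) \<cdot>\<^sub>v (adj_mat M *\<^sub>v c)"
  have adj: "adj_mat M \<in> carrier_mat m m" "M * adj_mat M = Determinant.det M \<cdot>\<^sub>m 1\<^sub>m m"
    using adj_mat[OF M] by auto
  have x: "x \<in> carrier_vec m" using adj c by (simp add: x_def)
  have "M *\<^sub>v x = inverse (Determinant.det M) \<cdot>\<^sub>v (M *\<^sub>v (adj_mat M *\<^sub>v c))"
    unfolding x_def using M adj c by (intro mult_mat_vec) auto
  also have "M *\<^sub>v (adj_mat M *\<^sub>v c) = (M * adj_mat M) *\<^sub>v c"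
    by (rule assoc_mult_mat_vec[symmetric, OF M adj(1) c])
  also have "\<dots> = Determinant.det M \<cdot>\<^sub>v c" unfolding adj(2) using c by auto
  finally have "M *\<^sub>v x = inverse (Determinant.det M) \<cdot>\<^sub>v (Determinant.det M \<cdot>\<^sub>v c)" .
  then have Mx: "M *\<^sub>v x = c" using nz c by (auto simp: dM)
  define X where "X q = vec_index x (THE k. k < m \<and> Is ! k = q)" for q
  have X: "X (Is ! k) = vec_index x k" if "k < m" for k
  proof -
    have "(THE k'. k' < m \<and> Is ! k' = Is ! k) = k"
      by (rule the_equality) (use that Is in \<open>auto simp: m_def nth_eq_iff_index_eq\<close>)
    then show ?thesis by (simp add: X_def)
  qed
  have rel: "entry (bs ! a) l = (\<Sum>q\<in>set Is. entry (bs ! a) q * X q)" if a: "a < length bs" for a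
  proof -
    have "entry (bs ! a) l = vec_index (M *\<^sub>v x) a" using a by (simp add: Mx c_def m_def)
    also have "\<dots> = (\<Sum>b<m. entry (bs ! a) (Is ! b) * X (Is ! b))"
      using a x by (simp add: M_def m_def[symmetric] scalar_prod_def atLeast0LessThan X)
    also have "\<dots> = (\<Sum>q\<in>set Is. entry (bs ! a) q * X q)"
      by (rule sum.reindex_bij_betw[OF bij_betw_nth]) (use Is in \<open>auto simp: m_def\<close>)
    finally show ?thesis .
  qed
  have "X q = plucker bs (subst_index q l Is) / plucker bs Is" if "q \<in> set Is" for q
    using plucker_subst_index[OF Is that rel] nz by simp
  then show ?thesis using rel[OF a] by simp
qed

text \<open>The monomial with exponents \<open>\<beta>\<close> in the entries of the graph, homogenised with the Pluecker coordinate \<open>Is\<close>. The additional factor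
\<open>Is\<close> makes the resulting polynomial vanish on all subspaces outside the chart.\<close>

definition chart_monomial :: "'p list \<Rightarrow> 'p set \<Rightarrow> nat \<Rightarrow> ('p \<times> 'p \<Rightarrow> nat) \<Rightarrow> ('p list \<Rightarrow>\<^sub>0 nat)" where
  "chart_monomial Is J K \<beta> =
     Poly_Mapping.single Is (Suc (\<Sum>e\<in>set Is \<times> J. K - \<beta> e)) +
     (\<Sum>e\<in>set Is \<times> J. Poly_Mapping.single (subst_index (fst e) (snd e) Is) (\<beta> e))"

definition chart_rpoly :: "'p list \<Rightarrow> 'p set \<Rightarrow> nat \<Rightarrow> (('p \<times> 'p \<Rightarrow> nat) \<Rightarrow> real) \<Rightarrow> 'p list rpoly" where
  "chart_rpoly Is J K c = (\<Sum>\<beta>\<in>set Is \<times> J \<rightarrow>\<^sub>E {..K}. Poly_Mapping.single (chart_monomial Is J K \<beta>) (c \<beta>))"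

context
  fixes Is :: "'p list" and J :: "'p set"
  assumes J: "finite J" "set Is \<inter> J = {}"
begin

lemma subst_index_inj:
  assumes "p \<in> set Is" "l \<in> J" "p' \<in> set Is" "l' \<in> J" "subst_index p l Is = subst_index p' l' Is"
  shows "p = p' \<and> l = l'"
proof -
  have eq: "(if q = p then l else q) = (if q = p' then l' else q)" if "q \<in> set Is" for q
    using assms(5) that unfolding subst_index_def by (simp add: map_eq_conv)
  \<comment> \<open>At position \<open>p\<close> one side shows an element of \<open>J\<close>, hence so does the other.\<close>
  have "p = p'" using eq[OF assms(1)] assms J(2) by (auto split: if_splits)
  then show ?thesis using eq[OF assms(1)] by simp
qed

lemma subst_index_neq: "p \<in> set Is \<Longrightarrow> l \<in> J \<Longrightarrow> subst_index p l Is \<noteq> Is"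
proof
  assume a: "p \<in> set Is" "l \<in> J" "subst_index p l Is = Is"
  have "l \<in> set (subst_index p l Is)" using a(1) by (auto simp: subst_index_def)
  then show False using a J(2) by auto
qed

lemma lookup_chart_monomial:
  "Poly_Mapping.lookup (chart_monomial Is J K \<beta>) Is = Suc (\<Sum>e\<in>set Is \<times> J. K - \<beta> e)"
  "e \<in> set Is \<times> J \<Longrightarrow> Poly_Mapping.lookup (chart_monomial Is J K \<beta>) (subst_index (fst e) (snd e) Is) = \<beta> e"
  "v \<noteq> Is \<Longrightarrow> v \<notin> (\<lambda>e. subst_index (fst e) (snd e) Is) ` (set Is \<times> J) \<Longrightarrow>
     Poly_Mapping.lookup (chart_monomial Is J K \<beta>) v = 0"
proof -
  let ?s = "\<lambda>e. subst_index (fst e) (snd e) Is"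
  have *: "Poly_Mapping.lookup (chart_monomial Is J K \<beta>) v =
      (if v = Is then Suc (\<Sum>e\<in>set Is \<times> J. K - \<beta> e) else 0) + (\<Sum>e\<in>set Is \<times> J. if ?s e = v then \<beta> e else 0)" for v
    by (auto simp: chart_monomial_def lookup_add lookup_sum lookup_single when_def)
  have "(\<Sum>e\<in>set Is \<times> J. if ?s e = Is then \<beta> e else 0) = 0"
    by (rule sum.neutral) (use subst_index_neq in auto)
  then show "Poly_Mapping.lookup (chart_monomial Is J K \<beta>) Is = Suc (\<Sum>e\<in>set Is \<times> J. K - \<beta> e)"
    by (simp add: *)
  show "Poly_Mapping.lookup (chart_monomial Is J K \<beta>) v = 0"
    if "v \<noteq> Is" "v \<notin> ?s ` (set Is \<times> J)"
  proof -
    have "?s e \<noteq> v" if "e \<in> set Is \<times> J" for e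
      using imageI[OF that, of ?s] \<open>v \<notin> ?s ` (set Is \<times> J)\<close> by metis
    then have "(\<Sum>e\<in>set Is \<times> J. if ?s e = v then \<beta> e else 0) = 0"
      by (intro sum.neutral) simp
    then show ?thesis using that by (simp add: *)
  qed
  assume e: "e \<in> set Is \<times> J"
  have "(\<Sum>e'\<in>set Is \<times> J. if ?s e' = ?s e then \<beta> e' else 0) = (\<Sum>e'\<in>set Is \<times> J. if e' = e then \<beta> e else 0)"
  proof (rule sum.cong[OF refl])
    fix e' assume e': "e' \<in> set Is \<times> J"
    have "?s e' = ?s e \<longleftrightarrow> e' = e"
      using subst_index_inj[of "fst e'" "snd e'" "fst e" "snd e"] e e' by (auto simp: prod_eq_iff)
    then show "(if ?s e' = ?s e then \<beta> e' else 0) = (if e' = e then \<beta> e else 0)" by simp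
  qed
  also have "\<dots> = \<beta> e" using e J by simp
  finally show "Poly_Mapping.lookup (chart_monomial Is J K \<beta>) (?s e) = \<beta> e"
    using subst_index_neq e by (auto simp: *)
qed

lemma keys_chart_monomial:
  "Poly_Mapping.keys (chart_monomial Is J K \<beta>) \<subseteq> insert Is ((\<lambda>e. subst_index (fst e) (snd e) Is) ` (set Is \<times> J))"
  using lookup_chart_monomial(3) by (auto simp: in_keys_iff)

lemma chart_variables_sum:
  fixes g :: "'p list \<Rightarrow> 'a::comm_monoid_add"
  shows "sum g (insert Is ((\<lambda>e. subst_index (fst e) (snd e) Is) ` (set Is \<times> J))) =
    g Is + (\<Sum>e\<in>set Is \<times> J. g (subst_index (fst e) (snd e) Is))"
proof -
  have "inj_on (\<lambda>e. subst_index (fst e) (snd e) Is) (set Is \<times> J)"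
    using subst_index_inj by (auto simp: inj_on_def)
  moreover have "Is \<notin> (\<lambda>e. subst_index (fst e) (snd e) Is) ` (set Is \<times> J)"
    using subst_index_neq by force
  ultimately show ?thesis using J by (simp add: sum.reindex)
qed

lemma chart_variables_prod:
  fixes g :: "'p list \<Rightarrow> 'a::comm_monoid_mult"
  shows "prod g (insert Is ((\<lambda>e. subst_index (fst e) (snd e) Is) ` (set Is \<times> J))) =
    g Is * (\<Prod>e\<in>set Is \<times> J. g (subst_index (fst e) (snd e) Is))"
proof -
  have "inj_on (\<lambda>e. subst_index (fst e) (snd e) Is) (set Is \<times> J)"
    using subst_index_inj by (auto simp: inj_on_def)
  moreover have "Is \<notin> (\<lambda>e. subst_index (fst e) (snd e) Is) ` (set Is \<times> J)"
    using subst_index_neq by force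
  ultimately show ?thesis using J by (simp add: prod.reindex)
qed

lemma degree_chart_monomial:
  assumes \<beta>: "\<beta> \<in> set Is \<times> J \<rightarrow>\<^sub>E {..K}"
  shows "(\<Sum>v\<in>Poly_Mapping.keys (chart_monomial Is J K \<beta>). Poly_Mapping.lookup (chart_monomial Is J K \<beta>) v)
    = Suc (card (set Is \<times> J) * K)"
proof -
  let ?V = "insert Is ((\<lambda>e. subst_index (fst e) (snd e) Is) ` (set Is \<times> J))"
  have "(\<Sum>v\<in>Poly_Mapping.keys (chart_monomial Is J K \<beta>). Poly_Mapping.lookup (chart_monomial Is J K \<beta>) v)
      = (\<Sum>v\<in>?V. Poly_Mapping.lookup (chart_monomial Is J K \<beta>) v)"
    by (rule sum.mono_neutral_left) (use keys_chart_monomial J in \<open>auto simp: in_keys_iff\<close>)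
  also have "\<dots> = Suc (\<Sum>e\<in>set Is \<times> J. K - \<beta> e) + (\<Sum>e\<in>set Is \<times> J. \<beta> e)"
    by (subst chart_variables_sum) (simp only: lookup_chart_monomial cong: sum.cong)
  also have "\<dots> = Suc (\<Sum>e\<in>set Is \<times> J. (K - \<beta> e) + \<beta> e)" by (simp add: sum.distrib)
  also have "(\<Sum>e\<in>set Is \<times> J. (K - \<beta> e) + \<beta> e) = (\<Sum>e\<in>set Is \<times> J. K)"
    by (rule sum.cong) (use \<beta> in \<open>auto simp: PiE_iff\<close>)
  finally show ?thesis by simp
qed

lemma eval_chart_monomial:
  fixes x :: "'p list \<Rightarrow> real"
  shows "(\<Prod>v\<in>Poly_Mapping.keys (chart_monomial Is J K \<beta>). x v ^ Poly_Mapping.lookup (chart_monomial Is J K \<beta>) v)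
    = x Is ^ Suc (\<Sum>e\<in>set Is \<times> J. K - \<beta> e) * (\<Prod>e\<in>set Is \<times> J. x (subst_index (fst e) (snd e) Is) ^ \<beta> e)"
proof -
  let ?V = "insert Is ((\<lambda>e. subst_index (fst e) (snd e) Is) ` (set Is \<times> J))"
  have "(\<Prod>v\<in>Poly_Mapping.keys (chart_monomial Is J K \<beta>). x v ^ Poly_Mapping.lookup (chart_monomial Is J K \<beta>) v)
      = (\<Prod>v\<in>?V. x v ^ Poly_Mapping.lookup (chart_monomial Is J K \<beta>) v)"
    by (rule prod.mono_neutral_left) (use keys_chart_monomial J in \<open>auto simp: in_keys_iff\<close>)
  also have "\<dots> = x Is ^ Suc (\<Sum>e\<in>set Is \<times> J. K - \<beta> e) * (\<Prod>e\<in>set Is \<times> J. x (subst_index (fst e) (snd e) Is) ^ \<beta> e)"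
    by (subst chart_variables_prod) (simp only: lookup_chart_monomial cong: prod.cong)
  finally show ?thesis .
qed

lemma inj_chart_monomial: "inj_on (chart_monomial Is J K) (set Is \<times> J \<rightarrow>\<^sub>E {..K})"
proof (rule inj_onI)
  fix \<beta> \<gamma> assume b: "\<beta> \<in> set Is \<times> J \<rightarrow>\<^sub>E {..K}" "\<gamma> \<in> set Is \<times> J \<rightarrow>\<^sub>E {..K}"
    and eq: "chart_monomial Is J K \<beta> = chart_monomial Is J K \<gamma>"
  have "\<beta> e = \<gamma> e" if "e \<in> set Is \<times> J" for e
    using lookup_chart_monomial(2)[OF that, of K \<beta>] lookup_chart_monomial(2)[OF that, of K \<gamma>] eq by simp
  then show "\<beta> = \<gamma>" using b by (intro PiE_ext) auto
qed

lemma lookup_chart_rpoly: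
  "\<beta> \<in> set Is \<times> J \<rightarrow>\<^sub>E {..K} \<Longrightarrow> Poly_Mapping.lookup (chart_rpoly Is J K c) (chart_monomial Is J K \<beta>) = c \<beta>"
  "t \<notin> chart_monomial Is J K ` (set Is \<times> J \<rightarrow>\<^sub>E {..K}) \<Longrightarrow> Poly_Mapping.lookup (chart_rpoly Is J K c) t = 0"
proof -
  let ?B = "set Is \<times> J \<rightarrow>\<^sub>E {..K}"
  have fin: "finite ?B" using J by (simp add: finite_PiE)
  have *: "Poly_Mapping.lookup (chart_rpoly Is J K c) t = (\<Sum>\<beta>\<in>?B. if chart_monomial Is J K \<beta> = t then c \<beta> else 0)" for t
    by (simp add: chart_rpoly_def lookup_sum lookup_single when_def)
  show "Poly_Mapping.lookup (chart_rpoly Is J K c) t = 0" if "t \<notin> chart_monomial Is J K ` ?B"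
    unfolding * by (rule sum.neutral) (use that in auto)
  assume \<beta>: "\<beta> \<in> ?B"
  have "(\<Sum>\<gamma>\<in>?B. if chart_monomial Is J K \<gamma> = chart_monomial Is J K \<beta> then c \<gamma> else 0) = (\<Sum>\<gamma>\<in>?B. if \<gamma> = \<beta> then c \<beta> else 0)"
    by (rule sum.cong) (use inj_chart_monomial \<beta> in \<open>auto simp: inj_on_def\<close>)
  then show "Poly_Mapping.lookup (chart_rpoly Is J K c) (chart_monomial Is J K \<beta>) = c \<beta>"
    using \<beta> fin by (simp add: *)
qed

lemma keys_chart_rpoly: "Poly_Mapping.keys (chart_rpoly Is J K c) \<subseteq> chart_monomial Is J K ` (set Is \<times> J \<rightarrow>\<^sub>E {..K})"
proof
  fix t assume "t \<in> Poly_Mapping.keys (chart_rpoly Is J K c)"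
  then have "Poly_Mapping.lookup (chart_rpoly Is J K c) t \<noteq> 0" by (simp add: in_keys_iff)
  then show "t \<in> chart_monomial Is J K ` (set Is \<times> J \<rightarrow>\<^sub>E {..K})"
    using lookup_chart_rpoly(2) by blast
qed

lemma homogeneous_chart_rpoly: "rpoly_homogeneous (chart_rpoly Is J K c)"
  unfolding rpoly_homogeneous_def using keys_chart_rpoly degree_chart_monomial by blast

lemma vars_chart_rpoly:
  "rpoly_vars (chart_rpoly Is J K c) \<subseteq> insert Is ((\<lambda>e. subst_index (fst e) (snd e) Is) ` (set Is \<times> J))"
  unfolding rpoly_vars_def using keys_chart_rpoly[of K c] keys_chart_monomial by blast

lemma eval_chart_rpoly:
  "rpoly_eval x (chart_rpoly Is J K c) = (\<Sum>\<beta>\<in>set Is \<times> J \<rightarrow>\<^sub>E {..K}. c \<beta> *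
    (x Is ^ Suc (\<Sum>e\<in>set Is \<times> J. K - \<beta> e) * (\<Prod>e\<in>set Is \<times> J. x (subst_index (fst e) (snd e) Is) ^ \<beta> e)))"
proof -
  let ?B = "set Is \<times> J \<rightarrow>\<^sub>E {..K}"
  let ?m = "\<lambda>t. \<Prod>v\<in>Poly_Mapping.keys t. x v ^ Poly_Mapping.lookup t v"
  have fin: "finite ?B" using J by (simp add: finite_PiE)
  have "rpoly_eval x (chart_rpoly Is J K c) =
      (\<Sum>t\<in>chart_monomial Is J K ` ?B. Poly_Mapping.lookup (chart_rpoly Is J K c) t * ?m t)"
    unfolding rpoly_eval_def
    by (rule sum.mono_neutral_left) (use keys_chart_rpoly[of K c] fin in \<open>auto simp: in_keys_iff\<close>)
  also have "\<dots> = (\<Sum>\<beta>\<in>?B. Poly_Mapping.lookup (chart_rpoly Is J K c) (chart_monomial Is J K \<beta>) * ?m (chart_monomial Is J K \<beta>))"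
    by (subst sum.reindex[OF inj_chart_monomial]) simp
  also have "\<dots> = (\<Sum>\<beta>\<in>?B. c \<beta> *
    (x Is ^ Suc (\<Sum>e\<in>set Is \<times> J. K - \<beta> e) * (\<Prod>e\<in>set Is \<times> J. x (subst_index (fst e) (snd e) Is) ^ \<beta> e)))"
    by (rule sum.cong[OF refl]) (simp only: lookup_chart_rpoly(1) eval_chart_monomial)
  finally show ?thesis .
qed

text \<open>Every monomial has the same degree, so the homogenising coordinate factors out.\<close>

lemma eval_chart_rpoly_dehomogenise:
  assumes nz: "x Is \<noteq> 0" and A: "\<And>e. e \<in> set Is \<times> J \<Longrightarrow> x (subst_index (fst e) (snd e) Is) = A e * x Is"
  shows "rpoly_eval x (chart_rpoly Is J K c) = x Is ^ Suc (card (set Is \<times> J) * K) *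
    (\<Sum>\<beta>\<in>set Is \<times> J \<rightarrow>\<^sub>E {..K}. c \<beta> * (\<Prod>e\<in>set Is \<times> J. A e ^ \<beta> e))"
proof -
  let ?B = "set Is \<times> J"
  have "x Is ^ Suc (\<Sum>e\<in>?B. K - \<beta> e) * (\<Prod>e\<in>?B. x (subst_index (fst e) (snd e) Is) ^ \<beta> e)
      = x Is ^ Suc (card ?B * K) * (\<Prod>e\<in>?B. A e ^ \<beta> e)" if \<beta>: "\<beta> \<in> ?B \<rightarrow>\<^sub>E {..K}" for \<beta>
  proof -
    have "(\<Prod>e\<in>?B. x (subst_index (fst e) (snd e) Is) ^ \<beta> e) = (\<Prod>e\<in>?B. A e ^ \<beta> e * x Is ^ \<beta> e)"
      by (rule prod.cong) (simp_all only: A power_mult_distrib)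
    also have "\<dots> = (\<Prod>e\<in>?B. A e ^ \<beta> e) * x Is ^ (\<Sum>e\<in>?B. \<beta> e)" by (simp add: prod.distrib power_sum)
    finally have "x Is ^ Suc (\<Sum>e\<in>?B. K - \<beta> e) * (\<Prod>e\<in>?B. x (subst_index (fst e) (snd e) Is) ^ \<beta> e)
      = x Is ^ (Suc (\<Sum>e\<in>?B. K - \<beta> e) + (\<Sum>e\<in>?B. \<beta> e)) * (\<Prod>e\<in>?B. A e ^ \<beta> e)"
      by (simp add: power_add)
    also have "Suc (\<Sum>e\<in>?B. K - \<beta> e) + (\<Sum>e\<in>?B. \<beta> e) = Suc (\<Sum>e\<in>?B. (K - \<beta> e) + \<beta> e)" by (simp add: sum.distrib)
    also have "(\<Sum>e\<in>?B. (K - \<beta> e) + \<beta> e) = (\<Sum>e\<in>?B. K)"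
      by (rule sum.cong) (use \<beta> in \<open>auto simp: PiE_iff\<close>)
    finally show ?thesis by simp
  qed
  then show ?thesis unfolding eval_chart_rpoly sum_distrib_left
    by (intro sum.cong refl) (simp only: mult.left_commute)
qed

end

section \<open>The generic statement\<close>

lemma card_upper_positions: "card (upper_positions :: ('n::{finite,linorder} \<times> 'n) set) = (CARD('n) + 1) choose 2"
proof -
  define D where "D = {p :: 'n \<times> 'n. fst p = snd p}"
  define U where "U = {p :: 'n \<times> 'n. fst p < snd p}"
  define U' where "U' = {p :: 'n \<times> 'n. snd p < fst p}"
  have D: "card D = CARD('n)"
    by (rule bij_betw_same_card[of fst], rule bij_betwI[of _ _ _ "\<lambda>i. (i, i)"]) (auto simp: D_def)
  have U: "card U' = card U"
    by (rule bij_betw_same_card[of prod.swap], rule bij_betwI[of _ _ _ prod.swap]) (auto simp: U_def U'_def)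
  have "CARD('n) * CARD('n) = card (D \<union> U \<union> U')"
  proof -
    have "D \<union> U \<union> U' = UNIV" by (auto simp: D_def U_def U'_def)
    then show ?thesis by simp
  qed
  also have "\<dots> = card D + card U + card U'"
    by (subst card_Un_disjoint, simp, simp, force simp: D_def U_def U'_def)
      (subst card_Un_disjoint, auto simp: D_def U_def)
  finally have 1: "CARD('n) * CARD('n) = CARD('n) + 2 * card U" using D U by simp
  have "(upper_positions :: ('n \<times> 'n) set) = D \<union> U" by (auto simp: D_def U_def upper_positions_def)
  moreover have "card (D \<union> U) = card D + card U"
    by (rule card_Un_disjoint) (auto simp: D_def U_def)
  ultimately have "card (upper_positions :: ('n \<times> 'n) set) = card D + card U" by simp
  then have "2 * card (upper_positions :: ('n \<times> 'n) set) = CARD('n) * CARD('n) + CARD('n)" using 1 D by simp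
  moreover have "2 * ((CARD('n) + 1) choose 2) = CARD('n) * CARD('n) + CARD('n)"
    by (simp add: choose_two)
  ultimately show ?thesis by linarith
qed

lemma dim_Sym: "dim (Sym :: (real^'n::{finite,linorder}^'n::{finite,linorder}) set) = (CARD('n) + 1) choose 2"
proof -
  have "chart_space upper_positions {} (\<lambda>_. 0) = (Sym :: (real^'n::{finite,linorder}^'n::{finite,linorder}) set)"
    by (simp add: chart_space_def)
  then show ?thesis
    using dim_chart[of "upper_positions :: ('n \<times> 'n) set" "{}" "\<lambda>_. 0"] by (simp add: card_upper_positions)
qed

lemma norm_matrix_le_sum: "norm X \<le> (\<Sum>i\<in>UNIV. \<Sum>j\<in>UNIV. \<bar>X $ i $ j\<bar>)" for X :: "real^'n^'n"
proof -
  have "norm X \<le> (\<Sum>i\<in>UNIV. norm (X $ i))" unfolding norm_vec_def[of X] by (rule L2_set_le_sum) simp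
  also have "\<dots> \<le> (\<Sum>i\<in>UNIV. \<Sum>j\<in>UNIV. \<bar>X $ i $ j\<bar>)" by (intro sum_mono norm_le_l1_cart)
  finally show ?thesis .
qed

lemma PD_near_identity:
  fixes X :: "real^'n^'n"
  assumes "X \<in> Sym" "norm (X - mat 1) < 1"
  shows "X \<in> PD"
proof -
  have "0 < x \<bullet> (X *v x)" if "x \<noteq> 0" for x
  proof -
    have "x \<bullet> (X *v x) = x \<bullet> x + x \<bullet> ((X - mat 1) *v x)"
      by (simp add: mv.diff_left inner_diff_right)
    moreover have "\<bar>x \<bullet> ((X - mat 1) *v x)\<bar> \<le> norm (X - mat 1) * (x \<bullet> x)" by (rule abs_form_le_norm)
    moreover have "norm (X - mat 1) * (x \<bullet> x) < x \<bullet> x" using assms(2) that by simp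
    ultimately show ?thesis by linarith
  qed
  then show ?thesis using assms(1) by (simp add: PD_def)
qed

text \<open>The graph point over the coordinates of the identity matrix differs from the identity only at off-diagonal positions in \<open>J\<close>, where its entries are sums of \<open>CARD('n)\<close> entries of \<open>A\<close>. The bound on \<open>A\<close> keeps the norm of the difference below one.\<close>

lemma chart_space_meets_PD:
  fixes I J :: "('n::{finite,linorder} \<times> 'n) set"
  assumes IJ: "I \<union> J = upper_positions" "I \<inter> J = {}" and diag: "\<And>k. (k, k) \<in> I"
    and A: "\<And>e. \<bar>A e\<bar> \<le> 1 / (real CARD('n) ^ 3 + 1)"
  shows "chart_space I J A \<inter> PD \<noteq> {}"
proof -
  define n where "n = real CARD('n)"
  define f where "f q = (if fst q = snd q then 1 else if q \<in> I then 0 else (\<Sum>k\<in>UNIV. A ((k, k), q)))" for q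
  define X where "X = sym_matrix f"
  have XS: "X \<in> Sym" by (simp add: X_def sym_matrix_Sym)
  have entX: "entry X q = f q" if "q \<in> upper_positions" for q using that by (simp add: X_def entry_sym_matrix)
  have "entry X l = (\<Sum>p\<in>I. entry X p * A (p, l))" if l: "l \<in> J" for l
  proof -
    have lI: "l \<notin> I" "l \<in> upper_positions" using l IJ by auto
    then have "fst l \<noteq> snd l" using diag by (metis prod.collapse)
    then have 1: "entry X l = (\<Sum>k\<in>UNIV. A ((k, k), l))" using lI entX by (simp add: f_def)
    have "(\<Sum>p\<in>I. entry X p * A (p, l)) = (\<Sum>p\<in>I. if fst p = snd p then A (p, l) else 0)"
    proof (rule sum.cong[OF refl])
      fix p assume p: "p \<in> I"
      then have "entry X p = f p" using IJ by (intro entX) auto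
      then show "entry X p * A (p, l) = (if fst p = snd p then A (p, l) else 0)" using p by (simp add: f_def)
    qed
    also have "\<dots> = (\<Sum>p\<in>{p\<in>I. fst p = snd p}. A (p, l))" by (simp add: sum.inter_filter)
    also have "\<dots> = (\<Sum>k\<in>UNIV. A ((k, k), l))"
      by (rule sum.reindex_bij_witness[of _ "\<lambda>k. (k, k)" fst]) (auto simp: diag)
    finally show ?thesis using 1 by simp
  qed
  then have XL: "X \<in> chart_space I J A" using XS by (simp add: chart_space_def)
  have n1: "1 \<le> n" by (simp add: n_def)
  have fb: "\<bar>f q\<bar> \<le> n * (1 / (n ^ 3 + 1))" if "fst q \<noteq> snd q" for q
  proof -
    have "\<bar>\<Sum>k\<in>UNIV. A ((k, k), q)\<bar> \<le> (\<Sum>k\<in>(UNIV :: 'n set). 1 / (n ^ 3 + 1))"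
      by (rule order_trans[OF sum_abs]) (intro sum_mono, simp add: A n_def)
    then show ?thesis using that n1 by (simp add: f_def n_def)
  qed
  have "\<bar>(X - mat 1) $ i $ j\<bar> \<le> n * (1 / (n ^ 3 + 1))" for i j
  proof (cases "i = j")
    case True
    then show ?thesis using n1 by (simp add: X_def sym_matrix_def sym_lookup_def f_def Finite_Cartesian_Product.mat_def)
  next
    case False
    then show ?thesis using fb[of "(min i j, max i j)"]
      by (auto simp: X_def sym_matrix_def sym_lookup_def Finite_Cartesian_Product.mat_def min_def max_def split: if_splits)
  qed
  then have "(\<Sum>i\<in>UNIV. \<Sum>j\<in>UNIV. \<bar>(X - mat 1) $ i $ j\<bar>) \<le>
      (\<Sum>i\<in>(UNIV :: 'n set). \<Sum>j\<in>(UNIV :: 'n set). n * (1 / (n ^ 3 + 1)))"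
    by (intro sum_mono)
  also have "\<dots> = n ^ 3 / (n ^ 3 + 1)" by (simp add: n_def power3_eq_cube)
  also have "\<dots> < 1" using n1 by (simp add: add_nonneg_pos)
  finally have "norm (X - mat 1) < 1" using norm_matrix_le_sum[of "X - mat 1"] by linarith
  then show ?thesis using XL PD_near_identity[OF XS] by blast
qed

text \<open>The inequalities between the dimensions are used in this form: the diagonal fits into \<open>m\<close> coordinates, the case
\<open>d = n\<close> is void, and the codimension of \<open>L\<close> is less than the dimension of the symmetric matrices of size \<open>n - d\<close>.\<close>

lemma dimension_bounds:
  fixes m d n :: nat
  assumes d: "1 \<le> d" "d \<le> n"
    and m: "int d * int n - int (d choose 2) + 1 \<le> int m" "m \<le> (n + 1) choose 2"
  shows "n \<le> m" "d < n" "((n + 1) choose 2) - m < (n - d + 1) choose 2"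
proof -
  have two: "2 * int (k choose 2) = int k * (int k - 1)" for k
  proof -
    have "even (k * (k - 1))" by (cases k) auto
    then have "2 * (k choose 2) = k * (k - 1)" by (simp add: choose_two)
    then have "2 * int (k choose 2) = int (k * (k - 1))" by (metis of_nat_mult of_nat_numeral)
    then show ?thesis by (cases k) (simp_all add: algebra_simps)
  qed
  have m2: "2 * int d * int n - int d * (int d - 1) + 2 \<le> 2 * int m" using m(1) two[of d] by linarith
  have n2: "2 * int ((n + 1) choose 2) = (int n + 1) * int n" using two[of "n + 1"] by simp
  have "int m \<le> int ((n + 1) choose 2)" using m(2) by (simp only: of_nat_le_iff)
  then have m3: "2 * int m \<le> (int n + 1) * int n" using n2 by linarith
  have "0 \<le> (int d - 1) * (2 * int n - int d)" using d by (intro mult_nonneg_nonneg) auto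
  then have "2 * int n \<le> 2 * int d * int n - int d * (int d - 1)" by (simp add: algebra_simps)
  then show "n \<le> m" using m2 by linarith
  show "d < n"
  proof (rule ccontr)
    assume "\<not> d < n"
    then have "d = n" using d by simp
    then show False using m2 m3 by (simp add: algebra_simps)
  qed
  have r: "2 * int ((n - d + 1) choose 2) = (int n - int d + 1) * (int n - int d)"
    using two[of "n - d + 1"] d by (simp add: of_nat_diff)
  have "2 * int ((n + 1) choose 2) - 2 * int m < 2 * int ((n - d + 1) choose 2)"
    using m2 unfolding r n2 by (simp add: algebra_simps)
  then have "int ((n + 1) choose 2) - int m < int ((n - d + 1) choose 2)" by linarith
  then have "int (((n + 1) choose 2) - m) < int ((n - d + 1) choose 2)"
    by (simp only: of_nat_diff[OF m(2)])
  then show "((n + 1) choose 2) - m < (n - d + 1) choose 2" by (simp only: of_nat_less_iff)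
qed

theorem proposition3p16:
  fixes m d n :: nat
    and G :: "(real^'n::{finite,linorder}^'n::{finite,linorder}) set set"
  assumes n: "n = CARD('n)"
    and d: "1 \<le> d" "d \<le> n"
    and m: "int d * int n - int (d choose 2) + 1 \<le> int m" "m \<le> (n + 1) choose 2"
    and G: "G = {L \<in> Gr_Sym m. L \<inter> PD \<noteq> {}}"
  shows "\<exists>E. zariski_closed_in m G E \<and> E \<subset> G \<and>
    (\<forall>L\<in>G. L \<notin> E \<longrightarrow>
      (\<exists>U. U \<noteq> {} \<and> openin (top_of_set (PSD_rank_le d)) U \<and>
        (\<forall>S\<in>U. \<exists>\<Omega>\<in>PSD \<inter> L. rank \<Omega> = n - d \<and> \<Omega> ** S = 0)))"
proof -
  note bounds = dimension_bounds[OF d m]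
  \<comment> \<open>The chart must contain the identity matrix in its centre, so the diagonal positions are among \<open>I\<close>.\<close>
  define D where "D = {p :: 'n \<times> 'n. fst p = snd p}"
  have cD: "card D = n" unfolding n
    by (rule bij_betw_same_card[of fst], rule bij_betwI[of _ _ _ "\<lambda>i. (i, i)"]) (auto simp: D_def)
  have "D \<subseteq> upper_positions" by (auto simp: D_def upper_positions_def)
  moreover have "card D \<le> m" "m \<le> card (upper_positions :: ('n \<times> 'n) set)"
    using cD bounds(1) m(2) by (simp_all add: card_upper_positions n)
  ultimately obtain I where I: "D \<subseteq> I" "I \<subseteq> upper_positions" "card I = m"
    using exists_subset_between[of D m upper_positions] by auto
  define J where "J = upper_positions - I"
  have IJ: "I \<union> J = upper_positions" "I \<inter> J = {}" using I by (auto simp: J_def)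
  have diag: "(k, k) \<in> I" for k using I(1) by (auto simp: D_def)
  obtain Is where Is: "set Is = I" "distinct Is" using finite_distinct_list[of I] by auto
  have lenIs: "length Is = m" using Is I(3) distinct_card by fastforce
  have J': "finite J" "set Is \<inter> J = {}" using IJ Is by auto
  obtain K c where Kc: "\<exists>\<beta>\<in>I \<times> J \<rightarrow>\<^sub>E {..K::nat}. c \<beta> \<noteq> (0::real)"
    and detect: "\<And>A \<Omega> N. (\<Sum>\<beta>\<in>I \<times> J \<rightarrow>\<^sub>E {..K}. c \<beta> * (\<Prod>e\<in>I \<times> J. A e ^ \<beta> e)) \<noteq> 0 \<Longrightarrow>
      \<Omega> \<in> chart_space I J A \<Longrightarrow> N \<in> sym_perp (chart_space I J A) \<Longrightarrow> \<Omega> ** N = 0 \<Longrightarrow> \<Omega> = 0 \<or> N = 0"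
    by (rule exists_transversality_polynomial[OF IJ]) (rule that)
  define g where "g A = (\<Sum>\<beta>\<in>I \<times> J \<rightarrow>\<^sub>E {..K}. c \<beta> * (\<Prod>e\<in>I \<times> J. A e ^ \<beta> e))" for A
  define f where "f = chart_rpoly Is J K c"
  define Z where "Z = {L \<in> Gr_Sym m. \<forall>h\<in>{f}. \<forall>bs. ordered_basis bs L \<longrightarrow> rpoly_eval (plucker bs) h = 0}"
  have vars: "rpoly_vars f \<subseteq> plucker_indices m"
  proof -
    have "insert Is ((\<lambda>e. subst_index (fst e) (snd e) Is) ` (set Is \<times> J)) \<subseteq> plucker_indices m"
      using Is I(2) lenIs by (auto simp: plucker_indices_def subst_index_def J_def upper_positions_def)
    then show ?thesis using vars_chart_rpoly[OF J', of K c] unfolding f_def by blast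
  qed
  have Z: "Gr_Sym_zariski_closed m Z"
    unfolding Gr_Sym_zariski_closed_def
    by (rule exI[of _ "{f}"]) (use vars homogeneous_chart_rpoly[OF J'] in \<open>simp add: Z_def f_def\<close>)
  have closed: "zariski_closed_in m G (G \<inter> Z)" using Z unfolding zariski_closed_in_def by blast
  have eval: "rpoly_eval (plucker bs) f = plucker bs Is ^ Suc (card (set Is \<times> J) * K) * g A"
    if "plucker bs Is \<noteq> 0" "\<And>e. e \<in> I \<times> J \<Longrightarrow> plucker bs (subst_index (fst e) (snd e) Is) = A e * plucker bs Is"
    for bs A
    unfolding f_def g_def using eval_chart_rpoly_dehomogenise[OF J', of "plucker bs" A K c, OF that(1)] that(2)
    by (simp only: Is(1))
  \<comment> \<open>A small graph off the hypersurface meets the positive definite cone.\<close>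
  have proper: "G \<inter> Z \<noteq> G"
  proof -
    have "0 < 1 / (real CARD('n) ^ 3 + 1)" by (simp add: add_nonneg_pos)
    from nonvanishing_small_point[OF _ Kc this]
    obtain A where A: "\<And>e. \<bar>A e\<bar> \<le> 1 / (real CARD('n) ^ 3 + 1)" "g A \<noteq> 0" unfolding g_def by auto
    define L where "L = chart_space I J A"
    define bs where "bs = map (chart_vec I A) Is"
    have dimL: "dim L = m" unfolding L_def using dim_chart[OF IJ] I(3) by simp
    have "L \<inter> PD \<noteq> {}" unfolding L_def by (rule chart_space_meets_PD[OF IJ diag]) (rule A(1))
    moreover have "subspace L" "L \<subseteq> Sym"
      using subspace_chart[OF IJ, of A] by (auto simp: L_def chart_space_def)
    ultimately have LG: "L \<in> G" using dimL by (simp add: G Gr_Sym_def)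
    have ob: "ordered_basis bs L"
      using chart_basis[OF IJ, of A] Is by (simp add: ordered_basis_def bs_def L_def distinct_map)
    have lenb: "length Is = length bs" by (simp add: bs_def)
    have entbs: "entry (bs ! a) (Is ! b) = (if a = b then 1 else 0)" if "a < m" "b < m" for a b
    proof -
      have "Is ! a \<in> I" "Is ! b \<in> I" using that lenIs Is(1) nth_mem by blast+
      then show ?thesis
        using that Is(2) lenIs by (simp add: bs_def entry_chart_vec[OF IJ] nth_eq_iff_index_eq eq_commute)
    qed
    have "plucker bs Is = Determinant.det (1\<^sub>m m)"
      unfolding plucker_eq
      by (rule arg_cong[of _ _ Determinant.det], rule eq_matI)
        (use entbs lenIs in \<open>auto simp: bs_def\<close>)
    then have p1: "plucker bs Is = 1" by simp
    have "plucker bs (subst_index p l Is) = A (p, l) * plucker bs Is" if "p \<in> I" "l \<in> J" for p l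
    proof (rule plucker_subst_index[OF Is(2) lenb])
      show "p \<in> set Is" using that Is by simp
      fix a assume "a < length bs"
      then have "bs ! a \<in> chart_space I J A"
        using chart_vec_in_chart[OF IJ, of "Is ! a" A] Is(1) nth_mem[of a Is] by (simp add: bs_def)
      then show "entry (bs ! a) l = (\<Sum>q\<in>set Is. entry (bs ! a) q * A (q, l))"
        using that(2) by (simp add: chart_space_def Is(1))
    qed
    then have "rpoly_eval (plucker bs) f = plucker bs Is ^ Suc (card (set Is \<times> J) * K) * g A"
      by (intro eval) (auto simp: p1)
    then have "rpoly_eval (plucker bs) f \<noteq> 0" using A(2) by (simp add: p1)
    then have "L \<notin> Z" using ob by (auto simp: Z_def)
    then show ?thesis using LG by blast
  qed
  have good: "\<exists>U. U \<noteq> {} \<and> openin (top_of_set (PSD_rank_le d)) U \<and>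
        (\<forall>S\<in>U. \<exists>\<Omega>\<in>PSD \<inter> L. rank \<Omega> = n - d \<and> \<Omega> ** S = 0)" if L: "L \<in> G" "L \<notin> Z" for L
  proof -
    have LGr: "subspace L" "L \<subseteq> Sym" "dim L = m" "L \<inter> PD \<noteq> {}" using L(1) by (auto simp: G Gr_Sym_def)
    obtain bs where bs: "ordered_basis bs L" "rpoly_eval (plucker bs) f \<noteq> 0"
      using L by (auto simp: Z_def G)
    have lenb: "length bs = m"
      using bs(1) LGr(3) by (auto simp: ordered_basis_def dim_span dim_eq_card_independent distinct_card)
    have pnz: "plucker bs Is \<noteq> 0"
    proof
      assume "plucker bs Is = 0"
      then have "rpoly_eval (plucker bs) f = 0" unfolding f_def eval_chart_rpoly[OF J'] by simp
      then show False using bs(2) by simp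
    qed
    define A where "A e = plucker bs (subst_index (fst e) (snd e) Is) / plucker bs Is" for e
    have "rpoly_eval (plucker bs) f = plucker bs Is ^ Suc (card (set Is \<times> J) * K) * g A"
      using pnz by (intro eval) (auto simp: A_def)
    then have gA: "g A \<noteq> 0" using bs(2) by auto
    have "set bs \<subseteq> chart_space I J A"
    proof
      fix X assume X: "X \<in> set bs"
      then obtain a where a: "a < length bs" "X = bs ! a" by (auto simp: set_conv_nth)
      have "X \<in> L" using span_base[OF X] bs(1) by (simp only: ordered_basis_def)
      then have "X \<in> Sym" using LGr(2) by blast
      moreover have "entry X l = (\<Sum>q\<in>I. entry X q * A (q, l))" for l
        using plucker_nonzero_relation[OF Is(2) _ pnz a(1), of l] lenIs lenb a(2) by (simp add: A_def Is(1))
      ultimately show "X \<in> chart_space I J A" unfolding chart_space_def by blast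
    qed
    then have "span (set bs) \<subseteq> chart_space I J A"
      by (rule span_minimal[OF _ subspace_chart[OF IJ]])
    then have "L \<subseteq> chart_space I J A" using bs(1) by (simp only: ordered_basis_def)
    moreover have "dim (chart_space I J A) \<le> dim L"
      using dim_chart[OF IJ, of A] LGr(3) I(3) by linarith
    ultimately have Leq: "L = chart_space I J A"
      by (rule subspace_dim_equal[OF LGr(1) subspace_chart[OF IJ]])
    interpret transversal_subspace L
    proof
      show "subspace L" "L \<subseteq> Sym" by (rule LGr)+
      show "X = 0 \<or> N = 0" if "X \<in> L" "N \<in> sym_perp L" "X ** N = 0" for X N
        using detect[of A X N] that gA by (simp add: Leq g_def)
    qed
    have dn: "d < CARD('n)" using bounds(2) n by simp
    have "dim (sym_perp L) + m = (n + 1) choose 2"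
      using sym_perp_dim[OF LGr(1,2)] LGr(3) by (simp add: dim_Sym n)
    then have "dim (sym_perp L) < (n - d + 1) choose 2" using bounds(3) by linarith
    then show ?thesis
      using open_set_of_kernels[OF refl dn _ LGr(4)] by (simp add: n)
  qed
  show ?thesis
    by (rule exI[of _ "G \<inter> Z"]) (use closed proper good in blast)
qed

end
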